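(* $\mathsf{ZF}+\mathsf{DC}$ proves that for every notion of forcing $\mathbb P$, $\mathbb P$ satisfies $\mathrm{CCC}_3$ if and only if $\mathbb P$ satisfies Mekler's definition of the countable chain condition, i.e. for all sufficiently large $\kappa$, whenever $M\prec H_\kappa$ is a countable elementary submodel with $\mathbb P\in M$, every condition of $\mathbb P$ is $M$-generic (equivalently, $\mathbf 1_{\mathbb P}$ is $M$-generic).
   Context: $\mathsf{DC}$ is the Principle of Dependent Choice. A notion of forcing is a preordered set $\mathbb P$ with a maximum $\mathbf 1_{\mathbb P}$. Conditions are compatible if they have a common extension. $D\subseteq\mathbb P$ is predense if every $p\in\mathbb P$ is compatible with some member of $D$; $D$ is predense below $q$ if every $p\le q$ is compatible with some member of $D$. $\mathbb P$ is $\mathrm{CCC}_3$ if every predense subset of $\mathbb P$ contains a countable predense subset. In $\mathsf{ZF}$, $H_\kappa$ is the set of those $x$ whose transitive closure does not map onto $\kappa$. For a countable $M\prec H_\kappa$ with $\mathbb P\in M$, a condition $q\in\mathbb P$ is $M$-generic if for every predense $D\subseteq\mathbb P$ with $D\in M$, the set $D\cap M$ is predense below $q$. *)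

theory Defs
  imports Main
begin

text \<open>
  The claim is that a first-order theory proves a sentence. HOL itself has choice, so the theory
  ZF + DC is not replaced by HOL: its axioms and the sentence are objects of a deeply embedded
  first-order logic, and provability is derivability in natural deduction.
\<close>

section \<open>First-order logic with equality over a single binary relation symbol\<close>

text \<open>Variables are de Bruijn indices; they are the only terms of the language.\<close>

datatype fm =
    FMem nat nat
  | FEq nat nat
  | FFalse
  | FImp fm fm
  | FAll fm

primrec ren :: "(nat \<Rightarrow> nat) \<Rightarrow> fm \<Rightarrow> fm" where
  "ren r (FMem i j) = FMem (r i) (r j)"
| "ren r (FEq i j) = FEq (r i) (r j)"
| "ren r FFalse = FFalse"
| "ren r (FImp \<phi> \<psi>) = FImp (ren r \<phi>) (ren r \<psi>)"
| "ren r (FAll \<phi>) = FAll (ren (case_nat 0 (\<lambda>i. Suc (r i))) \<phi>)"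

primrec fv :: "fm \<Rightarrow> nat set" where
  "fv (FMem i j) = {i, j}"
| "fv (FEq i j) = {i, j}"
| "fv FFalse = {}"
| "fv (FImp \<phi> \<psi>) = fv \<phi> \<union> fv \<psi>"
| "fv (FAll \<phi>) = {i. Suc i \<in> fv \<phi>}"

definition lift :: "fm \<Rightarrow> fm" where
  "lift \<phi> = ren Suc \<phi>"

definition inst :: "nat \<Rightarrow> fm \<Rightarrow> fm" where
  "inst n \<phi> = ren (case_nat n (\<lambda>i. i)) \<phi>"

inductive proves :: "fm set \<Rightarrow> fm \<Rightarrow> bool" (infix "\<turnstile>" 5) where
  Assm: "\<phi> \<in> \<Gamma> \<Longrightarrow> \<Gamma> \<turnstile> \<phi>"
| ImpI: "insert \<phi> \<Gamma> \<turnstile> \<psi> \<Longrightarrow> \<Gamma> \<turnstile> FImp \<phi> \<psi>"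
| ImpE: "\<Gamma> \<turnstile> FImp \<phi> \<psi> \<Longrightarrow> \<Gamma> \<turnstile> \<phi> \<Longrightarrow> \<Gamma> \<turnstile> \<psi>"
| Contr: "insert (FImp \<phi> FFalse) \<Gamma> \<turnstile> FFalse \<Longrightarrow> \<Gamma> \<turnstile> \<phi>"
| AllI: "lift ` \<Gamma> \<turnstile> \<phi> \<Longrightarrow> \<Gamma> \<turnstile> FAll \<phi>"
| AllE: "\<Gamma> \<turnstile> FAll \<phi> \<Longrightarrow> \<Gamma> \<turnstile> inst n \<phi>"
| EqRefl: "\<Gamma> \<turnstile> FEq n n"
| EqSubst: "\<Gamma> \<turnstile> FEq m n \<Longrightarrow> \<Gamma> \<turnstile> inst m \<phi> \<Longrightarrow> \<Gamma> \<turnstile> inst n \<phi>"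

section \<open>Formulas in context\<close>

text \<open>
  To write formulas with bound names instead of indices, a formula is presented as a function of
  the number \<open>d\<close> of variables in scope, and a variable as its de Bruijn level: the quantifier
  reached with \<open>d\<close> variables in scope binds level \<open>d\<close>, and level \<open>x\<close> is index \<open>d - 1 - x\<close>.
  A sentence is obtained at \<open>d = 0\<close>.
\<close>

type_synonym var = nat
type_synonym form = "nat \<Rightarrow> fm"

definition fMem :: "var \<Rightarrow> var \<Rightarrow> form" (infix "\<^bold>\<in>" 50) where
  "(x \<^bold>\<in> y) = (\<lambda>d. FMem (d - 1 - x) (d - 1 - y))"

definition fEq :: "var \<Rightarrow> var \<Rightarrow> form" (infix "\<^bold>=" 50) where
  "(x \<^bold>= y) = (\<lambda>d. FEq (d - 1 - x) (d - 1 - y))"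

definition fNot :: "form \<Rightarrow> form" ("\<^bold>\<not> _" [40] 40) where
  "(\<^bold>\<not> \<phi>) = (\<lambda>d. FImp (\<phi> d) FFalse)"

definition fImp :: "form \<Rightarrow> form \<Rightarrow> form" (infixr "\<^bold>\<rightarrow>" 25) where
  "(\<phi> \<^bold>\<rightarrow> \<psi>) = (\<lambda>d. FImp (\<phi> d) (\<psi> d))"

definition fOr :: "form \<Rightarrow> form \<Rightarrow> form" (infixr "\<^bold>\<or>" 30) where
  "(\<phi> \<^bold>\<or> \<psi>) = (\<^bold>\<not> \<phi> \<^bold>\<rightarrow> \<psi>)"

definition fAnd :: "form \<Rightarrow> form \<Rightarrow> form" (infixr "\<^bold>\<and>" 35) where
  "(\<phi> \<^bold>\<and> \<psi>) = (\<^bold>\<not> (\<phi> \<^bold>\<rightarrow> \<^bold>\<not> \<psi>))"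

definition fIff :: "form \<Rightarrow> form \<Rightarrow> form" (infixr "\<^bold>\<leftrightarrow>" 25) where
  "(\<phi> \<^bold>\<leftrightarrow> \<psi>) = ((\<phi> \<^bold>\<rightarrow> \<psi>) \<^bold>\<and> (\<psi> \<^bold>\<rightarrow> \<phi>))"

definition fAll :: "(var \<Rightarrow> form) \<Rightarrow> form" (binder "\<^bold>\<forall>" 10) where
  "fAll \<Phi> = (\<lambda>d. FAll (\<Phi> d (Suc d)))"

definition fEx :: "(var \<Rightarrow> form) \<Rightarrow> form" (binder "\<^bold>\<exists>" 10) where
  "(\<^bold>\<exists>x. \<Phi> x) = (\<^bold>\<not> (\<^bold>\<forall>x. \<^bold>\<not> \<Phi> x))"

definition sentence :: "form \<Rightarrow> fm" where
  "sentence \<Phi> = \<Phi> 0"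

text \<open>The raw formula \<open>\<phi>\<close> with its free index \<open>i\<close> read as the variable \<open>g i\<close>.\<close>

definition fSubst :: "fm \<Rightarrow> (nat \<Rightarrow> var) \<Rightarrow> form" where
  "fSubst \<phi> g = (\<lambda>d. ren (\<lambda>i. d - 1 - g i) \<phi>)"

section \<open>Elementary set-theoretic notions\<close>

definition is_subset :: "var \<Rightarrow> var \<Rightarrow> form" (infix "\<^bold>\<subseteq>" 50) where
  "(x \<^bold>\<subseteq> y) = (\<^bold>\<forall>z. z \<^bold>\<in> x \<^bold>\<rightarrow> z \<^bold>\<in> y)"

definition is_empty :: "var \<Rightarrow> form" where
  "is_empty x = (\<^bold>\<forall>z. \<^bold>\<not> z \<^bold>\<in> x)"

definition is_inter :: "var \<Rightarrow> var \<Rightarrow> var \<Rightarrow> form" where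
  "is_inter u x y = (\<^bold>\<forall>z. z \<^bold>\<in> u \<^bold>\<leftrightarrow> z \<^bold>\<in> x \<^bold>\<and> z \<^bold>\<in> y)"

definition is_upair :: "var \<Rightarrow> var \<Rightarrow> var \<Rightarrow> form" where
  "is_upair u x y = (\<^bold>\<forall>z. z \<^bold>\<in> u \<^bold>\<leftrightarrow> z \<^bold>= x \<^bold>\<or> z \<^bold>= y)"

definition is_opair :: "var \<Rightarrow> var \<Rightarrow> var \<Rightarrow> form" where
  "is_opair p x y = (\<^bold>\<exists>u v. is_upair u x x \<^bold>\<and> is_upair v x y \<^bold>\<and> is_upair p u v)"

definition is_otriple :: "var \<Rightarrow> var \<Rightarrow> var \<Rightarrow> var \<Rightarrow> form" where
  "is_otriple t x y z = (\<^bold>\<exists>p. is_opair p y z \<^bold>\<and> is_opair t x p)"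

definition rel :: "var \<Rightarrow> var \<Rightarrow> var \<Rightarrow> form" where
  "rel R x y = (\<^bold>\<exists>p. is_opair p x y \<^bold>\<and> p \<^bold>\<in> R)"

definition is_relation :: "var \<Rightarrow> var \<Rightarrow> var \<Rightarrow> form" where
  "is_relation R A B =
    (\<^bold>\<forall>p. p \<^bold>\<in> R \<^bold>\<rightarrow> (\<^bold>\<exists>x y. x \<^bold>\<in> A \<^bold>\<and> y \<^bold>\<in> B \<^bold>\<and> is_opair p x y))"

definition is_map :: "var \<Rightarrow> var \<Rightarrow> var \<Rightarrow> form" where
  "is_map f A B = (is_relation f A B \<^bold>\<and>
    (\<^bold>\<forall>x. x \<^bold>\<in> A \<^bold>\<rightarrow> (\<^bold>\<exists>y. rel f x y \<^bold>\<and> (\<^bold>\<forall>z. rel f x z \<^bold>\<rightarrow> z \<^bold>= y))))"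

definition is_injection :: "var \<Rightarrow> var \<Rightarrow> var \<Rightarrow> form" where
  "is_injection f A B = (is_map f A B \<^bold>\<and>
    (\<^bold>\<forall>x y z. rel f x z \<^bold>\<and> rel f y z \<^bold>\<rightarrow> x \<^bold>= y))"

definition is_surjection :: "var \<Rightarrow> var \<Rightarrow> var \<Rightarrow> form" where
  "is_surjection f A B = (is_map f A B \<^bold>\<and> (\<^bold>\<forall>y. y \<^bold>\<in> B \<^bold>\<rightarrow> (\<^bold>\<exists>x. rel f x y)))"

definition is_succ :: "var \<Rightarrow> var \<Rightarrow> form" where
  "is_succ y x = (\<^bold>\<forall>z. z \<^bold>\<in> y \<^bold>\<leftrightarrow> z \<^bold>\<in> x \<^bold>\<or> z \<^bold>= x)"

definition is_inductive :: "var \<Rightarrow> form" where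
  "is_inductive I = ((\<^bold>\<exists>z. is_empty z \<^bold>\<and> z \<^bold>\<in> I) \<^bold>\<and>
    (\<^bold>\<forall>x. x \<^bold>\<in> I \<^bold>\<rightarrow> (\<^bold>\<exists>y. is_succ y x \<^bold>\<and> y \<^bold>\<in> I)))"

definition is_omega :: "var \<Rightarrow> form" where
  "is_omega w = (is_inductive w \<^bold>\<and> (\<^bold>\<forall>I. is_inductive I \<^bold>\<rightarrow> w \<^bold>\<subseteq> I))"

definition is_countable :: "var \<Rightarrow> form" where
  "is_countable x = (\<^bold>\<exists>w f. is_omega w \<^bold>\<and> is_injection f x w)"

definition is_transitive :: "var \<Rightarrow> form" where
  "is_transitive x = (\<^bold>\<forall>y. y \<^bold>\<in> x \<^bold>\<rightarrow> y \<^bold>\<subseteq> x)"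

text \<open>This characterizes the von Neumann ordinals in the presence of Foundation.\<close>

definition is_ordinal :: "var \<Rightarrow> form" where
  "is_ordinal x = (is_transitive x \<^bold>\<and> (\<^bold>\<forall>y. y \<^bold>\<in> x \<^bold>\<rightarrow> is_transitive y))"

text \<open>Without choice, a cardinal \<open>\<kappa>\<close> is an initial ordinal.\<close>

definition is_cardinal :: "var \<Rightarrow> form" where
  "is_cardinal \<kappa> = (is_ordinal \<kappa> \<^bold>\<and>
    (\<^bold>\<forall>\<alpha>. \<alpha> \<^bold>\<in> \<kappa> \<^bold>\<rightarrow> \<^bold>\<not> (\<^bold>\<exists>f. is_injection f \<alpha> \<kappa> \<^bold>\<and> is_surjection f \<alpha> \<kappa>)))"

definition is_trcl :: "var \<Rightarrow> var \<Rightarrow> form" where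
  "is_trcl t x = (is_transitive t \<^bold>\<and> x \<^bold>\<subseteq> t \<^bold>\<and>
    (\<^bold>\<forall>s. is_transitive s \<^bold>\<and> x \<^bold>\<subseteq> s \<^bold>\<rightarrow> t \<^bold>\<subseteq> s))"

definition is_H :: "var \<Rightarrow> var \<Rightarrow> form" where
  "is_H h \<kappa> = (\<^bold>\<forall>x. x \<^bold>\<in> h \<^bold>\<leftrightarrow> \<^bold>\<not> (\<^bold>\<exists>t f. is_trcl t x \<^bold>\<and> is_surjection f t \<kappa>))"

section \<open>The theory ZF + DC\<close>

definition Extensionality :: form where
  "Extensionality = (\<^bold>\<forall>x y. (\<^bold>\<forall>z. z \<^bold>\<in> x \<^bold>\<leftrightarrow> z \<^bold>\<in> y) \<^bold>\<rightarrow> x \<^bold>= y)"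

definition Foundation :: form where
  "Foundation = (\<^bold>\<forall>x. (\<^bold>\<exists>y. y \<^bold>\<in> x) \<^bold>\<rightarrow> (\<^bold>\<exists>y. y \<^bold>\<in> x \<^bold>\<and> \<^bold>\<not> (\<^bold>\<exists>z. z \<^bold>\<in> x \<^bold>\<and> z \<^bold>\<in> y)))"

definition Pairing :: form where
  "Pairing = (\<^bold>\<forall>x y. \<^bold>\<exists>u. is_upair u x y)"

definition Union_ax :: form where
  "Union_ax = (\<^bold>\<forall>x. \<^bold>\<exists>u. \<^bold>\<forall>z. z \<^bold>\<in> u \<^bold>\<leftrightarrow> (\<^bold>\<exists>y. y \<^bold>\<in> x \<^bold>\<and> z \<^bold>\<in> y))"

definition Power_set :: form where
  "Power_set = (\<^bold>\<forall>x. \<^bold>\<exists>u. \<^bold>\<forall>z. z \<^bold>\<in> u \<^bold>\<leftrightarrow> z \<^bold>\<subseteq> x)"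

definition Infinity :: form where
  "Infinity = (\<^bold>\<exists>I. is_inductive I)"

text \<open>
  In an instance with \<open>n\<close> parameters, the parameters are the levels \<open>0, \<dots>, n - 1\<close>. Index 0 of
  \<open>\<phi>\<close> (for Replacement: indices 0 and 1) stands for the distinguished variable, the following
  indices for the parameters.
\<close>

definition Separation :: "fm \<Rightarrow> form" where
  "Separation \<phi> = (\<^bold>\<forall>a. \<^bold>\<exists>b. \<^bold>\<forall>x. x \<^bold>\<in> b \<^bold>\<leftrightarrow> x \<^bold>\<in> a \<^bold>\<and> fSubst \<phi> (case_nat x (\<lambda>k. k)))"

definition Replacement :: "fm \<Rightarrow> form" where
  "Replacement \<phi> =
    (let \<Phi> = (\<lambda>x y. fSubst \<phi> (case_nat x (case_nat y (\<lambda>k. k)))) in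
     \<^bold>\<forall>a. (\<^bold>\<forall>x y z. x \<^bold>\<in> a \<^bold>\<and> \<Phi> x y \<^bold>\<and> \<Phi> x z \<^bold>\<rightarrow> y \<^bold>= z) \<^bold>\<rightarrow>
       (\<^bold>\<exists>b. \<^bold>\<forall>y. y \<^bold>\<in> b \<^bold>\<leftrightarrow> (\<^bold>\<exists>x. x \<^bold>\<in> a \<^bold>\<and> \<Phi> x y)))"

definition ZF :: "fm set" where
  "ZF = sentence ` {Extensionality, Foundation, Pairing, Union_ax, Power_set, Infinity}
      \<union> {(FAll ^^ n) (Separation \<phi> n) | \<phi> n. fv \<phi> \<subseteq> {..<n + 1}}
      \<union> {(FAll ^^ n) (Replacement \<phi> n) | \<phi> n. fv \<phi> \<subseteq> {..<n + 2}}"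

definition Dependent_Choice :: form where
  "Dependent_Choice = (\<^bold>\<forall>A R w. is_omega w \<^bold>\<and> (\<^bold>\<exists>x. x \<^bold>\<in> A) \<^bold>\<and>
      (\<^bold>\<forall>x. x \<^bold>\<in> A \<^bold>\<rightarrow> (\<^bold>\<exists>y. y \<^bold>\<in> A \<^bold>\<and> rel R x y)) \<^bold>\<rightarrow>
    (\<^bold>\<exists>f. is_map f w A \<^bold>\<and>
      (\<^bold>\<forall>n m x y. n \<^bold>\<in> w \<^bold>\<and> is_succ m n \<^bold>\<and> rel f n x \<^bold>\<and> rel f m y \<^bold>\<rightarrow> rel R x y)))"

definition ZF_DC :: "fm set" where
  "ZF_DC = insert (sentence Dependent_Choice) ZF"

section \<open>Elementary submodels, inside set theory\<close>

text \<open>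
  The notion of an elementary submodel is a notion of ZF, so formulas and satisfaction are coded
  as sets. The codes of \<open>v\<^sub>i \<in> v\<^sub>j\<close>, \<open>v\<^sub>i = v\<^sub>j\<close>, \<open>\<not> (\<phi> \<and> \<psi>)\<close> and \<open>\<exists>v\<^sub>i. \<phi>\<close> are the triples
  \<open>(0, i, j)\<close>, \<open>(1, i, j)\<close>, \<open>(2, \<phi>, \<psi>)\<close> and \<open>(3, i, \<phi>)\<close>; assignments are maps from \<open>\<omega>\<close>.
\<close>

primrec is_numeral :: "nat \<Rightarrow> var \<Rightarrow> form" where
  "is_numeral 0 x = is_empty x"
| "is_numeral (Suc n) x = (\<^bold>\<exists>y. is_numeral n y \<^bold>\<and> is_succ x y)"

definition is_code :: "nat \<Rightarrow> var \<Rightarrow> var \<Rightarrow> var \<Rightarrow> form" where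
  "is_code k u a b = (\<^bold>\<exists>t. is_numeral k t \<^bold>\<and> is_otriple u t a b)"

definition formula_closed :: "var \<Rightarrow> form" where
  "formula_closed F = (\<^bold>\<exists>w. is_omega w \<^bold>\<and>
    (\<^bold>\<forall>i j u. i \<^bold>\<in> w \<^bold>\<and> j \<^bold>\<in> w \<^bold>\<and> is_code 0 u i j \<^bold>\<rightarrow> u \<^bold>\<in> F) \<^bold>\<and>
    (\<^bold>\<forall>i j u. i \<^bold>\<in> w \<^bold>\<and> j \<^bold>\<in> w \<^bold>\<and> is_code 1 u i j \<^bold>\<rightarrow> u \<^bold>\<in> F) \<^bold>\<and>
    (\<^bold>\<forall>\<phi> \<psi> u. \<phi> \<^bold>\<in> F \<^bold>\<and> \<psi> \<^bold>\<in> F \<^bold>\<and> is_code 2 u \<phi> \<psi> \<^bold>\<rightarrow> u \<^bold>\<in> F) \<^bold>\<and>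
    (\<^bold>\<forall>i \<phi> u. i \<^bold>\<in> w \<^bold>\<and> \<phi> \<^bold>\<in> F \<^bold>\<and> is_code 3 u i \<phi> \<^bold>\<rightarrow> u \<^bold>\<in> F))"

definition is_formula :: "var \<Rightarrow> form" where
  "is_formula u = (\<^bold>\<forall>F. formula_closed F \<^bold>\<rightarrow> u \<^bold>\<in> F)"

definition is_assignment :: "var \<Rightarrow> var \<Rightarrow> form" where
  "is_assignment s A = (\<^bold>\<exists>w. is_omega w \<^bold>\<and> is_map s w A)"

definition is_update :: "var \<Rightarrow> var \<Rightarrow> var \<Rightarrow> var \<Rightarrow> form" where
  "is_update s' s i a =
    (\<^bold>\<forall>p. p \<^bold>\<in> s' \<^bold>\<leftrightarrow> is_opair p i a \<^bold>\<or> (p \<^bold>\<in> s \<^bold>\<and> \<^bold>\<not> (\<^bold>\<exists>y. is_opair p i y)))"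

text \<open>\<open>T\<close> obeys Tarski's clauses for the structure \<open>(A, \<in>)\<close>; ZF proves that such a \<open>T\<close> exists and
  is determined on pairs of a formula and an assignment.\<close>

definition is_satrel :: "var \<Rightarrow> var \<Rightarrow> form" where
  "is_satrel T A = (\<^bold>\<exists>w. is_omega w \<^bold>\<and> (\<^bold>\<forall>s. is_assignment s A \<^bold>\<rightarrow>
    (\<^bold>\<forall>i j u. i \<^bold>\<in> w \<^bold>\<and> j \<^bold>\<in> w \<^bold>\<and> is_code 0 u i j \<^bold>\<rightarrow>
      (rel T u s \<^bold>\<leftrightarrow> (\<^bold>\<exists>x y. rel s i x \<^bold>\<and> rel s j y \<^bold>\<and> x \<^bold>\<in> y))) \<^bold>\<and>
    (\<^bold>\<forall>i j u. i \<^bold>\<in> w \<^bold>\<and> j \<^bold>\<in> w \<^bold>\<and> is_code 1 u i j \<^bold>\<rightarrow>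
      (rel T u s \<^bold>\<leftrightarrow> (\<^bold>\<exists>x y. rel s i x \<^bold>\<and> rel s j y \<^bold>\<and> x \<^bold>= y))) \<^bold>\<and>
    (\<^bold>\<forall>\<phi> \<psi> u. is_formula \<phi> \<^bold>\<and> is_formula \<psi> \<^bold>\<and> is_code 2 u \<phi> \<psi> \<^bold>\<rightarrow>
      (rel T u s \<^bold>\<leftrightarrow> \<^bold>\<not> (rel T \<phi> s \<^bold>\<and> rel T \<psi> s))) \<^bold>\<and>
    (\<^bold>\<forall>i \<phi> u. i \<^bold>\<in> w \<^bold>\<and> is_formula \<phi> \<^bold>\<and> is_code 3 u i \<phi> \<^bold>\<rightarrow>
      (rel T u s \<^bold>\<leftrightarrow> (\<^bold>\<exists>a s'. a \<^bold>\<in> A \<^bold>\<and> is_update s' s i a \<^bold>\<and> rel T \<phi> s')))))"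

definition satisfies :: "var \<Rightarrow> var \<Rightarrow> var \<Rightarrow> form" where
  "satisfies A u s = (\<^bold>\<exists>T. is_satrel T A \<^bold>\<and> rel T u s)"

definition elementary_submodel :: "var \<Rightarrow> var \<Rightarrow> form" (infix "\<^bold>\<prec>" 50) where
  "(M \<^bold>\<prec> N) = ((\<^bold>\<exists>x. x \<^bold>\<in> M) \<^bold>\<and> M \<^bold>\<subseteq> N \<^bold>\<and>
    (\<^bold>\<forall>u s. is_formula u \<^bold>\<and> is_assignment s M \<^bold>\<rightarrow> (satisfies M u s \<^bold>\<leftrightarrow> satisfies N u s)))"

section \<open>Forcing\<close>

text \<open>A notion of forcing is the triple \<open>\<P> = (P, R, e)\<close>, where \<open>p \<le> q\<close> is \<open>rel R p q\<close> and \<open>e\<close> is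
  the maximum.\<close>

definition is_forcing :: "var \<Rightarrow> var \<Rightarrow> var \<Rightarrow> var \<Rightarrow> form" where
  "is_forcing \<P> P R e = (is_otriple \<P> P R e \<^bold>\<and> is_relation R P P \<^bold>\<and>
    (\<^bold>\<forall>p. p \<^bold>\<in> P \<^bold>\<rightarrow> rel R p p) \<^bold>\<and>
    (\<^bold>\<forall>p q r. rel R p q \<^bold>\<and> rel R q r \<^bold>\<rightarrow> rel R p r) \<^bold>\<and>
    e \<^bold>\<in> P \<^bold>\<and> (\<^bold>\<forall>p. p \<^bold>\<in> P \<^bold>\<rightarrow> rel R p e))"

definition compatible :: "var \<Rightarrow> var \<Rightarrow> var \<Rightarrow> var \<Rightarrow> form" where
  "compatible P R p q = (\<^bold>\<exists>r. r \<^bold>\<in> P \<^bold>\<and> rel R r p \<^bold>\<and> rel R r q)"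

definition predense :: "var \<Rightarrow> var \<Rightarrow> var \<Rightarrow> form" where
  "predense P R D = (D \<^bold>\<subseteq> P \<^bold>\<and>
    (\<^bold>\<forall>p. p \<^bold>\<in> P \<^bold>\<rightarrow> (\<^bold>\<exists>d. d \<^bold>\<in> D \<^bold>\<and> compatible P R p d)))"

definition predense_below :: "var \<Rightarrow> var \<Rightarrow> var \<Rightarrow> var \<Rightarrow> form" where
  "predense_below P R D q = (D \<^bold>\<subseteq> P \<^bold>\<and>
    (\<^bold>\<forall>p. p \<^bold>\<in> P \<^bold>\<and> rel R p q \<^bold>\<rightarrow> (\<^bold>\<exists>d. d \<^bold>\<in> D \<^bold>\<and> compatible P R p d)))"

definition CCC3 :: "var \<Rightarrow> var \<Rightarrow> form" where
  "CCC3 P R = (\<^bold>\<forall>D. predense P R D \<^bold>\<rightarrow>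
    (\<^bold>\<exists>C. C \<^bold>\<subseteq> D \<^bold>\<and> is_countable C \<^bold>\<and> predense P R C))"

definition is_generic :: "var \<Rightarrow> var \<Rightarrow> var \<Rightarrow> var \<Rightarrow> form" where
  "is_generic P R M q = (\<^bold>\<forall>D. predense P R D \<^bold>\<and> D \<^bold>\<in> M \<^bold>\<rightarrow>
    (\<^bold>\<exists>C. is_inter C D M \<^bold>\<and> predense_below P R C q))"

definition suitable_model :: "var \<Rightarrow> var \<Rightarrow> var \<Rightarrow> form" where
  "suitable_model \<P> \<kappa> M = (is_countable M \<^bold>\<and> \<P> \<^bold>\<in> M \<^bold>\<and> (\<^bold>\<exists>h. is_H h \<kappa> \<^bold>\<and> M \<^bold>\<prec> h))"

definition Mekler_CCC :: "var \<Rightarrow> var \<Rightarrow> var \<Rightarrow> form" where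
  "Mekler_CCC \<P> P R = (\<^bold>\<exists>\<kappa>\<^sub>0. is_cardinal \<kappa>\<^sub>0 \<^bold>\<and>
    (\<^bold>\<forall>\<kappa>. is_cardinal \<kappa> \<^bold>\<and> \<kappa>\<^sub>0 \<^bold>\<subseteq> \<kappa> \<^bold>\<rightarrow>
      (\<^bold>\<forall>M. suitable_model \<P> \<kappa> M \<^bold>\<rightarrow> (\<^bold>\<forall>q. q \<^bold>\<in> P \<^bold>\<rightarrow> is_generic P R M q))))"

end

theory Submission
  imports Defs "HOL-Library.Countable" "HOL-Library.Infinite_Set"
begin

text \<open>
  By completeness of the deduction system it suffices to argue in an arbitrary model of ZF + DC;
  Separation and Replacement are then available for predicates definable with parameters.

  If \<open>C\<close> is a countable predense subset of \<open>D \<in> M\<close>, then by elementarity \<open>M\<close> contains such a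
  \<open>C\<close> together with an injection of \<open>C\<close> into \<open>\<omega>\<close>. Since \<open>\<omega> \<subseteq> M\<close>, this gives \<open>C \<subseteq> D \<inter> M\<close>, so
  \<open>D \<inter> M\<close> is predense. Conversely, given a predense \<open>D\<close>, the Loewenheim--Skolem theorem, which
  needs only DC, provides a countable \<open>M \<prec> H\<^sub>\<kappa>\<close> containing \<open>\<P>\<close> and \<open>D\<close>, and \<open>D \<inter> M\<close> is a countable
  predense subset of \<open>D\<close>. A cardinal \<open>\<kappa>\<close> is large enough if a transitive set containing the relevant
  objects does not map onto it.
\<close>

section \<open>Completeness of the deduction system\<close>

primrec sat :: "'a set \<Rightarrow> ('a \<Rightarrow> 'a \<Rightarrow> bool) \<Rightarrow> (nat \<Rightarrow> 'a) \<Rightarrow> fm \<Rightarrow> bool" where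
  "sat D E e (FMem i j) = E (e i) (e j)"
| "sat D E e (FEq i j) = (e i = e j)"
| "sat D E e FFalse = False"
| "sat D E e (FImp \<phi> \<psi>) = (sat D E e \<phi> \<longrightarrow> sat D E e \<psi>)"
| "sat D E e (FAll \<phi>) = (\<forall>a\<in>D. sat D E (case_nat a e) \<phi>)"

lemma sat_ren: "sat D E e (ren r \<phi>) = sat D E (\<lambda>i. e (r i)) \<phi>"
proof (induction \<phi> arbitrary: e r)
  case (FAll \<phi>)
  have "(\<lambda>i. case_nat a e (case_nat 0 (\<lambda>i. Suc (r i)) i)) = case_nat a (\<lambda>i. e (r i))" for a
    by (auto split: nat.split)
  then show ?case by (simp add: FAll)
qed auto

lemma sat_cong_fv: "(\<And>i. i \<in> fv \<phi> \<Longrightarrow> e i = e' i) \<Longrightarrow> sat D E e \<phi> = sat D E e' \<phi>"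
proof (induction \<phi> arbitrary: e e')
  case (FImp \<phi> \<psi>)
  have "sat D E e \<phi> = sat D E e' \<phi>" "sat D E e \<psi> = sat D E e' \<psi>"
    using FImp.prems by (auto intro!: FImp.IH)
  then show ?case by simp
next
  case (FAll \<phi>)
  have "sat D E (case_nat a e) \<phi> = sat D E (case_nat a e') \<phi>" for a
    by (rule FAll.IH) (use FAll.prems in \<open>auto split: nat.split\<close>)
  then show ?case by simp
qed auto

text \<open>Reindexes a model so that its domain becomes a whole type and its quantifiers become
  those of HOL. Injectivity of \<open>f\<close> is what preserves equations.\<close>

lemma sat_transfer:
  assumes "inj f" "range f = D"
  shows "sat D E (\<lambda>i. f (e i)) \<phi> = sat UNIV (\<lambda>x y. E (f x) (f y)) e \<phi>"
proof (induction \<phi> arbitrary: e)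
  case (FAll \<phi>)
  have "case_nat (f a) (\<lambda>i. f (e i)) = (\<lambda>i. f (case_nat a e i))" for a
    by (auto split: nat.split)
  then show ?case using FAll assms(2) by auto
qed (use assms(1) in \<open>auto simp: inj_def\<close>)

section \<open>Renaming of variables in formulas and derivations\<close>

lemma ren_ren: "ren r (ren s \<phi>) = ren (\<lambda>i. r (s i)) \<phi>"
proof (induction \<phi> arbitrary: r s)
  case (FAll \<phi>)
  have "(\<lambda>i. case_nat 0 (\<lambda>i. Suc (r i)) (case_nat 0 (\<lambda>i. Suc (s i)) i))
      = case_nat 0 (\<lambda>i. Suc (r (s i)))"
    by (auto split: nat.split)
  then show ?case by (simp add: FAll)
qed auto

lemma ren_cong_fv: "(\<And>i. i \<in> fv \<phi> \<Longrightarrow> r i = s i) \<Longrightarrow> ren r \<phi> = ren s \<phi>"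
proof (induction \<phi> arbitrary: r s)
  case (FImp \<phi> \<psi>)
  have "ren r \<phi> = ren s \<phi>" "ren r \<psi> = ren s \<psi>"
    using FImp.prems by (auto intro!: FImp.IH)
  then show ?case by simp
next
  case (FAll \<phi>)
  have "ren (case_nat 0 (\<lambda>i. Suc (r i))) \<phi> = ren (case_nat 0 (\<lambda>i. Suc (s i))) \<phi>"
    by (rule FAll.IH) (use FAll.prems in \<open>auto split: nat.split\<close>)
  then show ?case by simp
qed auto

lemma ren_id: "ren (\<lambda>i. i) \<phi> = \<phi>"
proof (induction \<phi>)
  case (FAll \<phi>)
  have "case_nat 0 (\<lambda>i. Suc i) = (\<lambda>i. i)" by (auto split: nat.split)
  then show ?case by (simp add: FAll)
qed auto

lemma finite_fv: "finite (fv \<phi>)"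
proof (induction \<phi>)
  case (FAll \<phi>)
  have "fv (FAll \<phi>) = Suc -` fv \<phi>" by auto
  then show ?case using FAll by (simp add: finite_vimageI)
qed auto

lemma fv_ren: "fv (ren r \<phi>) = r ` fv \<phi>"
proof (induction \<phi> arbitrary: r)
  case (FAll \<phi>)
  show ?case
    by (auto simp: FAll split: nat.splits)
qed auto

lemma ren_inst: "ren r (inst n \<phi>) = inst (r n) (ren (case_nat 0 (\<lambda>i. Suc (r i))) \<phi>)"
proof -
  have "(\<lambda>i. r (case_nat n (\<lambda>i. i) i))
      = (\<lambda>i. case_nat (r n) (\<lambda>i. i) (case_nat 0 (\<lambda>i. Suc (r i)) i))"
    by (auto split: nat.split)
  then show ?thesis by (simp add: inst_def ren_ren)
qed

lemma inst_ren: "inst n (ren (case_nat 0 (\<lambda>i. Suc (r i))) \<phi>) = ren (case_nat n r) \<phi>"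
proof -
  have "(\<lambda>i. case_nat n (\<lambda>i. i) (case_nat 0 (\<lambda>i. Suc (r i)) i)) = case_nat n r"
    by (auto split: nat.split)
  then show ?thesis by (simp add: inst_def ren_ren)
qed

lemma ren_lift: "ren (case_nat 0 (\<lambda>i. Suc (r i))) (lift \<phi>) = lift (ren r \<phi>)"
  by (simp add: lift_def ren_ren)

lemma proves_weaken: "\<Gamma> \<turnstile> \<phi> \<Longrightarrow> \<Gamma> \<subseteq> \<Delta> \<Longrightarrow> \<Delta> \<turnstile> \<phi>"
proof (induction arbitrary: \<Delta> rule: proves.induct)
  case (ImpI \<phi> \<Gamma> \<psi>)
  then show ?case by (meson insert_mono proves.ImpI)
next
  case (Contr \<phi> \<Gamma>)
  then show ?case by (meson insert_mono proves.Contr)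
next
  case (AllI \<Gamma> \<phi>)
  then show ?case by (meson image_mono proves.AllI)
qed (blast intro: proves.intros)+

text \<open>Every rule is stable under renaming, injective or not. The induction runs over all
  \<open>r\<close> because \<open>AllI\<close> needs the renaming that fixes the new index 0 and
  acts as \<open>r\<close> above it.\<close>

lemma proves_ren: "\<Gamma> \<turnstile> \<phi> \<Longrightarrow> ren r ` \<Gamma> \<turnstile> ren r \<phi>"
proof (induction arbitrary: r rule: proves.induct)
  case (ImpI \<phi> \<Gamma> \<psi>)
  then show ?case by (simp add: proves.ImpI)
next
  case (ImpE \<Gamma> \<phi> \<psi>)
  then show ?case by (metis proves.ImpE ren.simps(4))
next
  case (Contr \<phi> \<Gamma>)
  then show ?case by (simp add: proves.Contr)
next
  case (AllI \<Gamma> \<phi>)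
  show ?case using AllI.IH[of "case_nat 0 (\<lambda>i. Suc (r i))"]
    by (simp add: image_image ren_lift proves.AllI)
next
  case (AllE \<Gamma> \<phi> n)
  then show ?case by (simp add: ren_inst proves.AllE)
next
  case (EqSubst \<Gamma> m n \<phi>)
  then show ?case unfolding ren_inst by (metis proves.EqSubst ren.simps(2))
qed (auto intro: proves.intros)

text \<open>Carries consistency over to the union of the Henkin chain: a refutation of the union
  uses finitely many formulas, which all occur at one stage.\<close>

lemma proves_finite: "\<Gamma> \<turnstile> \<phi> \<Longrightarrow> \<exists>\<Delta>\<subseteq>\<Gamma>. finite \<Delta> \<and> (\<Delta> \<turnstile> \<phi>)"
proof (induction rule: proves.induct)
  case (Assm \<phi> \<Gamma>)
  then show ?case by (intro exI[of _ "{\<phi>}"]) (auto intro: proves.Assm)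
next
  case (ImpI \<phi> \<Gamma> \<psi>)
  then obtain \<Delta> where "\<Delta> \<subseteq> insert \<phi> \<Gamma>" "finite \<Delta>" "\<Delta> \<turnstile> \<psi>" by blast
  then show ?case
    by (intro exI[of _ "\<Delta> - {\<phi>}"]) (auto intro!: proves.ImpI elim!: proves_weaken)
next
  case (ImpE \<Gamma> \<phi> \<psi>)
  then obtain \<Delta> \<Delta>' where "\<Delta> \<subseteq> \<Gamma>" "finite \<Delta>" "\<Delta> \<turnstile> FImp \<phi> \<psi>" "\<Delta>' \<subseteq> \<Gamma>" "finite \<Delta>'" "\<Delta>' \<turnstile> \<phi>"
    by blast
  then show ?case
    by (intro exI[of _ "\<Delta> \<union> \<Delta>'"]) (auto intro!: proves.ImpE[of _ \<phi> \<psi>] elim!: proves_weaken)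
next
  case (Contr \<phi> \<Gamma>)
  then obtain \<Delta> where "\<Delta> \<subseteq> insert (FImp \<phi> FFalse) \<Gamma>" "finite \<Delta>" "\<Delta> \<turnstile> FFalse" by blast
  then show ?case
    by (intro exI[of _ "\<Delta> - {FImp \<phi> FFalse}"]) (auto intro!: proves.Contr elim!: proves_weaken)
next
  case (AllI \<Gamma> \<phi>)
  then obtain \<Delta> where "\<Delta> \<subseteq> lift ` \<Gamma>" "finite \<Delta>" "\<Delta> \<turnstile> \<phi>" by blast
  then show ?case by (metis finite_subset_image proves.AllI)
next
  case (EqSubst \<Gamma> m n \<phi>)
  then obtain \<Delta> \<Delta>' where "\<Delta> \<subseteq> \<Gamma>" "finite \<Delta>" "\<Delta> \<turnstile> FEq m n" "\<Delta>' \<subseteq> \<Gamma>" "finite \<Delta>'" "\<Delta>' \<turnstile> inst m \<phi>"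
    by blast
  then show ?case
    by (intro exI[of _ "\<Delta> \<union> \<Delta>'"]) (auto intro!: proves.EqSubst[of _ m n \<phi>] elim!: proves_weaken)
next
  case (EqRefl \<Gamma> n)
  then show ?case by (meson empty_subsetI finite.emptyI proves.EqRefl)
qed (blast intro: proves.intros)+

section \<open>Henkin's construction\<close>

abbreviation neg :: "fm \<Rightarrow> fm" where "neg \<phi> \<equiv> FImp \<phi> FFalse"

definition consistent :: "fm set \<Rightarrow> bool" where
  "consistent \<Gamma> \<longleftrightarrow> \<not> (\<Gamma> \<turnstile> FFalse)"

text \<open>Variables are the only terms of the language, so no constants can be added; variables
  free in no formula of the theory take the role of Henkin constants.\<close>

definition fresh :: "fm set \<Rightarrow> nat set" where
  "fresh \<Gamma> = {k. \<forall>\<phi>\<in>\<Gamma>. k \<notin> fv \<phi>}"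

lemma infinite_fresh_insert: "infinite (fresh \<Gamma>) \<Longrightarrow> infinite (fresh (insert \<phi> \<Gamma>))"
proof -
  have "fresh (insert \<phi> \<Gamma>) = fresh \<Gamma> - fv \<phi>" by (auto simp: fresh_def)
  then show "infinite (fresh \<Gamma>) \<Longrightarrow> ?thesis" by (simp add: finite_fv)
qed

text \<open>The renaming that sends \<open>k\<close> to 0 and shifts everything else acts on
  \<Gamma> as \<open>lift\<close>, since \<open>k\<close> is not free there, and turns
  \<open>inst k \<chi>\<close> back into \<chi>. Thus \<open>AllI\<close> applies to a named
  variable.\<close>

lemma generalize:
  assumes k: "k \<in> fresh \<Gamma>" "k \<notin> fv (FAll \<chi>)" and "\<Gamma> \<turnstile> inst k \<chi>"
  shows "\<Gamma> \<turnstile> FAll \<chi>"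
proof (rule proves.AllI)
  define r where "r = (\<lambda>i. if i = k then 0 else Suc i)"
  have "ren r ` \<Gamma> = lift ` \<Gamma>"
    unfolding lift_def by (intro image_cong refl ren_cong_fv) (use k in \<open>auto simp: r_def fresh_def\<close>)
  moreover have "ren r (inst k \<chi>) = ren (\<lambda>i. i) \<chi>"
    unfolding inst_def ren_ren
    by (rule ren_cong_fv) (use k in \<open>auto simp: r_def split: nat.split\<close>)
  ultimately show "lift ` \<Gamma> \<turnstile> \<chi>"
    using proves_ren[OF assms(3), of r] by (simp add: ren_id)
qed

lemma consistent_insert_neg:
  "consistent \<Gamma> \<Longrightarrow> \<not> consistent (insert \<psi> \<Gamma>) \<Longrightarrow> consistent (insert (neg \<psi>) \<Gamma>)"
  unfolding consistent_def using proves.Contr proves.ImpE proves.ImpI by blast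

instance fm :: countable
  by countable_datatype

text \<open>Applied only after \<open>neg \<psi>\<close> has been added: a universal formula
  declared false must fail at some variable.\<close>

definition witnesses :: "fm set \<Rightarrow> fm \<Rightarrow> fm set" where
  "witnesses \<Gamma> \<psi> = (case \<psi> of
     FAll \<chi> \<Rightarrow> insert (neg (inst (SOME k. k \<in> fresh (insert \<psi> \<Gamma>)) \<chi>)) \<Gamma>
   | _ \<Rightarrow> \<Gamma>)"

definition henkin_step :: "fm set \<Rightarrow> fm \<Rightarrow> fm set" where
  "henkin_step \<Gamma> \<psi> = (if consistent (insert \<psi> \<Gamma>) then insert \<psi> \<Gamma>
     else witnesses (insert (neg \<psi>) \<Gamma>) \<psi>)"

primrec henkin :: "fm set \<Rightarrow> nat \<Rightarrow> fm set" where
  "henkin \<Gamma> 0 = \<Gamma>"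
| "henkin \<Gamma> (Suc n) = henkin_step (henkin \<Gamma> n) (from_nat n)"

text \<open>An inconsistent witness would mean that the instance at a fresh variable is provable,
  hence by \<open>generalize\<close> also the universal formula, whose negation is in \<Gamma>. A
  single formula uses up only finitely many fresh variables.\<close>

lemma witnesses_ok:
  assumes "consistent \<Gamma>" "infinite (fresh \<Gamma>)" "neg \<psi> \<in> \<Gamma>"
  shows "consistent (witnesses \<Gamma> \<psi>) \<and> infinite (fresh (witnesses \<Gamma> \<psi>))"
proof (cases \<psi>)
  case (FAll \<chi>)
  define k where "k = (SOME k. k \<in> fresh (insert \<psi> \<Gamma>))"
  have w: "witnesses \<Gamma> \<psi> = insert (neg (inst k \<chi>)) \<Gamma>"
    by (simp add: witnesses_def FAll k_def)
  have "k \<in> fresh (insert \<psi> \<Gamma>)"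
    unfolding k_def using infinite_fresh_insert[OF assms(2), of \<psi>]
    by (metis infinite_imp_nonempty some_in_eq)
  then have k: "k \<in> fresh \<Gamma>" "k \<notin> fv (FAll \<chi>)" by (auto simp: fresh_def FAll)
  have "consistent (insert (neg (inst k \<chi>)) \<Gamma>)"
  proof (rule ccontr)
    assume "\<not> consistent (insert (neg (inst k \<chi>)) \<Gamma>)"
    then have "\<Gamma> \<turnstile> \<psi>"
      unfolding consistent_def FAll by (auto intro: generalize[OF k] proves.Contr)
    then show False
      using assms(1) proves.ImpE[OF proves.Assm[OF assms(3)]] by (simp add: consistent_def)
  qed
  then show ?thesis using infinite_fresh_insert[OF assms(2)] by (simp add: w)
qed (use assms in \<open>auto simp: witnesses_def\<close>)

lemma henkin_step_ok:
  assumes "consistent \<Gamma>" "infinite (fresh \<Gamma>)"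
  shows "consistent (henkin_step \<Gamma> \<psi>) \<and> infinite (fresh (henkin_step \<Gamma> \<psi>))"
  unfolding henkin_step_def
  by (simp add: assms infinite_fresh_insert consistent_insert_neg witnesses_ok)

lemma henkin_ok:
  assumes "consistent \<Gamma>" "infinite (fresh \<Gamma>)"
  shows "consistent (henkin \<Gamma> n) \<and> infinite (fresh (henkin \<Gamma> n))"
  by (induction n) (use assms in \<open>auto simp: henkin_step_ok\<close>)

lemma witnesses_mono: "\<Gamma> \<subseteq> witnesses \<Gamma> \<psi>"
  by (auto simp: witnesses_def split: fm.split)

lemma henkin_mono: "m \<le> n \<Longrightarrow> henkin \<Gamma> m \<subseteq> henkin \<Gamma> n"
proof (induction n rule: dec_induct)
  case (step n)
  have "henkin \<Gamma> n \<subseteq> henkin \<Gamma> (Suc n)"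
    using witnesses_mono by (fastforce simp: henkin_step_def)
  with step show ?case by blast
qed auto

section \<open>The term model of a complete theory with witnesses\<close>

locale henkin_theory =
  fixes T :: "fm set"
  assumes cons: "consistent T"
    and complete: "\<psi> \<in> T \<or> neg \<psi> \<in> T"
    and wit: "FAll \<chi> \<notin> T \<Longrightarrow> \<exists>k. neg (inst k \<chi>) \<in> T"
begin

lemma closed: "T \<turnstile> \<psi> \<Longrightarrow> \<psi> \<in> T"
  using cons complete[of \<psi>] proves.ImpE[OF proves.Assm[of "neg \<psi>" T]]
  by (auto simp: consistent_def)

lemma neg_iff: "neg \<psi> \<in> T \<longleftrightarrow> \<psi> \<notin> T"
  using cons complete[of \<psi>] proves.ImpE[OF proves.Assm[of "neg \<psi>" T] proves.Assm]
  by (auto simp: consistent_def)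

lemma false_notin: "FFalse \<notin> T"
  using cons proves.Assm by (auto simp: consistent_def)

lemma imp_iff: "FImp \<phi> \<psi> \<in> T \<longleftrightarrow> (\<phi> \<in> T \<longrightarrow> \<psi> \<in> T)"
proof
  show "FImp \<phi> \<psi> \<in> T \<Longrightarrow> \<phi> \<in> T \<longrightarrow> \<psi> \<in> T"
    using closed proves.ImpE[OF proves.Assm proves.Assm] by blast
  assume "\<phi> \<in> T \<longrightarrow> \<psi> \<in> T"
  moreover have "FImp \<phi> \<psi> \<in> T" if "\<psi> \<in> T"
    by (rule closed, rule proves.ImpI, rule proves.Assm) (simp add: that)
  moreover have "FImp \<phi> \<psi> \<in> T" if "neg \<phi> \<in> T"
  proof (rule closed, rule proves.ImpI, rule proves.Contr)
    let ?\<Gamma> = "insert (neg \<psi>) (insert \<phi> T)"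
    show "?\<Gamma> \<turnstile> FFalse"
      by (rule proves.ImpE[of _ \<phi>]) (use that in \<open>auto intro: proves.Assm\<close>)
  qed
  ultimately show "FImp \<phi> \<psi> \<in> T" using neg_iff by blast
qed

lemma all_iff: "FAll \<chi> \<in> T \<longleftrightarrow> (\<forall>k. inst k \<chi> \<in> T)"
  using wit neg_iff closed proves.AllE[OF proves.Assm] by blast

lemma eq_refl: "FEq n n \<in> T"
  by (simp add: closed proves.EqRefl)

lemma eq_subst: "FEq m n \<in> T \<Longrightarrow> inst m \<phi> \<in> T \<Longrightarrow> inst n \<phi> \<in> T"
  by (rule closed, rule proves.EqSubst[OF proves.Assm proves.Assm])

lemma eq_sym: "FEq m n \<in> T \<Longrightarrow> FEq n m \<in> T"
  using eq_subst[of m n "FEq 0 (Suc m)"] eq_refl by (simp add: inst_def)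

lemma eq_trans: "FEq m n \<in> T \<Longrightarrow> FEq n k \<in> T \<Longrightarrow> FEq m k \<in> T"
  using eq_subst[of n k "FEq (Suc m) 0"] by (simp add: inst_def)

lemma mem_cong: "FEq m m' \<in> T \<Longrightarrow> FEq n n' \<in> T \<Longrightarrow> FMem m n \<in> T \<Longrightarrow> FMem m' n' \<in> T"
  using eq_subst[of m m' "FMem 0 (Suc n)"] eq_subst[of n n' "FMem (Suc m') 0"]
  by (simp add: inst_def)

text \<open>Variables that the theory declares equal are identified by passing to the least one, so
  the domain of the term model is a set of natural numbers and no quotient is formed.\<close>

definition rep :: "nat \<Rightarrow> nat" where
  "rep n = (LEAST m. FEq m n \<in> T)"

lemma rep_eq: "FEq (rep n) n \<in> T"
  unfolding rep_def by (rule LeastI[of _ n]) (rule eq_refl)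

lemma rep_iff: "rep m = rep n \<longleftrightarrow> FEq m n \<in> T"
proof
  show "rep m = rep n \<Longrightarrow> FEq m n \<in> T"
    using rep_eq eq_sym eq_trans by metis
  assume "FEq m n \<in> T"
  then have "FEq k m \<in> T \<longleftrightarrow> FEq k n \<in> T" for k using eq_sym eq_trans by metis
  then show "rep m = rep n" by (simp add: rep_def)
qed

text \<open>Every element of the domain is named by a variable, so an assignment amounts to a
  renaming \<open>r\<close>, and a quantifier over the domain becomes the conjunction of all
  instances, which \<open>all_iff\<close> handles.\<close>

lemma truth: "sat (range rep) (\<lambda>a b. FMem a b \<in> T) (\<lambda>i. rep (r i)) \<phi> \<longleftrightarrow> ren r \<phi> \<in> T"
proof (induction \<phi> arbitrary: r)
  case (FMem i j)
  then show ?case using mem_cong rep_eq eq_sym by (simp, metis)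
next
  case (FAll \<phi>)
  have "case_nat (rep n) (\<lambda>i. rep (r i)) = (\<lambda>i. rep (case_nat n r i))" for n
    by (auto split: nat.split)
  then show ?case by (auto simp: FAll all_iff inst_ren)
qed (auto simp: rep_iff false_notin imp_iff)

end

lemma henkin_theory_henkin:
  assumes "consistent \<Gamma>" "infinite (fresh \<Gamma>)"
  shows "henkin_theory (\<Union>n. henkin \<Gamma> n)"
proof
  show "consistent (\<Union>n. henkin \<Gamma> n)"
    unfolding consistent_def
  proof
    assume "(\<Union>n. henkin \<Gamma> n) \<turnstile> FFalse"
    then obtain \<Delta> where \<Delta>: "\<Delta> \<subseteq> (\<Union>n. henkin \<Gamma> n)" "finite \<Delta>" "\<Delta> \<turnstile> FFalse"
      using proves_finite by blast
    have "\<exists>n. \<Delta> \<subseteq> henkin \<Gamma> n" using \<Delta>(2,1)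
    proof (induction \<Delta>)
      case (insert \<phi> \<Delta>)
      then obtain m n where "\<Delta> \<subseteq> henkin \<Gamma> m" "\<phi> \<in> henkin \<Gamma> n" by blast
      then show ?case
        using henkin_mono[of m "max m n" \<Gamma>] henkin_mono[of n "max m n" \<Gamma>]
        by (intro exI[of _ "max m n"]) auto
    qed auto
    then show False
      using \<Delta>(3) henkin_ok[OF assms] proves_weaken unfolding consistent_def by blast
  qed
  \<comment> \<open>Stage \<open>to_nat \<psi>\<close> of the chain is the one that treats \<psi>:
    it is added, or else its negation is, together with a witness if \<psi> is universal.\<close>
  have step: "\<psi> \<in> henkin \<Gamma> (Suc (to_nat \<psi>)) \<or>
      (insert (neg \<psi>) (henkin \<Gamma> (to_nat \<psi>)) \<subseteq> henkin \<Gamma> (Suc (to_nat \<psi>)) \<and>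
       (\<forall>\<chi>. \<psi> = FAll \<chi> \<longrightarrow> (\<exists>k. neg (inst k \<chi>) \<in> henkin \<Gamma> (Suc (to_nat \<psi>)))))" for \<psi>
    using witnesses_mono[of "insert (neg \<psi>) (henkin \<Gamma> (to_nat \<psi>))" \<psi>]
    by (auto simp: henkin_step_def, auto simp: witnesses_def)
  show "\<psi> \<in> (\<Union>n. henkin \<Gamma> n) \<or> neg \<psi> \<in> (\<Union>n. henkin \<Gamma> n)" for \<psi>
    using step[of \<psi>] by blast
  show "\<exists>k. neg (inst k \<chi>) \<in> (\<Union>n. henkin \<Gamma> n)" if "FAll \<chi> \<notin> (\<Union>n. henkin \<Gamma> n)" for \<chi>
    using step[of "FAll \<chi>"] that by blast
qed

text \<open>Testing models on sets of natural numbers is enough, because the term model is of this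
  kind. The environment \<open>e\<close> interprets the free variables.\<close>

theorem completeness:
  fixes \<Gamma> :: "fm set"
  assumes "\<And>(D :: nat set) E e. range e \<subseteq> D \<Longrightarrow> (\<And>\<psi>. \<psi> \<in> \<Gamma> \<Longrightarrow> sat D E e \<psi>) \<Longrightarrow> sat D E e \<phi>"
  shows "\<Gamma> \<turnstile> \<phi>"
proof (rule ccontr)
  assume not: "\<not> (\<Gamma> \<turnstile> \<phi>)"
  \<comment> \<open>Doubling all variables frees the odd ones for use as Henkin witnesses.\<close>
  define d :: "nat \<Rightarrow> nat" where "d = (\<lambda>i. 2 * i)"
  define \<Delta> where "\<Delta> = ren d ` insert (neg \<phi>) \<Gamma>"
  \<comment> \<open>Halving undoes the doubling, so a refutation of \<Delta> is renamed to a
    refutation of \<open>insert (neg \<phi>) \<Gamma>\<close>.\<close>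
  have "ren (\<lambda>i. i div 2) ` \<Delta> = insert (neg \<phi>) \<Gamma>"
    by (simp add: \<Delta>_def image_image ren_ren d_def ren_id del: ren.simps)
  then have "consistent \<Delta>"
    using proves_ren[of \<Delta> FFalse "\<lambda>i. i div 2"] not
    unfolding consistent_def by (auto intro: proves.Contr)
  moreover have "range (\<lambda>i. 2 * i + 1) \<subseteq> fresh \<Delta>"
    by (auto simp: fresh_def \<Delta>_def fv_ren d_def; presburger)
  then have "infinite (fresh \<Delta>)"
    by (rule infinite_super) (auto simp: finite_image_iff inj_def)
  ultimately interpret henkin_theory "\<Union>n. henkin \<Delta> n"
    by (rule henkin_theory_henkin)
  let ?sat = "sat (range rep) (\<lambda>a b. FMem a b \<in> (\<Union>n. henkin \<Delta> n)) (\<lambda>i. rep (d i))"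
  have "henkin \<Delta> 0 \<subseteq> (\<Union>n. henkin \<Delta> n)" by blast
  then have "?sat \<psi>" if "\<psi> \<in> insert (neg \<phi>) \<Gamma>" for \<psi>
    unfolding truth using that by (auto simp: \<Delta>_def)
  then show False using assms[of "\<lambda>i. rep (d i)" "range rep"] by fastforce
qed

section \<open>Evaluating formulas in context\<close>

text \<open>The values \<open>v\<close> are listed by level and a formula reads them by index, hence
  the reversal; indices from \<open>d\<close> on are free in the whole formula and read
  \<open>e\<close>.\<close>

definition lenv :: "nat \<Rightarrow> (nat \<Rightarrow> 'a) \<Rightarrow> (nat \<Rightarrow> 'a) \<Rightarrow> nat \<Rightarrow> 'a" where
  "lenv d v e i = (if i < d then v (d - 1 - i) else e (i - d))"

definition ev :: "'a set \<Rightarrow> ('a \<Rightarrow> 'a \<Rightarrow> bool) \<Rightarrow> (nat \<Rightarrow> 'a) \<Rightarrow> nat \<Rightarrow> (nat \<Rightarrow> 'a) \<Rightarrow> form \<Rightarrow> bool" where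
  "ev D E e d v \<Phi> = sat D E (lenv d v e) (\<Phi> d)"

lemma case_nat_lenv: "case_nat a (lenv d v e) = lenv (Suc d) (v(d := a)) e"
  by (auto simp: lenv_def fun_eq_iff split: nat.split)

lemma lenv_0: "lenv 0 v e = e"
  by (simp add: lenv_def fun_eq_iff)

lemma lenv_level: "x < d \<Longrightarrow> lenv d v e (d - Suc x) = v x"
  by (simp add: lenv_def)

named_theorems evs

lemma ev_mem [evs]: "x < d \<Longrightarrow> y < d \<Longrightarrow> ev D E e d v (x \<^bold>\<in> y) \<longleftrightarrow> E (v x) (v y)"
  by (simp add: ev_def fMem_def lenv_level)

lemma ev_eq [evs]: "x < d \<Longrightarrow> y < d \<Longrightarrow> ev D E e d v (x \<^bold>= y) \<longleftrightarrow> v x = v y"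
  by (simp add: ev_def fEq_def lenv_level)

lemma ev_not [evs]: "ev D E e d v (\<^bold>\<not> \<Phi>) \<longleftrightarrow> \<not> ev D E e d v \<Phi>"
  by (simp add: ev_def fNot_def)

lemma ev_imp [evs]: "ev D E e d v (\<Phi> \<^bold>\<rightarrow> \<Psi>) \<longleftrightarrow> (ev D E e d v \<Phi> \<longrightarrow> ev D E e d v \<Psi>)"
  by (simp add: ev_def fImp_def)

lemma ev_or [evs]: "ev D E e d v (\<Phi> \<^bold>\<or> \<Psi>) \<longleftrightarrow> ev D E e d v \<Phi> \<or> ev D E e d v \<Psi>"
  by (auto simp: fOr_def evs)

lemma ev_and [evs]: "ev D E e d v (\<Phi> \<^bold>\<and> \<Psi>) \<longleftrightarrow> ev D E e d v \<Phi> \<and> ev D E e d v \<Psi>"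
  by (simp add: fAnd_def evs)

lemma ev_iff [evs]: "ev D E e d v (\<Phi> \<^bold>\<leftrightarrow> \<Psi>) \<longleftrightarrow> (ev D E e d v \<Phi> \<longleftrightarrow> ev D E e d v \<Psi>)"
  by (auto simp add: fIff_def evs)

lemma ev_all [evs]: "ev D E e d v (fAll \<Phi>) \<longleftrightarrow> (\<forall>a\<in>D. ev D E e (Suc d) (v(d := a)) (\<Phi> d))"
  by (simp add: ev_def fAll_def case_nat_lenv)

lemma ev_ex [evs]: "ev D E e d v (fEx \<Phi>) \<longleftrightarrow> (\<exists>a\<in>D. ev D E e (Suc d) (v(d := a)) (\<Phi> d))"
  by (simp add: fEx_def evs)

lemma ev_subst:
  assumes "\<And>i. i \<in> fv \<phi> \<Longrightarrow> g i < d"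
  shows "ev D E e d v (fSubst \<phi> g) \<longleftrightarrow> sat D E (\<lambda>i. v (g i)) \<phi>"
  unfolding ev_def fSubst_def sat_ren by (rule sat_cong_fv) (simp add: assms lenv_level)

lemma sat_sentence: "sat D E e (sentence \<Phi>) \<longleftrightarrow> ev D E e 0 v \<Phi>"
  by (simp add: sentence_def ev_def lenv_0)

text \<open>The leading quantifiers of an axiom instance bind the levels below \<open>n\<close>, so
  \<open>v\<close> may supply arbitrary parameters there.\<close>

lemma sat_FAll_funpow: "sat UNIV E e ((FAll ^^ n) \<psi>) \<Longrightarrow> sat UNIV E (lenv n v e) \<psi>"
proof (induction n arbitrary: \<psi>)
  case (Suc n)
  from Suc.prems have "sat UNIV E e ((FAll ^^ n) (FAll \<psi>))" by (simp add: funpow_swap1)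
  from Suc.IH[OF this] have "sat UNIV E (case_nat (v n) (lenv n v e)) \<psi>" by simp
  then show ?case by (simp add: case_nat_lenv)
qed (simp add: lenv_0)

section \<open>Definability with parameters\<close>

named_theorems dfs

definition mix :: "(nat \<Rightarrow> 'a) \<Rightarrow> (nat \<Rightarrow> 'a) \<Rightarrow> nat \<Rightarrow> 'a" where
  "mix e p n = (case sum_decode n of Inl i \<Rightarrow> e i | Inr j \<Rightarrow> p j)"

lemma mix_simps [simp]: "mix e p (sum_encode (Inl i)) = e i" "mix e p (sum_encode (Inr j)) = p j"
  by (auto simp: mix_def)

locale mem_structure =
  fixes E :: "'a \<Rightarrow> 'a \<Rightarrow> bool" (infix "\<E>" 50)
begin

text \<open>A predicate on environments is definable if a formula expresses it, reading the even
  variables from the environment and the odd ones from a fixed list of parameters.\<close>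

definition df :: "((nat \<Rightarrow> 'a) \<Rightarrow> bool) \<Rightarrow> bool" where
  "df P \<longleftrightarrow> (\<exists>\<phi> p. \<forall>e. P e \<longleftrightarrow> sat UNIV E (mix e p) \<phi>)"

text \<open>A class function is definable if its graph is. The value is read at index 0, which
  shifts the environment of the arguments by one.\<close>

definition dfn :: "((nat \<Rightarrow> 'a) \<Rightarrow> 'a) \<Rightarrow> bool" where
  "dfn t \<longleftrightarrow> df (\<lambda>e. e 0 = t (\<lambda>i. e (Suc i)))"

lemma dfI: "(\<And>e. P e \<longleftrightarrow> sat UNIV E (mix e p) \<phi>) \<Longrightarrow> df P"
  unfolding df_def by blast

lemma df_ren: "df P \<Longrightarrow> df (\<lambda>e. P (\<lambda>i. e (r i)))"
proof -
  assume "df P"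
  then obtain \<phi> p where P: "P e \<longleftrightarrow> sat UNIV E (mix e p) \<phi>" for e unfolding df_def by blast
  define s where "s n = (case sum_decode n of Inl i \<Rightarrow> sum_encode (Inl (r i)) | Inr j \<Rightarrow> n)" for n
  have "(\<lambda>n. mix e p (s n)) = mix (\<lambda>i. e (r i)) p" for e
    by (auto simp: fun_eq_iff s_def mix_def split: sum.split)
  then show ?thesis
    by (intro dfI[of _ p "ren s \<phi>"]) (simp add: P sat_ren)
qed

lemma df_imp: "df P \<Longrightarrow> df Q \<Longrightarrow> df (\<lambda>e. P e \<longrightarrow> Q e)"
proof -
  assume "df P" "df Q"
  then obtain \<phi> p \<psi> q where P: "P e \<longleftrightarrow> sat UNIV E (mix e p) \<phi>"
      and Q: "Q e \<longleftrightarrow> sat UNIV E (mix e q) \<psi>" for e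
    unfolding df_def by metis
  \<comment> \<open>The two parameter lists are merged into \<open>mix p q\<close>;
    \<open>s f\<close> keeps the environment variables and redirects each parameter to its place in
    the merged list.\<close>
  define s where "s f n = (case sum_decode n of Inl i \<Rightarrow> n | Inr j \<Rightarrow> sum_encode (Inr (sum_encode (f j))))"
    for f :: "nat \<Rightarrow> nat + nat" and n
  have "(\<lambda>n. mix e (mix p q) (s Inl n)) = mix e p" "(\<lambda>n. mix e (mix p q) (s Inr n)) = mix e q" for e
    by (auto simp: fun_eq_iff s_def split: sum.split) (auto simp: mix_def split: sum.split)
  then show ?thesis
    by (intro dfI[of _ "mix p q" "FImp (ren (s Inl) \<phi>) (ren (s Inr) \<psi>)"]) (simp add: P Q sat_ren)
qed

lemma df_all: "df (\<lambda>e. P (e 0) (\<lambda>i. e (Suc i))) \<Longrightarrow> df (\<lambda>e. \<forall>x. P x e)"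
proof -
  assume "df (\<lambda>e. P (e 0) (\<lambda>i. e (Suc i)))"
  then obtain \<phi> p where P: "P (e 0) (\<lambda>i. e (Suc i)) \<longleftrightarrow> sat UNIV E (mix e p) \<phi>" for e
    unfolding df_def by blast
  have P: "P x e \<longleftrightarrow> sat UNIV E (mix (case_nat x e) p) \<phi>" for x e
    using P[of "case_nat x e"] by simp
  define s where "s n = (case sum_decode n of Inl i \<Rightarrow> (case i of 0 \<Rightarrow> 0 | Suc i \<Rightarrow> Suc (sum_encode (Inl i)))
      | Inr j \<Rightarrow> Suc n)" for n
  have "(\<lambda>n. case_nat x (mix e p) (s n)) = mix (case_nat x e) p" for e x
    by (auto simp: fun_eq_iff s_def mix_def split: sum.split nat.split)
  then show ?thesis
    by (intro dfI[of _ p "FAll (ren s \<phi>)"]) (simp add: P sat_ren)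
qed

lemma df_bool: "df (\<lambda>e. b)"
  by (cases b; intro dfI[where \<phi> = "if b then FImp FFalse FFalse else FFalse"]) auto

lemma df_not: "df P \<Longrightarrow> df (\<lambda>e. \<not> P e)"
  using df_imp[OF _ df_bool[of False]] by simp

lemma df_or: "df P \<Longrightarrow> df Q \<Longrightarrow> df (\<lambda>e. P e \<or> Q e)"
  using df_imp[OF df_not] by (simp add: disj_imp)

lemma df_and: "df P \<Longrightarrow> df Q \<Longrightarrow> df (\<lambda>e. P e \<and> Q e)"
  using df_not[OF df_imp[OF _ df_not]] by simp

lemma df_iff: "df P \<Longrightarrow> df Q \<Longrightarrow> df (\<lambda>e. P e \<longleftrightarrow> Q e)"
  using df_and[OF df_imp df_imp] by (simp add: iff_conv_conj_imp)

lemma df_ex: "df (\<lambda>e. P (e 0) (\<lambda>i. e (Suc i))) \<Longrightarrow> df (\<lambda>e. \<exists>x. P x e)"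
  using df_not[OF df_all[OF df_not]] by simp

lemma dfn_var: "dfn (\<lambda>e. e i)"
  unfolding dfn_def
  by (rule dfI[where \<phi> = "FEq (sum_encode (Inl 0)) (sum_encode (Inl (Suc i)))"]) simp

lemma dfn_const: "dfn (\<lambda>e. c)"
  unfolding dfn_def
  by (rule dfI[where \<phi> = "FEq (sum_encode (Inl 0)) (sum_encode (Inr 0))" and p = "\<lambda>_. c"]) simp

lemma dfn_ren: "dfn t \<Longrightarrow> dfn (\<lambda>e. t (\<lambda>i. e (r i)))"
  unfolding dfn_def using df_ren[of _ "case_nat 0 (\<lambda>i. Suc (r i))"] by fastforce

text \<open>The language has no function symbols, so a class function is substituted by quantifying
  over its value.\<close>

lemma df_subst: "df (\<lambda>e. P (e 0) (\<lambda>i. e (Suc i))) \<Longrightarrow> dfn s \<Longrightarrow> df (\<lambda>e. P (s e) e)"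
  using df_ex[OF df_and, of "\<lambda>x e. x = s e" P] unfolding dfn_def by simp

lemma df_comp1:
  assumes "df (\<lambda>e. Q (e 0))" "dfn s" shows "df (\<lambda>e. Q (s e))"
  using df_subst[of "\<lambda>x e. Q x"] assms by simp

lemma dfn_eq: "dfn t \<Longrightarrow> df (\<lambda>e. e k = t (\<lambda>i. e (r i)))"
  unfolding dfn_def using df_ren[of _ "case_nat k r"] by fastforce

lemma df_comp2:
  assumes "df (\<lambda>e. Q (e 0) (e (Suc 0)))" "dfn s" "dfn t"
  shows "df (\<lambda>e. Q (s e) (t e))"
proof -
  \<comment> \<open>Under the two quantifiers below, the inner \<open>y\<close> is index 0 and
    \<open>x\<close> is index 1, so the arguments of \<open>Q\<close> are first interchanged; the
    truncated difference \<open>Suc 0 - i\<close> does this.\<close>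
  have Q: "df (\<lambda>e. Q (e (Suc 0)) (e 0))"
    using df_ren[OF assms(1), of "\<lambda>i. Suc 0 - i"] by simp
  have "df (\<lambda>e. \<exists>x y. x = s e \<and> y = t e \<and> Q x y)"
    by (intro df_ex df_and Q dfn_eq[where r = "\<lambda>i. Suc (Suc i)"] assms)
  then show ?thesis by simp
qed

lemma df_comp3:
  assumes "df (\<lambda>e. Q (e 0) (e (Suc 0)) (e (Suc (Suc 0))))" "dfn s" "dfn t" "dfn u"
  shows "df (\<lambda>e. Q (s e) (t e) (u e))"
proof -
  have Q: "df (\<lambda>e. Q (e (Suc (Suc 0))) (e (Suc 0)) (e 0))"
    using df_ren[OF assms(1), of "\<lambda>i. Suc (Suc 0) - i"] by simp
  have "df (\<lambda>e. \<exists>x y z. x = s e \<and> y = t e \<and> z = u e \<and> Q x y z)"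
    by (intro df_ex df_and Q dfn_eq[where r = "\<lambda>i. Suc (Suc (Suc i))"] assms)
  then show ?thesis by simp
qed

lemma df_comp4:
  assumes "df (\<lambda>e. Q (e 0) (e (Suc 0)) (e (Suc (Suc 0))) (e (Suc (Suc (Suc 0)))))" "dfn s" "dfn t" "dfn u" "dfn w"
  shows "df (\<lambda>e. Q (s e) (t e) (u e) (w e))"
proof -
  have Q: "df (\<lambda>e. Q (e (Suc (Suc (Suc 0)))) (e (Suc (Suc 0))) (e (Suc 0)) (e 0))"
    using df_ren[OF assms(1), of "\<lambda>i. Suc (Suc (Suc 0)) - i"] by simp
  have "df (\<lambda>e. \<exists>x y z a. x = s e \<and> y = t e \<and> z = u e \<and> a = w e \<and> Q x y z a)"
    by (intro df_ex df_and Q dfn_eq[where r = "\<lambda>i. Suc (Suc (Suc (Suc i)))"] assms)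
  then show ?thesis by simp
qed

lemma df_mem: "dfn s \<Longrightarrow> dfn t \<Longrightarrow> df (\<lambda>e. s e \<E> t e)"
  by (rule df_comp2[where Q = "(\<E>)"])
    (rule dfI[where \<phi> = "FMem (sum_encode (Inl 0)) (sum_encode (Inl (Suc 0)))"], simp)

lemma df_eq: "dfn s \<Longrightarrow> dfn t \<Longrightarrow> df (\<lambda>e. s e = t e)"
  by (rule df_comp2[where Q = "(=)"])
    (rule dfI[where \<phi> = "FEq (sum_encode (Inl 0)) (sum_encode (Inl (Suc 0)))"], simp)

lemma dfn_comp1: "dfn (\<lambda>e. F (e 0)) \<Longrightarrow> dfn s \<Longrightarrow> dfn (\<lambda>e. F (s e))"
  unfolding dfn_def[of "\<lambda>e. F (s e)"]
  by (rule df_comp2[where Q = "\<lambda>x y. x = F y"], simp add: dfn_def) (rule dfn_var, rule dfn_ren)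

lemma dfn_comp2: "dfn (\<lambda>e. F (e 0) (e (Suc 0))) \<Longrightarrow> dfn s \<Longrightarrow> dfn t \<Longrightarrow> dfn (\<lambda>e. F (s e) (t e))"
  unfolding dfn_def[of "\<lambda>e. F (s e) (t e)"]
  by (rule df_comp3[where Q = "\<lambda>x y z. x = F y z"], simp add: dfn_def) (rule dfn_var, (erule dfn_ren)+)

lemma dfn_comp3: "dfn (\<lambda>e. F (e 0) (e (Suc 0)) (e (Suc (Suc 0)))) \<Longrightarrow> dfn s \<Longrightarrow> dfn t \<Longrightarrow> dfn u \<Longrightarrow>
    dfn (\<lambda>e. F (s e) (t e) (u e))"
  unfolding dfn_def[of "\<lambda>e. F (s e) (t e) (u e)"]
  by (rule df_comp4[where Q = "\<lambda>x y z a. x = F y z a"], simp add: dfn_def)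
    (rule dfn_var, (erule dfn_ren)+)

text \<open>Freezing all variables beyond the first two as parameters lets Separation and
  Replacement be applied inside a larger definable context.\<close>

lemma df_fix:
  assumes "df (\<lambda>e. P (e 0) (e (Suc 0)) (\<lambda>i. e (Suc (Suc i))))"
  shows "df (\<lambda>e. P (e 0) (e (Suc 0)) c)"
proof -
  obtain \<phi> p where P: "P (e 0) (e (Suc 0)) (\<lambda>i. e (Suc (Suc i))) \<longleftrightarrow> sat UNIV E (mix e p) \<phi>" for e
    using assms unfolding df_def by blast
  have P: "P x y c \<longleftrightarrow> sat UNIV E (mix (case_nat x (case_nat y c)) p) \<phi>" for x y
    using P[of "case_nat x (case_nat y c)"] by simp
  define s where "s n = (case sum_decode n of
      Inl i \<Rightarrow> (if i < 2 then n else sum_encode (Inr (sum_encode (Inl (i - 2)))))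
    | Inr j \<Rightarrow> sum_encode (Inr (sum_encode (Inr j))))" for n
  have "(\<lambda>n. mix e (mix c p) (s n)) = mix (case_nat (e 0) (case_nat (e (Suc 0)) c)) p" for e
    by (auto simp: fun_eq_iff s_def mix_def numeral_2_eq_2 less_Suc_eq split: sum.split nat.split)
  then show ?thesis
    by (intro dfI[of _ "mix c p" "ren s \<phi>"]) (simp add: P sat_ren)
qed

lemma df_fix1: "df (\<lambda>e. P (e 0) (\<lambda>i. e (Suc i))) \<Longrightarrow> df (\<lambda>e. P (e 0) c)"
  using df_fix[of "\<lambda>x y e. P x e" c] df_ren[of "\<lambda>e. P (e 0) (\<lambda>i. e (Suc i))" "case_nat 0 (\<lambda>i. Suc (Suc i))"]
  by simp

lemmas [dfs] = df_bool df_not df_imp df_and df_or df_iff df_all df_ex df_mem df_eq dfn_var dfn_const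

end

section \<open>Set theory inside a model\<close>

locale zf_dc = mem_structure E for E :: "'a \<Rightarrow> 'a \<Rightarrow> bool" (infix "\<E>" 50) +
  fixes e0 :: "nat \<Rightarrow> 'a"
  assumes models: "\<psi> \<in> ZF_DC \<Longrightarrow> sat UNIV E e0 \<psi>"
begin

lemma axiom: "sentence \<Phi> \<in> ZF_DC \<Longrightarrow> ev UNIV E e0 0 e0 \<Phi>"
  using models sat_sentence by metis

lemma extensionality: "(\<And>z. z \<E> x \<longleftrightarrow> z \<E> y) \<Longrightarrow> x = y"
  using axiom[of Extensionality] by (simp add: ZF_DC_def ZF_def Extensionality_def evs)

lemma foundation: "z \<E> x \<Longrightarrow> \<exists>y. y \<E> x \<and> (\<forall>z. z \<E> y \<longrightarrow> \<not> z \<E> x)"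
  using axiom[of Foundation] by (simp add: ZF_DC_def ZF_def Foundation_def evs) blast

lemma pairing: "\<exists>u. \<forall>z. z \<E> u \<longleftrightarrow> z = x \<or> z = y"
  using axiom[of Pairing] by (simp add: ZF_DC_def ZF_def Pairing_def is_upair_def evs)

lemma union_ax: "\<exists>u. \<forall>z. z \<E> u \<longleftrightarrow> (\<exists>y. y \<E> x \<and> z \<E> y)"
  using axiom[of Union_ax] by (simp add: ZF_DC_def ZF_def Union_ax_def evs)

lemma power_set: "\<exists>u. \<forall>z. z \<E> u \<longleftrightarrow> (\<forall>y. y \<E> z \<longrightarrow> y \<E> x)"
  using axiom[of Power_set] by (simp add: ZF_DC_def ZF_def Power_set_def is_subset_def evs)

lemma infinity: "\<exists>I. (\<exists>z. (\<forall>y. \<not> y \<E> z) \<and> z \<E> I) \<and>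
    (\<forall>x. x \<E> I \<longrightarrow> (\<exists>y. (\<forall>z. z \<E> y \<longleftrightarrow> z \<E> x \<or> z = x) \<and> y \<E> I))"
  using axiom[of Infinity]
  by (simp add: ZF_DC_def ZF_def Infinity_def is_inductive_def is_empty_def is_succ_def evs)

lemma fv_bound: "\<exists>n. fv \<phi> \<subseteq> {..<n + k}"
proof -
  have "fv \<phi> \<subseteq> {..<Suc (Max (insert 0 (fv \<phi>))) + k}"
    using finite_fv[of \<phi>] by (auto simp: less_Suc_eq_le trans_le_add1)
  then show ?thesis by blast
qed

lemma separation:
  assumes "df (\<lambda>e. P (e 0))" shows "\<exists>b. \<forall>x. x \<E> b \<longleftrightarrow> x \<E> a \<and> P x"
proof -
  obtain \<phi> p where P: "P (e 0) \<longleftrightarrow> sat UNIV E (mix e p) \<phi>" for e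
    using assms unfolding df_def by blast
  \<comment> \<open>The schema wants the distinguished variable at index 0 and the parameters after
    it. As \<open>P\<close> depends on \<open>e 0\<close> alone, the environment may be taken
    constant, so all its variables can be merged into index 0.\<close>
  define r where "r m = (case sum_decode m of Inl _ \<Rightarrow> 0 | Inr j \<Rightarrow> Suc j)" for m
  obtain n where n: "fv (ren r \<phi>) \<subseteq> {..<n + 1}" using fv_bound by blast
  then have "(FAll ^^ n) (Separation (ren r \<phi>) n) \<in> ZF_DC" unfolding ZF_DC_def ZF_def by blast
  then have "sat UNIV E (lenv n p e0) (Separation (ren r \<phi>) n)"
    by (intro sat_FAll_funpow models)
  then have ax: "ev UNIV E e0 n p (Separation (ren r \<phi>))" by (simp add: ev_def)
  have sub: "ev UNIV E e0 d v (fSubst (ren r \<phi>) (case_nat x (\<lambda>k. k))) \<longleftrightarrow> P (v x)"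
    if "x < d" "n \<le> d" "\<And>k. k < n \<Longrightarrow> v k = p k" for d v x
  proof -
    have "ev UNIV E e0 d v (fSubst (ren r \<phi>) (case_nat x (\<lambda>k. k)))
        \<longleftrightarrow> sat UNIV E (\<lambda>i. v (case_nat x (\<lambda>k. k) i)) (ren r \<phi>)"
      by (rule ev_subst) (use that n in \<open>force split: nat.split\<close>)
    also have "\<dots> \<longleftrightarrow> sat UNIV E (case_nat (v x) p) (ren r \<phi>)"
      by (rule sat_cong_fv) (use n that in \<open>force split: nat.split\<close>)
    also have "\<dots> \<longleftrightarrow> sat UNIV E (mix (\<lambda>_. v x) p) \<phi>"
    proof -
      have "(\<lambda>i. case_nat (v x) p (r i)) = mix (\<lambda>_. v x) p"
        by (auto simp: fun_eq_iff r_def mix_def split: sum.split)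
      then show ?thesis by (simp add: sat_ren)
    qed
    finally show ?thesis using P[of "\<lambda>_. v x"] by simp
  qed
  show ?thesis
    using ax unfolding Separation_def by (simp add: evs sub)
qed

lemma replacement:
  assumes "df (\<lambda>e. P (e 0) (e (Suc 0)))" and fnl: "\<And>x y z. x \<E> a \<Longrightarrow> P x y \<Longrightarrow> P x z \<Longrightarrow> y = z"
  shows "\<exists>b. \<forall>y. y \<E> b \<longleftrightarrow> (\<exists>x. x \<E> a \<and> P x y)"
proof -
  obtain \<phi> p where P: "P (e 0) (e (Suc 0)) \<longleftrightarrow> sat UNIV E (mix e p) \<phi>" for e
    using assms(1) unfolding df_def by blast
  \<comment> \<open>Index 0 stays the argument; all other environment variables are merged into the
    value at index 1.\<close>
  define r where "r m = (case sum_decode m of Inl i \<Rightarrow> (if i = 0 then 0 else Suc 0) | Inr j \<Rightarrow> Suc (Suc j))" for m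
  obtain n where n: "fv (ren r \<phi>) \<subseteq> {..<n + 2}" using fv_bound by blast
  then have "(FAll ^^ n) (Replacement (ren r \<phi>) n) \<in> ZF_DC" unfolding ZF_DC_def ZF_def by blast
  then have "sat UNIV E (lenv n p e0) (Replacement (ren r \<phi>) n)"
    by (intro sat_FAll_funpow models)
  then have ax: "ev UNIV E e0 n p (Replacement (ren r \<phi>))" by (simp add: ev_def)
  have sub: "ev UNIV E e0 d v (fSubst (ren r \<phi>) (case_nat x (case_nat y (\<lambda>k. k)))) \<longleftrightarrow> P (v x) (v y)"
    if "x < d" "y < d" "n \<le> d" "\<And>k. k < n \<Longrightarrow> v k = p k" for d v x y
  proof -
    have "ev UNIV E e0 d v (fSubst (ren r \<phi>) (case_nat x (case_nat y (\<lambda>k. k))))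
        \<longleftrightarrow> sat UNIV E (\<lambda>i. v (case_nat x (case_nat y (\<lambda>k. k)) i)) (ren r \<phi>)"
      by (rule ev_subst) (use that n in \<open>force split: nat.split\<close>)
    also have "\<dots> \<longleftrightarrow> sat UNIV E (case_nat (v x) (case_nat (v y) p)) (ren r \<phi>)"
      by (rule sat_cong_fv) (use n that in \<open>force split: nat.split\<close>)
    also have "\<dots> \<longleftrightarrow> sat UNIV E (mix (case_nat (v x) (\<lambda>_. v y)) p) \<phi>"
    proof -
      have "(\<lambda>i. case_nat (v x) (case_nat (v y) p) (r i)) = mix (case_nat (v x) (\<lambda>_. v y)) p"
        by (auto simp: fun_eq_iff r_def mix_def split: sum.split nat.split)
      then show ?thesis by (simp add: sat_ren)
    qed
    finally show ?thesis using P[of "case_nat (v x) (\<lambda>_. v y)"] by simp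
  qed
  show ?thesis
    using ax fnl unfolding Replacement_def Let_def by (simp add: evs sub) blast
qed

subsection \<open>Set formation\<close>

definition coll :: "('a \<Rightarrow> bool) \<Rightarrow> 'a" where
  "coll P = (THE b. \<forall>x. x \<E> b \<longleftrightarrow> P x)"

lemma in_coll: "\<exists>b. \<forall>x. x \<E> b \<longleftrightarrow> P x \<Longrightarrow> x \<E> coll P \<longleftrightarrow> P x"
proof -
  assume "\<exists>b. \<forall>x. x \<E> b \<longleftrightarrow> P x"
  then have "\<exists>!b. \<forall>x. x \<E> b \<longleftrightarrow> P x" using extensionality by blast
  from theI'[OF this] show ?thesis by (simp add: coll_def)
qed

text \<open>Existence in every environment is demanded so that being equal to the collected set can
  be expressed by the membership condition.\<close>

lemma dfn_coll:
  assumes "\<And>e. \<exists>b. \<forall>x. x \<E> b \<longleftrightarrow> P x e" "df (\<lambda>e. P (e 0) (\<lambda>i. e (Suc i)))"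
  shows "dfn (\<lambda>e. coll (\<lambda>x. P x e))"
proof -
  have P': "df (\<lambda>e. P (e 0) (\<lambda>i. e (Suc (Suc i))))"
    using df_ren[OF assms(2), of "case_nat 0 (\<lambda>i. Suc (Suc i))"] by simp
  have "df (\<lambda>e. \<forall>x. x \<E> e 0 \<longleftrightarrow> P x (\<lambda>i. e (Suc i)))"
    by (intro dfs P')
  moreover have "(\<forall>x. x \<E> y \<longleftrightarrow> P x e) \<longleftrightarrow> y = coll (\<lambda>x. P x e)" for y e
    using in_coll[OF assms(1)] extensionality by metis
  ultimately show ?thesis by (simp add: dfn_def)
qed

definition Sep :: "'a \<Rightarrow> ('a \<Rightarrow> bool) \<Rightarrow> 'a" where
  "Sep A P = coll (\<lambda>x. x \<E> A \<and> P x)"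

lemma in_Sep: "df (\<lambda>e. P (e 0)) \<Longrightarrow> x \<E> Sep A P \<longleftrightarrow> x \<E> A \<and> P x"
  unfolding Sep_def by (rule in_coll[OF separation])

lemma dfn_Sep [dfs]:
  assumes "df (\<lambda>e. P (e 0) (\<lambda>i. e (Suc i)))" "dfn A"
  shows "dfn (\<lambda>e. Sep (A e) (\<lambda>x. P x e))"
  unfolding Sep_def
  by (rule dfn_coll, rule separation, rule df_fix1[OF assms(1)])
    (intro dfs assms dfn_ren[OF assms(2)])

definition Repl :: "'a \<Rightarrow> ('a \<Rightarrow> 'a) \<Rightarrow> 'a" where
  "Repl A F = coll (\<lambda>y. \<exists>x. x \<E> A \<and> y = F x)"

lemma in_Repl: "dfn (\<lambda>e. F (e 0)) \<Longrightarrow> y \<E> Repl A F \<longleftrightarrow> (\<exists>x. x \<E> A \<and> y = F x)"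
  unfolding Repl_def
  by (rule in_coll, rule replacement) (auto intro!: dfs elim: dfn_comp1)

lemma dfn_Repl [dfs]:
  assumes "dfn (\<lambda>e. F (e 0) (\<lambda>i. e (Suc i)))" "dfn A"
  shows "dfn (\<lambda>e. Repl (A e) (\<lambda>x. F x e))"
  unfolding Repl_def
proof (rule dfn_coll)
  have 1: "df (\<lambda>e. e (Suc 0) = F (e 0) (\<lambda>i. e (Suc (Suc i))))"
    using dfn_eq[OF assms(1), of "Suc 0" "case_nat 0 (\<lambda>i. Suc (Suc i))"] by simp
  from df_fix[OF this] show "\<exists>b. \<forall>y. y \<E> b \<longleftrightarrow> (\<exists>x. x \<E> A e \<and> y = F x e)" for e
    by (rule replacement) auto
  show "df (\<lambda>e. \<exists>x. x \<E> A (\<lambda>i. e (Suc i)) \<and> e 0 = F x (\<lambda>i. e (Suc i)))"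
    by (intro dfs 1 dfn_ren[OF assms(2)])
qed

definition emp :: 'a where "emp = coll (\<lambda>x. False)"

lemma in_emp [simp]: "\<not> x \<E> emp"
proof -
  obtain a where "\<forall>z. \<not> z \<E> a" using infinity by blast
  then show ?thesis unfolding emp_def using in_coll[of "\<lambda>x. False"] by blast
qed

definition upair :: "'a \<Rightarrow> 'a \<Rightarrow> 'a" where "upair x y = coll (\<lambda>z. z = x \<or> z = y)"

lemma in_upair [simp]: "z \<E> upair x y \<longleftrightarrow> z = x \<or> z = y"
  unfolding upair_def by (rule in_coll[OF pairing])

definition union :: "'a \<Rightarrow> 'a" where "union A = coll (\<lambda>z. \<exists>y. y \<E> A \<and> z \<E> y)"

lemma in_union [simp]: "z \<E> union A \<longleftrightarrow> (\<exists>y. y \<E> A \<and> z \<E> y)"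
  unfolding union_def by (rule in_coll[OF union_ax])

definition sub :: "'a \<Rightarrow> 'a \<Rightarrow> bool" where "sub x y \<longleftrightarrow> (\<forall>z. z \<E> x \<longrightarrow> z \<E> y)"

definition power :: "'a \<Rightarrow> 'a" where "power A = coll (\<lambda>z. \<forall>y. y \<E> z \<longrightarrow> y \<E> A)"

lemma in_power [simp]: "z \<E> power A \<longleftrightarrow> sub z A"
  unfolding power_def sub_def by (rule in_coll[OF power_set])

lemma df_sub [dfs]: "dfn s \<Longrightarrow> dfn t \<Longrightarrow> df (\<lambda>e. sub (s e) (t e))"
  by (rule df_comp2[where Q = sub], unfold sub_def) (intro dfs)

lemma dfn_upair [dfs]: "dfn s \<Longrightarrow> dfn t \<Longrightarrow> dfn (\<lambda>e. upair (s e) (t e))"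
  by (rule dfn_comp2[where F = upair], unfold upair_def) (intro dfn_coll pairing dfs)

lemma dfn_union [dfs]: "dfn s \<Longrightarrow> dfn (\<lambda>e. union (s e))"
  by (rule dfn_comp1[where F = union], unfold union_def) (intro dfn_coll union_ax dfs)

lemma dfn_power [dfs]: "dfn s \<Longrightarrow> dfn (\<lambda>e. power (s e))"
  by (rule dfn_comp1[where F = power], unfold power_def) (intro dfn_coll power_set dfs)

definition un :: "'a \<Rightarrow> 'a \<Rightarrow> 'a" where "un x y = union (upair x y)"

lemma in_un [simp]: "z \<E> un x y \<longleftrightarrow> z \<E> x \<or> z \<E> y"
  by (auto simp: un_def)

definition succ :: "'a \<Rightarrow> 'a" where "succ x = un x (upair x x)"

lemma in_succ [simp]: "z \<E> succ x \<longleftrightarrow> z \<E> x \<or> z = x"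
  by (auto simp: succ_def)

definition pair :: "'a \<Rightarrow> 'a \<Rightarrow> 'a" where "pair x y = upair (upair x x) (upair x y)"

lemma upair_eq: "upair a b = upair c d \<longleftrightarrow> a = c \<and> b = d \<or> a = d \<and> b = c"
proof
  assume "upair a b = upair c d"
  then have "z = a \<or> z = b \<longleftrightarrow> z = c \<or> z = d" for z using in_upair by metis
  then show "a = c \<and> b = d \<or> a = d \<and> b = c" by metis
next
  assume "a = c \<and> b = d \<or> a = d \<and> b = c"
  then show "upair a b = upair c d" by (intro extensionality) auto
qed

lemma pair_eq [simp]: "pair a b = pair c d \<longleftrightarrow> a = c \<and> b = d"
  by (auto simp: pair_def upair_eq)

lemma dfn_un [dfs]: "dfn s \<Longrightarrow> dfn t \<Longrightarrow> dfn (\<lambda>e. un (s e) (t e))"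
  unfolding un_def by (intro dfs)

lemma dfn_succ [dfs]: "dfn s \<Longrightarrow> dfn (\<lambda>e. succ (s e))"
  unfolding succ_def by (intro dfs)

lemma dfn_pair [dfs]: "dfn s \<Longrightarrow> dfn t \<Longrightarrow> dfn (\<lambda>e. pair (s e) (t e))"
  unfolding pair_def by (intro dfs)

definition prod :: "'a \<Rightarrow> 'a \<Rightarrow> 'a" where
  "prod A B = Sep (power (power (un A B))) (\<lambda>p. \<exists>x y. x \<E> A \<and> y \<E> B \<and> p = pair x y)"

lemma in_prod: "p \<E> prod A B \<longleftrightarrow> (\<exists>x y. x \<E> A \<and> y \<E> B \<and> p = pair x y)"
proof -
  have "p \<E> prod A B \<longleftrightarrow> p \<E> power (power (un A B)) \<and> (\<exists>x y. x \<E> A \<and> y \<E> B \<and> p = pair x y)"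
    unfolding prod_def by (rule in_Sep) (intro dfs)
  then show ?thesis by (auto simp: sub_def pair_def)
qed

lemma pair_in_prod [simp]: "pair x y \<E> prod A B \<longleftrightarrow> x \<E> A \<and> y \<E> B"
  by (auto simp: in_prod)

lemma dfn_prod [dfs]: "dfn s \<Longrightarrow> dfn t \<Longrightarrow> dfn (\<lambda>e. prod (s e) (t e))"
  by (rule dfn_comp2[where F = prod], unfold prod_def) (intro dfs)

text \<open>The union unpacks the singleton of the value. This makes \<open>app\<close> a total
  definable operation, whether or not \<open>f\<close> is a function at \<open>x\<close>.\<close>

definition app :: "'a \<Rightarrow> 'a \<Rightarrow> 'a" where
  "app f x = union (Sep (union (union f)) (\<lambda>y. pair x y \<E> f))"

lemma in_union_union: "pair x y \<E> f \<Longrightarrow> x \<E> union (union f) \<and> y \<E> union (union f)"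
  unfolding pair_def in_union by (metis in_upair)

lemma app_eq: "pair x y \<E> f \<Longrightarrow> (\<And>z. pair x z \<E> f \<Longrightarrow> z = y) \<Longrightarrow> app f x = y"
proof -
  assume a: "pair x y \<E> f" "\<And>z. pair x z \<E> f \<Longrightarrow> z = y"
  have "z \<E> Sep (union (union f)) (\<lambda>y. pair x y \<E> f) \<longleftrightarrow> z \<E> union (union f) \<and> pair x z \<E> f" for z
    by (rule in_Sep) (intro dfs)
  then have "z \<E> Sep (union (union f)) (\<lambda>y. pair x y \<E> f) \<longleftrightarrow> z = y" for z
    using a in_union_union by blast
  then show ?thesis unfolding app_def by (intro extensionality) simp
qed

lemma dfn_app [dfs]: "dfn s \<Longrightarrow> dfn t \<Longrightarrow> dfn (\<lambda>e. app (s e) (t e))"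
  by (rule dfn_comp2[where F = app], unfold app_def) (intro dfs)

subsection \<open>Functions, well-foundedness, ordinals\<close>

definition funion :: "'a \<Rightarrow> 'a \<Rightarrow> 'a" where
  "funion A g = union (Repl A (app g))"

lemma in_funion: "z \<E> funion A g \<longleftrightarrow> (\<exists>x. x \<E> A \<and> z \<E> app g x)"
proof -
  have "w \<E> Repl A (app g) \<longleftrightarrow> (\<exists>x. x \<E> A \<and> w = app g x)" for w by (rule in_Repl) (intro dfs)
  then show ?thesis unfolding funion_def by auto
qed

lemma dfn_funion [dfs]: "dfn s \<Longrightarrow> dfn t \<Longrightarrow> dfn (\<lambda>e. funion (s e) (t e))"
  by (rule dfn_comp2[where F = funion], unfold funion_def) (intro dfs)

lemma ex_Sep: "df (\<lambda>e. P (e 0)) \<Longrightarrow> (\<And>b. (\<And>x. x \<E> b \<longleftrightarrow> x \<E> A \<and> P x) \<Longrightarrow> thesis) \<Longrightarrow> thesis"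
  using separation[of P A] by blast

definition lam :: "'a \<Rightarrow> ('a \<Rightarrow> 'a) \<Rightarrow> 'a" where
  "lam A F = Repl A (\<lambda>x. pair x (F x))"

lemma dfn_lam [dfs]: "dfn (\<lambda>e. F (e 0) (\<lambda>i. e (Suc i))) \<Longrightarrow> dfn A \<Longrightarrow> dfn (\<lambda>e. lam (A e) (\<lambda>x. F x e))"
  unfolding lam_def by (intro dfs)

lemma in_lam: "dfn (\<lambda>e. F (e 0)) \<Longrightarrow> p \<E> lam A F \<longleftrightarrow> (\<exists>x. x \<E> A \<and> p = pair x (F x))"
  unfolding lam_def by (rule in_Repl) (intro dfs)

lemma app_lam: "dfn (\<lambda>e. F (e 0)) \<Longrightarrow> x \<E> A \<Longrightarrow> app (lam A F) x = F x"
  by (rule app_eq) (auto simp: in_lam)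

lemma lam_cong: "dfn (\<lambda>e. F (e 0)) \<Longrightarrow> dfn (\<lambda>e. G (e 0)) \<Longrightarrow> (\<And>x. x \<E> A \<Longrightarrow> F x = G x) \<Longrightarrow> lam A F = lam A G"
  by (rule extensionality) (auto simp: in_lam)

lemma in_funion_lam: "z \<E> funion A (lam A (app g)) \<longleftrightarrow> (\<exists>x. x \<E> A \<and> z \<E> app g x)"
proof -
  have "app (lam A (app g)) x = app g x" if "x \<E> A" for x using that by (intro app_lam dfs)
  then show ?thesis by (simp add: in_funion cong: conj_cong)
qed

definition isfun :: "'a \<Rightarrow> 'a \<Rightarrow> 'a \<Rightarrow> bool" where
  "isfun f A B \<longleftrightarrow> (\<forall>p. p \<E> f \<longrightarrow> (\<exists>x y. x \<E> A \<and> y \<E> B \<and> p = pair x y)) \<and>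
    (\<forall>x. x \<E> A \<longrightarrow> (\<exists>y. pair x y \<E> f \<and> (\<forall>z. pair x z \<E> f \<longrightarrow> z = y)))"

lemma df_isfun [dfs]: "dfn f \<Longrightarrow> dfn A \<Longrightarrow> dfn B \<Longrightarrow> df (\<lambda>e. isfun (f e) (A e) (B e))"
  by (rule df_comp3[where Q = isfun], unfold isfun_def) (intro dfs)

lemma isfunD: "isfun f A B \<Longrightarrow> pair x y \<E> f \<Longrightarrow> x \<E> A \<and> y \<E> B"
  unfolding isfun_def by fastforce

lemma isfun_unique: "isfun f A B \<Longrightarrow> pair x y \<E> f \<Longrightarrow> pair x z \<E> f \<Longrightarrow> y = z"
  using isfunD[of f A B x y] unfolding isfun_def by metis

lemma isfun_pair: "isfun f A B \<Longrightarrow> pair x y \<E> f \<longleftrightarrow> x \<E> A \<and> y = app f x"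
proof -
  assume f: "isfun f A B"
  have eq: "y = app f x" if "pair x y \<E> f" for y
    using app_eq[OF that] isfun_unique[OF f that] by metis
  have "\<exists>y. pair x y \<E> f" if "x \<E> A" using f that unfolding isfun_def by metis
  then show ?thesis using eq isfunD[OF f] by metis
qed

lemma isfun_app: "isfun f A B \<Longrightarrow> x \<E> A \<Longrightarrow> app f x \<E> B"
  using isfun_pair isfunD by metis

lemma isfunI:
  "(\<And>p. p \<E> f \<Longrightarrow> \<exists>x y. x \<E> A \<and> y \<E> B \<and> p = pair x y) \<Longrightarrow> (\<And>x. x \<E> A \<Longrightarrow> \<exists>y. pair x y \<E> f) \<Longrightarrow>
    (\<And>x y z. pair x y \<E> f \<Longrightarrow> pair x z \<E> f \<Longrightarrow> y = z) \<Longrightarrow> isfun f A B"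
  unfolding isfun_def by metis

lemma isfun_lam: "dfn (\<lambda>e. F (e 0)) \<Longrightarrow> (\<And>x. x \<E> A \<Longrightarrow> F x \<E> B) \<Longrightarrow> isfun (lam A F) A B"
  by (rule isfunI) (auto simp: in_lam)

lemma set_min:
  assumes "df (\<lambda>e. P (e 0))" "a \<E> A" "P a"
  shows "\<exists>x. x \<E> A \<and> P x \<and> (\<forall>y. y \<E> x \<longrightarrow> y \<E> A \<longrightarrow> \<not> P y)"
proof -
  obtain b where b: "x \<E> b \<longleftrightarrow> x \<E> A \<and> P x" for x using ex_Sep[OF assms(1)] by blast
  then have "a \<E> b" using assms by blast
  from foundation[OF this] show ?thesis using b by blast
qed

lemma mem_irrefl: "\<not> x \<E> x"
  using foundation[of x "upair x x"] by auto

lemma mem_asym: "x \<E> y \<Longrightarrow> \<not> y \<E> x"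
  using foundation[of x "upair x y"] by auto

lemma sub_refl [simp]: "sub x x"
  by (simp add: sub_def)

lemma sub_trans: "sub x y \<Longrightarrow> sub y z \<Longrightarrow> sub x z"
  by (simp add: sub_def)

lemma subD: "sub x y \<Longrightarrow> z \<E> x \<Longrightarrow> z \<E> y"
  by (simp add: sub_def)

lemma sub_antisym: "sub x y \<Longrightarrow> sub y x \<Longrightarrow> x = y"
  by (rule extensionality) (auto simp: sub_def)

definition Trans :: "'a \<Rightarrow> bool" where "Trans x \<longleftrightarrow> (\<forall>y. y \<E> x \<longrightarrow> sub y x)"

definition Ord :: "'a \<Rightarrow> bool" where "Ord x \<longleftrightarrow> Trans x \<and> (\<forall>y. y \<E> x \<longrightarrow> Trans y)"

lemma df_Trans [dfs]: "dfn s \<Longrightarrow> df (\<lambda>e. Trans (s e))"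
  by (rule df_comp1[where Q = Trans], unfold Trans_def) (intro dfs)

lemma df_Ord [dfs]: "dfn s \<Longrightarrow> df (\<lambda>e. Ord (s e))"
  by (rule df_comp1[where Q = Ord], unfold Ord_def) (intro dfs)

lemma TransD: "Trans x \<Longrightarrow> y \<E> x \<Longrightarrow> z \<E> y \<Longrightarrow> z \<E> x"
  by (auto simp: Trans_def sub_def)

lemma Ord_mem: "Ord x \<Longrightarrow> y \<E> x \<Longrightarrow> Ord y"
  unfolding Ord_def by (meson TransD)

lemma Ord_Trans: "Ord x \<Longrightarrow> Trans x"
  by (simp add: Ord_def)

text \<open>Take a minimal \<open>x\<close> incomparable with something and then a minimal
  \<open>y\<close> incomparable with \<open>x\<close>: by minimality both have the same elements.
  Working in \<open>succ a\<close> and \<open>succ b\<close> makes \<open>a\<close> and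
  \<open>b\<close> themselves candidates.\<close>

lemma Ord_linear:
  assumes "Ord a" "Ord b" shows "a \<E> b \<or> a = b \<or> b \<E> a"
proof (rule ccontr)
  let ?inc = "\<lambda>x y. \<not> (x \<E> y \<or> x = y \<or> y \<E> x)"
  assume a: "?inc a b"
  have "df (\<lambda>e. \<exists>y. y \<E> succ b \<and> ?inc (e 0) y)" by (intro dfs)
  from set_min[OF this, of a "succ a"] a
  obtain x where x: "x \<E> succ a" "\<exists>y. y \<E> succ b \<and> ?inc x y"
    and minx: "\<forall>z. z \<E> x \<longrightarrow> z \<E> succ a \<longrightarrow> \<not> (\<exists>y. y \<E> succ b \<and> ?inc z y)" by auto
  have "df (\<lambda>e. ?inc x (e 0))" by (intro dfs)
  from set_min[OF this, of _ "succ b"] x(2)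
  obtain y where y: "y \<E> succ b" "?inc x y"
    and miny: "\<forall>z. z \<E> y \<longrightarrow> z \<E> succ b \<longrightarrow> \<not> ?inc x z" by blast
  have Ox: "Trans x" and Oy: "Trans y" using assms x(1) y(1) Ord_mem Ord_Trans by auto
  have xs: "z \<E> x \<Longrightarrow> z \<E> succ a" for z using x(1) assms(1) TransD Ord_Trans by auto
  have ys: "z \<E> y \<Longrightarrow> z \<E> succ b" for z using y(1) assms(2) TransD Ord_Trans by auto
  have "x = y"
  proof (rule extensionality, rule iffI)
    fix z
    show "z \<E> x \<Longrightarrow> z \<E> y" using minx xs y Ox TransD by blast
    show "z \<E> y \<Longrightarrow> z \<E> x" using miny ys y Oy TransD by blast
  qed
  then show False using y by blast
qed

lemma Ord_succ: "Ord x \<Longrightarrow> Ord (succ x)"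
  unfolding Ord_def Trans_def sub_def in_succ by blast

subsection \<open>The natural numbers\<close>

definition indset :: "'a \<Rightarrow> bool" where
  "indset I \<longleftrightarrow> emp \<E> I \<and> (\<forall>x. x \<E> I \<longrightarrow> succ x \<E> I)"

definition omega :: 'a where "omega = coll (\<lambda>n. \<forall>I. indset I \<longrightarrow> n \<E> I)"

lemma df_indset [dfs]: "dfn s \<Longrightarrow> df (\<lambda>e. indset (s e))"
  by (rule df_comp1[where Q = indset], unfold indset_def) (intro dfs)

lemma empI: "(\<And>y. \<not> y \<E> x) \<Longrightarrow> x = emp"
  by (rule extensionality) simp

lemma succI: "(\<And>z. z \<E> y \<longleftrightarrow> z \<E> x \<or> z = x) \<Longrightarrow> y = succ x"
  by (rule extensionality) simp

lemma ex_indset: "\<exists>I. indset I"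
  using infinity empI succI unfolding indset_def by metis

lemma in_omega: "n \<E> omega \<longleftrightarrow> (\<forall>I. indset I \<longrightarrow> n \<E> I)"
proof -
  obtain I where I: "indset I" using ex_indset by blast
  have "df (\<lambda>e. \<forall>I. indset I \<longrightarrow> e 0 \<E> I)" by (intro dfs)
  from separation[OF this, of I] have "\<exists>b. \<forall>n. n \<E> b \<longleftrightarrow> (\<forall>I. indset I \<longrightarrow> n \<E> I)"
    using I by blast
  from in_coll[OF this] show ?thesis by (simp add: omega_def)
qed

lemma inductive_omega: "indset omega"
  unfolding indset_def using in_omega by (simp add: indset_def)

lemma emp_omega [simp]: "emp \<E> omega" and succ_omega [simp]: "n \<E> omega \<Longrightarrow> succ n \<E> omega"
  using inductive_omega by (auto simp: indset_def)

text \<open>The set of counterexamples must exist in the model. As \<open>omega\<close> may contain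
  nonstandard numbers, induction along it is confined to definable predicates.\<close>

lemma omega_induct [consumes 2, case_names zero step]:
  assumes "df (\<lambda>e. P (e 0))" "n \<E> omega" "P emp" "\<And>n. n \<E> omega \<Longrightarrow> P n \<Longrightarrow> P (succ n)"
  shows "P n"
proof -
  obtain b where b: "x \<E> b \<longleftrightarrow> x \<E> omega \<and> P x" for x using ex_Sep[OF assms(1)] by blast
  then have "indset b" by (simp add: indset_def assms)
  then show ?thesis using assms(2) b in_omega by blast
qed

lemma Ord_nat: "n \<E> omega \<Longrightarrow> Ord n"
proof (rule omega_induct[where P = Ord])
  show "Ord emp" by (simp add: Ord_def Trans_def)
  show "df (\<lambda>e. Ord (e 0))" by (intro dfs)
qed (auto intro: Ord_succ)

lemma Trans_omega: "Trans omega"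
  unfolding Trans_def
proof (intro allI impI)
  fix n assume "n \<E> omega"
  then show "sub n omega"
    by (rule omega_induct[where P = "\<lambda>n. sub n omega", rotated]) (auto simp: sub_def intro!: dfs)
qed

lemma nat_bound: "m \<E> omega \<Longrightarrow> n \<E> omega \<Longrightarrow> \<exists>k. k \<E> omega \<and> sub m k \<and> sub n k"
  using Ord_linear[of m n] Ord_nat Ord_Trans unfolding Trans_def by (metis sub_refl)

lemma set_induct:
  assumes "df (\<lambda>e. P (e 0))" "\<And>x. x \<E> A \<Longrightarrow> (\<And>y. y \<E> x \<Longrightarrow> y \<E> A \<Longrightarrow> P y) \<Longrightarrow> P x" "a \<E> A"
  shows "P a"
  using set_min[OF df_not[OF assms(1)] assms(3)] assms(2) by blast

subsection \<open>Recursion\<close>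

context
  fixes F :: "'a \<Rightarrow> 'a \<Rightarrow> 'a" and dep :: "'a \<Rightarrow> 'a" and t :: 'a
  assumes dfn_F: "dfn (\<lambda>e. F (e 0) (e (Suc 0)))" and dfn_dep: "dfn (\<lambda>e. dep (e 0))"
    and dep_closed: "\<And>x. x \<E> t \<Longrightarrow> sub (dep x) t"
    and dep_wf: "\<And>B b. sub B t \<Longrightarrow> b \<E> B \<Longrightarrow> \<exists>x. x \<E> B \<and> (\<forall>y. y \<E> dep x \<longrightarrow> \<not> y \<E> B)"
begin

text \<open>\<open>dep x\<close> collects the points whose values enter the value at
  \<open>x\<close>. It is instantiated below with \<open>x\<close> itself, for recursion along
  membership, and with \<open>trcl x\<close>, for values that depend on sets deeper inside. An
  approximation solves the recursion on a \<open>dep\<close>-closed part \<open>s\<close> of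
  \<open>t\<close>.\<close>

definition approx :: "'a \<Rightarrow> 'a \<Rightarrow> bool" where
  "approx g s \<longleftrightarrow> sub s t \<and> (\<forall>x. x \<E> s \<longrightarrow> sub (dep x) s) \<and>
    (\<forall>x. x \<E> s \<longrightarrow> app g x = F x (lam (dep x) (app g)))"

lemma df_approx: "dfn a \<Longrightarrow> dfn b \<Longrightarrow> df (\<lambda>e. approx (a e) (b e))"
  by (rule df_comp2[where Q = approx], unfold approx_def)
    (intro dfs dfn_comp2[OF dfn_F] dfn_comp1[OF dfn_dep])

lemma approx_unique:
  assumes "approx g s" "approx g' s'" "x \<E> s" "x \<E> s'" shows "app g x = app g' x"
proof (rule ccontr)
  assume ne: "app g x \<noteq> app g' x"
  obtain B where B: "x \<E> B \<longleftrightarrow> x \<E> s \<and> x \<E> s' \<and> app g x \<noteq> app g' x" for x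
    by (rule ex_Sep[of "\<lambda>x. x \<E> s' \<and> app g x \<noteq> app g' x" s]) (intro dfs, rule that)
  have "sub B t" using B assms(1) by (auto simp: sub_def approx_def)
  moreover have "x \<E> B" using B ne assms by blast
  ultimately obtain x where x: "x \<E> B" "\<And>y. y \<E> dep x \<Longrightarrow> \<not> y \<E> B" using dep_wf by blast
  have "lam (dep x) (app g) = lam (dep x) (app g')"
  proof (rule lam_cong)
    fix y assume "y \<E> dep x"
    then show "app g y = app g' y" using x B assms(1,2) unfolding approx_def by (meson subD)
  qed (intro dfs)+
  then show False using x(1) B assms(1,2) unfolding approx_def by metis
qed

text \<open>Approximations agree where both are defined, so their union is again one. If it missed
  part of \<open>t\<close>, adding the prescribed value at a \<open>dep\<close>-minimal missing
  point would give a larger approximation.\<close>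

lemma recursion: "\<exists>g. \<forall>x. x \<E> t \<longrightarrow> app g x = F x (lam (dep x) (app g))"
proof -
  have "\<exists>s. \<forall>x. x \<E> s \<longleftrightarrow> x \<E> t \<and> (\<exists>g s. approx g s \<and> x \<E> s)"
    by (rule separation) (intro dfs df_approx)
  then obtain s where s: "x \<E> s \<longleftrightarrow> x \<E> t \<and> (\<exists>g s. approx g s \<and> x \<E> s)" for x
    by (elim exE) (rule that, erule spec)
  define P where "P x p \<longleftrightarrow> (\<exists>g s. approx g s \<and> x \<E> s \<and> p = pair x (app g x))" for x p
  have "\<exists>b. \<forall>y. y \<E> b \<longleftrightarrow> (\<exists>x. x \<E> s \<and> P x y)"
    unfolding P_def
    by (rule replacement) (intro dfs df_approx, elim exE conjE, simp, erule (3) approx_unique)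
  then obtain g where g: "p \<E> g \<longleftrightarrow> (\<exists>x. x \<E> s \<and> P x p)" for p by blast
  have gp: "pair x z \<E> g \<longleftrightarrow> x \<E> s \<and> (\<exists>h r. approx h r \<and> x \<E> r \<and> z = app h x)" for x z
    unfolding g P_def pair_eq by blast
  have app_g: "app g x = app h x" if "approx h r" "x \<E> r" for h r x
  proof (rule app_eq)
    have "x \<E> s" using s that unfolding approx_def sub_def by blast
    then show "pair x (app h x) \<E> g" using gp that by blast
    show "z = app h x" if z: "pair x z \<E> g" for z
    proof -
      obtain g' s' where "approx g' s'" "x \<E> s'" "z = app g' x"
        using z gp by blast
      then show ?thesis using approx_unique \<open>approx h r\<close> \<open>x \<E> r\<close> by blast
    qed
  qed
  have ap: "approx g s" unfolding approx_def
  proof (intro conjI allI impI)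
    show "sub s t" using s by (simp add: sub_def)
    fix x assume "x \<E> s"
    then obtain h r where h: "approx h r" "x \<E> r" using s by blast
    then have dep: "y \<E> r" if "y \<E> dep x" for y using that unfolding approx_def sub_def by blast
    then show "sub (dep x) s" using s h unfolding approx_def sub_def by blast
    have "lam (dep x) (app g) = lam (dep x) (app h)"
      by (rule lam_cong) (intro dfs, intro dfs, use app_g h dep in blast)
    then show "app g x = F x (lam (dep x) (app g))"
      using app_g[OF h] h unfolding approx_def by metis
  qed
  have "x \<E> s" if "x \<E> t" for x
  proof (rule ccontr)
    assume "\<not> x \<E> s"
    obtain B where B: "x \<E> B \<longleftrightarrow> x \<E> t \<and> \<not> x \<E> s" for x
      by (rule ex_Sep[of "\<lambda>x. \<not> x \<E> s" t]) (intro dfs, rule that)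
    have "sub B t" "x \<E> B" using B \<open>\<not> x \<E> s\<close> that by (auto simp: sub_def)
    then obtain x where x: "x \<E> B" "\<And>y. y \<E> dep x \<Longrightarrow> \<not> y \<E> B" using dep_wf by blast
    have xs: "x \<E> t" "\<not> x \<E> s" using B x by auto
    have dx: "y \<E> s" if "y \<E> dep x" for y using that x B dep_closed[OF xs(1)] by (auto simp: sub_def)
    define v where "v = F x (lam (dep x) (app g))"
    define h where "h = un g (upair (pair x v) (pair x v))"
    have nx: "\<not> pair x z \<E> g" for z using gp xs by blast
    have hx: "app h x = v" by (rule app_eq) (auto simp: h_def nx)
    have hy: "app h y = app g y" if "y \<E> s" for y
    proof (rule app_eq)
      have "pair y (app g y) \<E> g" using that gp ap by blast
      then show "pair y (app g y) \<E> h" by (simp add: h_def)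
      show "z = app g y" if z: "pair y z \<E> h" for z
      proof -
        have "pair y z \<E> g" using z \<open>y \<E> s\<close> xs(2) by (auto simp: h_def)
        then show ?thesis using gp app_g by metis
      qed
    qed
    have "approx h (un s (upair x x))"
      unfolding approx_def
    proof (intro conjI allI impI)
      show "sub (un s (upair x x)) t" using xs s by (auto simp: sub_def)
      fix y assume y: "y \<E> un s (upair x x)"
      have dy: "z \<E> s" if "z \<E> dep y" for z
        using that y dx ap unfolding approx_def sub_def by auto
      then show "sub (dep y) (un s (upair x x))" by (simp add: sub_def)
      have "lam (dep y) (app h) = lam (dep y) (app g)"
        by (rule lam_cong) (intro dfs, intro dfs, use hy dy in blast)
      then show "app h y = F y (lam (dep y) (app h))"
        using y hx hy ap xs unfolding approx_def v_def by auto
    qed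
    moreover have "x \<E> un s (upair x x)" by simp
    ultimately show False using s xs by blast
  qed
  then show ?thesis using ap unfolding approx_def by blast
qed

end

lemma Trans_recursion:
  assumes "dfn (\<lambda>e. F (e 0) (e (Suc 0)))" "Trans t"
  shows "\<exists>g. \<forall>x. x \<E> t \<longrightarrow> app g x = F x (lam x (app g))"
  by (rule recursion[where dep = "\<lambda>x. x"])
    (use assms foundation in \<open>auto simp: Trans_def intro!: dfs\<close>)

subsection \<open>Transitive closure\<close>

definition istrcl :: "'a \<Rightarrow> 'a \<Rightarrow> bool" where
  "istrcl t x \<longleftrightarrow> Trans t \<and> sub x t \<and> (\<forall>s. Trans s \<and> sub x s \<longrightarrow> sub t s)"

lemma df_istrcl [dfs]: "dfn s \<Longrightarrow> dfn t \<Longrightarrow> df (\<lambda>e. istrcl (s e) (t e))"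
  by (rule df_comp2[where Q = istrcl], unfold istrcl_def) (intro dfs)

lemma ex_trcl: "\<exists>t. istrcl t x"
proof -
  \<comment> \<open>Each stage consists of \<open>x\<close> and the elements of elements of all
    earlier stages, which avoids a case distinction between zero and successors.\<close>
  define F where "F n g = un x (union (funion n g))" for n g
  have "dfn (\<lambda>e. F (e 0) (e (Suc 0)))" unfolding F_def by (intro dfs)
  from Trans_recursion[OF this Trans_omega]
  obtain g where g: "app g n = F n (lam n (app g))" if "n \<E> omega" for n by blast
  have g': "z \<E> app g n \<longleftrightarrow> z \<E> x \<or> (\<exists>m y. m \<E> n \<and> y \<E> app g m \<and> z \<E> y)" if "n \<E> omega" for z n
    unfolding g[OF that] F_def in_un in_union in_funion_lam by blast
  define t where "t = funion omega g"
  have t: "z \<E> t \<longleftrightarrow> (\<exists>n. n \<E> omega \<and> z \<E> app g n)" for z unfolding t_def by (rule in_funion)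
  have "Trans t" unfolding Trans_def sub_def
  proof (intro allI impI)
    fix y z assume "y \<E> t" "z \<E> y"
    then obtain n where "n \<E> omega" "y \<E> app g n" using t by blast
    then have "z \<E> app g (succ n)" using g'[of "succ n"] \<open>z \<E> y\<close> by auto
    then show "z \<E> t" using t \<open>n \<E> omega\<close> succ_omega by blast
  qed
  moreover have "sub x t" using t g'[OF emp_omega] emp_omega unfolding sub_def by blast
  moreover have "sub t s" if s: "Trans s" "sub x s" for s
  proof -
    have "sub (app g n) s" if "n \<E> omega" for n
    proof (rule set_induct[where P = "\<lambda>n. sub (app g n) s" and A = omega])
      show "df (\<lambda>e. sub (app g (e 0)) s)" by (intro dfs)
      fix m assume m: "m \<E> omega" and IH: "\<And>k. k \<E> m \<Longrightarrow> k \<E> omega \<Longrightarrow> sub (app g k) s"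
      show "sub (app g m) s" unfolding sub_def
      proof (intro allI impI)
        fix z assume "z \<E> app g m"
        then consider "z \<E> x" | k y where "k \<E> m" "y \<E> app g k" "z \<E> y" using g'[OF m] by blast
        then show "z \<E> s"
        proof cases
          case 1
          then show ?thesis using s subD by blast
        next
          case 2
          then have "y \<E> s" using IH TransD[OF Trans_omega m] subD by blast
          then show ?thesis using TransD[OF s(1)] 2 by blast
        qed
      qed
    qed (rule that)
    then show ?thesis using t unfolding sub_def by blast
  qed
  ultimately show ?thesis unfolding istrcl_def by blast
qed

definition trcl :: "'a \<Rightarrow> 'a" where
  "trcl x = coll (\<lambda>z. \<forall>s. Trans s \<and> sub x s \<longrightarrow> z \<E> s)"

lemma trcl_ex: "\<exists>b. \<forall>z. z \<E> b \<longleftrightarrow> (\<forall>s. Trans s \<and> sub x s \<longrightarrow> z \<E> s)"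
  using ex_trcl[of x] unfolding istrcl_def sub_def by blast

lemma dfn_trcl [dfs]: "dfn s \<Longrightarrow> dfn (\<lambda>e. trcl (s e))"
  by (rule dfn_comp1[where F = trcl], unfold trcl_def) (intro dfn_coll trcl_ex dfs)

lemma istrcl_iff: "istrcl t x \<longleftrightarrow> t = trcl x"
proof -
  have m: "z \<E> trcl x \<longleftrightarrow> (\<forall>s. Trans s \<and> sub x s \<longrightarrow> z \<E> s)" for z
    unfolding trcl_def by (rule in_coll[OF trcl_ex])
  have "t = trcl x" if "istrcl t x" for t
    by (rule extensionality, unfold m) (use that in \<open>unfold istrcl_def sub_def, blast\<close>)
  then show ?thesis using ex_trcl[of x] by blast
qed

lemma istrcl_trcl: "istrcl (trcl x) x"
  by (simp add: istrcl_iff)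

lemma Trans_trcl: "Trans (trcl x)" and sub_trcl: "sub x (trcl x)"
  and trcl_least: "Trans s \<Longrightarrow> sub x s \<Longrightarrow> sub (trcl x) s"
  using istrcl_trcl[of x] by (auto simp: istrcl_def)

lemma class_min:
  assumes "df (\<lambda>e. P (e 0))" "P a"
  shows "\<exists>x. P x \<and> (\<forall>y. y \<E> x \<longrightarrow> \<not> P y)"
proof -
  let ?t = "trcl (upair a a)"
  have "a \<E> ?t" using sub_trcl[of "upair a a"] by (auto simp: sub_def)
  from set_min[OF assms(1) this assms(2)] show ?thesis using TransD[OF Trans_trcl] by blast
qed

lemma trcl_unfold: "b \<E> trcl z \<Longrightarrow> b \<E> z \<or> (\<exists>y. y \<E> z \<and> b \<E> trcl y)"
proof -
  obtain s where s: "b \<E> s \<longleftrightarrow> b \<E> trcl z \<and> (b \<E> z \<or> (\<exists>y. y \<E> z \<and> b \<E> trcl y))" for b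
    by (rule ex_Sep[of "\<lambda>b. b \<E> z \<or> (\<exists>y. y \<E> z \<and> b \<E> trcl y)" "trcl z"]) (intro dfs, rule that)
  have "Trans s" unfolding Trans_def sub_def
  proof (intro allI impI)
    fix a b assume "a \<E> s" "b \<E> a"
    then have "b \<E> trcl z" "b \<E> trcl a" "a \<E> z \<or> (\<exists>y. y \<E> z \<and> a \<E> trcl y)"
      using s TransD[OF Trans_trcl] subD[OF sub_trcl] by blast+
    then show "b \<E> s" using s TransD[OF Trans_trcl] \<open>b \<E> a\<close> by blast
  qed
  moreover have "sub z s" using s sub_trcl[of z] unfolding sub_def by blast
  ultimately show "b \<E> trcl z \<Longrightarrow> ?thesis" using trcl_least s unfolding sub_def by blast
qed

lemma trcl_min:
  assumes "b \<E> B" shows "\<exists>x. x \<E> B \<and> (\<forall>y. y \<E> trcl x \<longrightarrow> \<not> y \<E> B)"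
proof -
  \<comment> \<open>Membership-minimality among the elements of \<open>B\<close> would say nothing
    about deeper elements. Minimal is instead a \<open>z\<close> that lies in \<open>B\<close> or
    whose closure meets \<open>B\<close>; by \<open>trcl_unfold\<close> it can only be the former,
    and its closure avoids \<open>B\<close>.\<close>
  have "df (\<lambda>e. \<exists>b. b \<E> B \<and> (b = e 0 \<or> b \<E> trcl (e 0)))" by (intro dfs)
  from class_min[OF this, of b] assms obtain z where
    "\<exists>b. b \<E> B \<and> (b = z \<or> b \<E> trcl z)"
    "\<And>y. y \<E> z \<Longrightarrow> \<not> (\<exists>b. b \<E> B \<and> (b = y \<or> b \<E> trcl y))" by blast
  then show ?thesis using trcl_unfold by blast
qed

text \<open>The components of a code are not elements of it but lie in its transitive closure;
  recursion on formulas therefore needs the values on all of \<open>trcl x\<close>.\<close>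

lemma trcl_recursion:
  assumes "dfn (\<lambda>e. F (e 0) (e (Suc 0)))" "Trans t"
  shows "\<exists>g. \<forall>x. x \<E> t \<longrightarrow> app g x = F x (lam (trcl x) (app g))"
proof (rule recursion[where dep = trcl])
  show "sub (trcl x) t" if "x \<E> t" for x
    using that assms(2) trcl_least by (auto simp: Trans_def)
  show "dfn (\<lambda>e. trcl (e 0))" by (intro dfs)
qed (use assms trcl_min in auto)

lemma ex_relation:
  assumes "df (\<lambda>e. Q (e 0) (e (Suc 0)))"
  obtains g where "\<And>p. p \<E> g \<Longrightarrow> \<exists>x y. x \<E> A \<and> y \<E> B \<and> p = pair x y"
    "\<And>x y. pair x y \<E> g \<longleftrightarrow> x \<E> A \<and> y \<E> B \<and> Q x y"
proof -
  have "\<exists>g. \<forall>p. p \<E> g \<longleftrightarrow> p \<E> prod A B \<and> (\<exists>x y. p = pair x y \<and> Q x y)"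
    by (rule separation) (intro dfs df_comp2[OF assms])
  then obtain g where g: "\<forall>p. p \<E> g \<longleftrightarrow> p \<E> prod A B \<and> (\<exists>x y. p = pair x y \<and> Q x y)" ..
  show thesis
  proof (rule that)
    show "\<exists>x y. x \<E> A \<and> y \<E> B \<and> p = pair x y" if "p \<E> g" for p
      using that g by (simp add: in_prod)
    show "pair x y \<E> g \<longleftrightarrow> x \<E> A \<and> y \<E> B \<and> Q x y" for x y
      using g by simp
  qed
qed

subsection \<open>Lindenbaum numbers\<close>

text \<open>A surjection onto \<open>A\<close> from a subset of \<open>Z\<close>. Partiality lets
  \<open>A\<close> shrink and \<open>Z\<close> grow without default values, and for nonempty
  \<open>A\<close> a total surjection can be recovered by \<open>psurj_total\<close>.\<close>

definition psurj :: "'a \<Rightarrow> 'a \<Rightarrow> 'a \<Rightarrow> bool" where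
  "psurj f Z A \<longleftrightarrow> (\<forall>p. p \<E> f \<longrightarrow> (\<exists>x y. x \<E> Z \<and> y \<E> A \<and> p = pair x y)) \<and>
    (\<forall>x y z. pair x y \<E> f \<and> pair x z \<E> f \<longrightarrow> y = z) \<and> (\<forall>y. y \<E> A \<longrightarrow> (\<exists>x. pair x y \<E> f))"

definition issurj :: "'a \<Rightarrow> 'a \<Rightarrow> 'a \<Rightarrow> bool" where
  "issurj f A B \<longleftrightarrow> isfun f A B \<and> (\<forall>y. y \<E> B \<longrightarrow> (\<exists>x. pair x y \<E> f))"

definition isinj :: "'a \<Rightarrow> 'a \<Rightarrow> 'a \<Rightarrow> bool" where
  "isinj f A B \<longleftrightarrow> isfun f A B \<and> (\<forall>x y z. pair x z \<E> f \<and> pair y z \<E> f \<longrightarrow> x = y)"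

definition Card :: "'a \<Rightarrow> bool" where
  "Card k \<longleftrightarrow> Ord k \<and> (\<forall>a. a \<E> k \<longrightarrow> \<not> (\<exists>f. isinj f a k \<and> issurj f a k))"

lemma df_psurj [dfs]: "dfn f \<Longrightarrow> dfn A \<Longrightarrow> dfn B \<Longrightarrow> df (\<lambda>e. psurj (f e) (A e) (B e))"
  by (rule df_comp3[where Q = psurj], unfold psurj_def) (intro dfs)

lemma df_issurj [dfs]: "dfn f \<Longrightarrow> dfn A \<Longrightarrow> dfn B \<Longrightarrow> df (\<lambda>e. issurj (f e) (A e) (B e))"
  by (rule df_comp3[where Q = issurj], unfold issurj_def) (intro dfs)

lemma psurjD:
  assumes "psurj f Z A"
  shows psurj_in: "pair x y \<E> f \<Longrightarrow> x \<E> Z \<and> y \<E> A"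
    and psurj_unique: "pair x y \<E> f \<Longrightarrow> pair x z \<E> f \<Longrightarrow> y = z"
    and psurj_onto: "y \<E> A \<Longrightarrow> \<exists>x. pair x y \<E> f"
proof -
  show "pair x y \<E> f \<Longrightarrow> x \<E> Z \<and> y \<E> A"
    using assms unfolding psurj_def by (metis pair_eq)
qed (use assms in \<open>unfold psurj_def, blast+\<close>)

lemma psurjI:
  assumes "\<And>p. p \<E> f \<Longrightarrow> \<exists>x y. x \<E> Z \<and> y \<E> A \<and> p = pair x y"
    "\<And>x y z. pair x y \<E> f \<Longrightarrow> pair x z \<E> f \<Longrightarrow> y = z" "\<And>y. y \<E> A \<Longrightarrow> \<exists>x. pair x y \<E> f"
  shows "psurj f Z A"
  using assms unfolding psurj_def by blast

text \<open>The relation that a partial surjection onto an ordinal induces on \<open>Z\<close> determines the ordinal.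
  This bounds the ordinals in question by Replacement on the relations on \<open>Z\<close>.\<close>

definition induced :: "'a \<Rightarrow> 'a \<Rightarrow> 'a" where
  "induced Z f = Sep (prod Z Z)
    (\<lambda>p. \<exists>x y a b. p = pair x y \<and> pair x a \<E> f \<and> pair y b \<E> f \<and> (a \<E> b \<or> a = b))"

lemma dfn_induced [dfs]: "dfn s \<Longrightarrow> dfn t \<Longrightarrow> dfn (\<lambda>e. induced (s e) (t e))"
  by (rule dfn_comp2[where F = induced], unfold induced_def) (intro dfs)

lemma in_induced:
  assumes "psurj f Z A"
  shows "pair x y \<E> induced Z f \<longleftrightarrow> (\<exists>a b. pair x a \<E> f \<and> pair y b \<E> f \<and> (a \<E> b \<or> a = b))"
proof -
  have "pair x y \<E> induced Z f \<longleftrightarrow> pair x y \<E> prod Z Z \<and>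
      (\<exists>x' y' a b. pair x y = pair x' y' \<and> pair x' a \<E> f \<and> pair y' b \<E> f \<and> (a \<E> b \<or> a = b))"
    unfolding induced_def by (rule in_Sep) (intro dfs)
  then show ?thesis using psurj_in[OF assms] by auto
qed

text \<open>Both maps collapse the same preorder on \<open>Z\<close> onto an ordinal, and such a
  collapse is unique: by induction, the value at \<open>x\<close> is the set of the values at the
  points strictly below \<open>x\<close>.\<close>

lemma induced_le:
  assumes f: "psurj f Z A" "Ord A" and g: "psurj g Z B" "Ord B" and eq: "induced Z f = induced Z g"
    and xa: "pair x a \<E> f"
  shows "pair x a \<E> g"
proof -
  have rel: "(\<exists>a b. pair x a \<E> f \<and> pair y b \<E> f \<and> (a \<E> b \<or> a = b)) \<longleftrightarrow>
      (\<exists>a b. pair x a \<E> g \<and> pair y b \<E> g \<and> (a \<E> b \<or> a = b))" for x y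
    using in_induced[OF f(1), of x y] in_induced[OF g(1), of x y] by (simp only: eq)
  \<comment> \<open>The induced relation is reflexive exactly on the domain of the map, so it
    determines the domain too.\<close>
  have dom: "(\<exists>a. pair x a \<E> f) \<longleftrightarrow> (\<exists>a. pair x a \<E> g)" for x using rel[of x x] by blast
  have order: "(a \<E> b \<or> a = b) \<longleftrightarrow> (a' \<E> b' \<or> a' = b')"
    if p: "pair x a \<E> f" "pair y b \<E> f" "pair x a' \<E> g" "pair y b' \<E> g" for x y a b a' b'
  proof -
    have "(a \<E> b \<or> a = b) \<longleftrightarrow> (\<exists>a b. pair x a \<E> f \<and> pair y b \<E> f \<and> (a \<E> b \<or> a = b))"
      using p(1,2) psurj_unique[OF f(1)] by blast
    also note rel
    also have "(\<exists>a b. pair x a \<E> g \<and> pair y b \<E> g \<and> (a \<E> b \<or> a = b)) \<longleftrightarrow> (a' \<E> b' \<or> a' = b')"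
      using p(3,4) psurj_unique[OF g(1)] by blast
    finally show ?thesis .
  qed
  have "\<forall>x. pair x a \<E> f \<longrightarrow> pair x a \<E> g"
  proof (rule set_induct[where P = "\<lambda>a. \<forall>x. pair x a \<E> f \<longrightarrow> pair x a \<E> g" and A = A])
    show "df (\<lambda>e. \<forall>x. pair x (e 0) \<E> f \<longrightarrow> pair x (e 0) \<E> g)" by (intro dfs)
    show "a \<E> A" using psurj_in[OF f(1) xa] by blast
  next
    fix a assume a: "a \<E> A" and IH: "\<And>c. c \<E> a \<Longrightarrow> c \<E> A \<Longrightarrow> \<forall>x. pair x c \<E> f \<longrightarrow> pair x c \<E> g"
    show "\<forall>x. pair x a \<E> f \<longrightarrow> pair x a \<E> g"
    proof (intro allI impI)
      fix x assume x: "pair x a \<E> f"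
      then obtain a' where a': "pair x a' \<E> g" using dom by blast
      have "a = a'"
      proof (rule extensionality, rule iffI)
        fix c assume c: "c \<E> a"
        then have cA: "c \<E> A" using a f(2) TransD Ord_Trans by blast
        then obtain y where y: "pair y c \<E> f" using psurj_onto[OF f(1)] by blast
        then have yg: "pair y c \<E> g" using IH c cA by blast
        have "c \<E> a' \<or> c = a'" using order[OF y x yg a'] c by blast
        \<comment> \<open>\<open>order\<close> compares values only up to equality; equality is
          excluded by applying it in the opposite direction.\<close>
        moreover have False if "c = a'"
        proof -
          have "a \<E> c \<or> a = c" using order[OF x y a' yg] that by blast
          then show False using c mem_asym mem_irrefl by blast
        qed
        ultimately show "c \<E> a'" by blast
      next
        fix c assume c: "c \<E> a'"
        then have "c \<E> B" using psurj_in[OF g(1) a'] g(2) TransD Ord_Trans by blast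
        then obtain y where y: "pair y c \<E> g" using psurj_onto[OF g(1)] by blast
        then obtain b where yb: "pair y b \<E> f" using dom by blast
        then have b: "pair y b \<E> f" "b \<E> a \<or> b = a" using order[OF yb x y a'] c by blast+
        have False if "b = a"
        proof -
          have "a' \<E> c \<or> a' = c" using order[OF x yb a' y] that by blast
          then show False using c mem_asym mem_irrefl by blast
        qed
        then have ba: "b \<E> a" using b by blast
        then have "b \<E> A" using psurj_in[OF f(1) b(1)] by blast
        then have "pair y b \<E> g" using IH ba b by blast
        then show "c \<E> a" using psurj_unique[OF g(1) y] ba by blast
      qed
      then show "pair x a \<E> g" using a' by simp
    qed
  qed
  then show ?thesis using xa by blast
qed

text \<open>The Lindenbaum number of \<open>Z\<close>. The Hartogs number would not do here: without
  choice, a surjection of \<open>Z\<close> onto an ordinal need not yield an injection of that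
  ordinal into \<open>Z\<close>.\<close>

definition lind :: "'a \<Rightarrow> 'a" where
  "lind Z = coll (\<lambda>a. Ord a \<and> (\<exists>f. psurj f Z a))"

lemma in_lind: "a \<E> lind Z \<longleftrightarrow> Ord a \<and> (\<exists>f. psurj f Z a)"
proof -
  have "\<exists>b. \<forall>a. a \<E> b \<longleftrightarrow> (\<exists>R. R \<E> power (prod Z Z) \<and> (Ord a \<and> (\<exists>f. psurj f Z a \<and> R = induced Z f)))"
  proof (rule replacement)
    show "df (\<lambda>e. Ord (e (Suc 0)) \<and> (\<exists>f. psurj f Z (e (Suc 0)) \<and> e 0 = induced Z f))" by (intro dfs)
    fix R a b
    assume "Ord a \<and> (\<exists>f. psurj f Z a \<and> R = induced Z f)" "Ord b \<and> (\<exists>f. psurj f Z b \<and> R = induced Z f)"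
    then obtain f g where f: "psurj f Z a" "Ord a" and g: "psurj g Z b" "Ord b"
      and eq: "induced Z f = induced Z g" by metis
    show "a = b"
    proof (rule extensionality, rule iffI)
      show "x \<E> a \<Longrightarrow> x \<E> b" for x
        using induced_le[OF f g eq] psurj_onto[OF f(1)] psurj_in[OF g(1)] by blast
      show "x \<E> b \<Longrightarrow> x \<E> a" for x
        using induced_le[OF g f eq[symmetric]] psurj_onto[OF g(1)] psurj_in[OF f(1)] by blast
    qed
  qed
  moreover have "induced Z f \<E> power (prod Z Z)" for f
  proof -
    have "p \<E> induced Z f \<Longrightarrow> p \<E> prod Z Z" for p
    proof -
      have "p \<E> induced Z f \<longleftrightarrow> p \<E> prod Z Z \<and>
          (\<exists>x' y' a b. p = pair x' y' \<and> pair x' a \<E> f \<and> pair y' b \<E> f \<and> (a \<E> b \<or> a = b))"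
        unfolding induced_def by (rule in_Sep) (intro dfs)
      then show "p \<E> induced Z f \<Longrightarrow> p \<E> prod Z Z" by blast
    qed
    then show ?thesis by (simp add: sub_def)
  qed
  ultimately have "\<exists>b. \<forall>a. a \<E> b \<longleftrightarrow> Ord a \<and> (\<exists>f. psurj f Z a)"
    by (elim exE) (rule exI, blast)
  from in_coll[OF this] show ?thesis by (simp add: lind_def)
qed

lemma psurj_restrict:
  assumes f: "psurj f Z A" and "sub B A" "sub Z Z'" shows "\<exists>g. psurj g Z' B"
proof -
  have "df (\<lambda>e. pair (e 0) (e (Suc 0)) \<E> f)" by (intro dfs)
  then obtain g where g: "\<And>p. p \<E> g \<Longrightarrow> \<exists>x y. x \<E> Z' \<and> y \<E> B \<and> p = pair x y"
    and gp: "\<And>x y. pair x y \<E> g \<longleftrightarrow> x \<E> Z' \<and> y \<E> B \<and> pair x y \<E> f"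
    by (rule ex_relation[where A = "Z'" and B = "B"]) (rule that)
  have "psurj g Z' B"
  proof (rule psurjI)
    fix y assume "y \<E> B"
    then show "\<exists>x. pair x y \<E> g"
      using gp psurj_onto[OF f] psurj_in[OF f] subD[OF assms(2)] subD[OF assms(3)] by blast
  qed (use g gp psurj_unique[OF f] in blast)+
  then show ?thesis ..
qed

lemma psurj_total:
  assumes f: "psurj f Z A" and "c \<E> A" shows "\<exists>g. issurj g Z A"
proof -
  \<comment> \<open>Points outside the domain of \<open>f\<close> are sent to the default value
    \<open>c\<close>.\<close>
  have "df (\<lambda>e. pair (e 0) (e (Suc 0)) \<E> f \<or> (\<not> (\<exists>z. pair (e 0) z \<E> f) \<and> e (Suc 0) = c))"
    by (intro dfs)
  then obtain g where g: "\<And>p. p \<E> g \<Longrightarrow> \<exists>x y. x \<E> Z \<and> y \<E> A \<and> p = pair x y"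
    and gp: "\<And>x y. pair x y \<E> g \<longleftrightarrow> x \<E> Z \<and> y \<E> A \<and> (pair x y \<E> f \<or> (\<not> (\<exists>z. pair x z \<E> f) \<and> y = c))"
    by (rule ex_relation[where A = "Z" and B = "A"]) (rule that)
  have "isfun g Z A"
  proof (rule isfunI)
    fix p assume "p \<E> g"
    then show "\<exists>x y. x \<E> Z \<and> y \<E> A \<and> p = pair x y" by (rule g)
  next
    fix x assume "x \<E> Z"
    then show "\<exists>y. pair x y \<E> g" using gp psurj_in[OF f] assms(2) by blast
  next
    fix x y z assume "pair x y \<E> g" "pair x z \<E> g"
    then show "y = z" using gp psurj_unique[OF f] by blast
  qed
  moreover have "\<exists>x. pair x y \<E> g" if "y \<E> A" for y
    using that psurj_onto[OF f that] psurj_in[OF f] gp by blast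
  ultimately show ?thesis unfolding issurj_def by blast
qed

lemma issurj_psurj: "issurj f Z A \<Longrightarrow> psurj f Z A"
  unfolding issurj_def psurj_def using isfun_unique unfolding isfun_def by blast

lemma Ord_lind: "Ord (lind Z)"
  unfolding Ord_def
proof (intro conjI allI impI)
  show "Trans (lind Z)" unfolding Trans_def sub_def
  proof (intro allI impI)
    fix a b assume "a \<E> lind Z" "b \<E> a"
    then have "Ord a" "\<exists>f. psurj f Z a" "sub b a"
      using in_lind Ord_Trans[unfolded Trans_def] by blast+
    then show "b \<E> lind Z" unfolding in_lind
      using psurj_restrict[of _ Z a b Z] Ord_mem \<open>b \<E> a\<close> sub_refl by blast
  qed
  show "a \<E> lind Z \<Longrightarrow> Trans a" for a using in_lind Ord_Trans by blast
qed

text \<open>Such a map would make the ordinal \<open>lind Z\<close> an element of itself.\<close>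

lemma no_psurj_lind: "\<not> psurj f Z (lind Z)"
  using in_lind[of "lind Z" Z] Ord_lind mem_irrefl by blast

text \<open>A surjection onto \<open>lind Z\<close> from one of its elements \<open>a\<close> could
  be composed with a partial surjection of \<open>Z\<close> onto \<open>a\<close>, contradicting
  \<open>no_psurj_lind\<close>.\<close>

lemma Card_lind: "Card (lind Z)"
  unfolding Card_def
proof (intro conjI allI impI notI)
  show "Ord (lind Z)" by (rule Ord_lind)
  fix a assume "a \<E> lind Z" "\<exists>f. isinj f a (lind Z) \<and> issurj f a (lind Z)"
  then obtain g f where g: "psurj g Z a" and f: "psurj f a (lind Z)"
    using in_lind issurj_psurj by blast
  have "df (\<lambda>e. \<exists>y. pair (e 0) y \<E> g \<and> pair y (e (Suc 0)) \<E> f)" by (intro dfs)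
  then obtain h where h: "\<And>p. p \<E> h \<Longrightarrow> \<exists>x y. x \<E> Z \<and> y \<E> lind Z \<and> p = pair x y"
    and hp: "\<And>x z. pair x z \<E> h \<longleftrightarrow> x \<E> Z \<and> z \<E> lind Z \<and> (\<exists>y. pair x y \<E> g \<and> pair y z \<E> f)"
    by (rule ex_relation[where A = "Z" and B = "lind Z"]) (rule that)
  have "psurj h Z (lind Z)"
  proof (rule psurjI)
    fix p assume "p \<E> h"
    then show "\<exists>x y. x \<E> Z \<and> y \<E> lind Z \<and> p = pair x y" by (rule h)
  next
    fix z assume z: "z \<E> lind Z"
    then obtain y where y: "pair y z \<E> f" using psurj_onto[OF f] by blast
    then have "y \<E> a" using psurj_in[OF f] by blast
    then obtain x where x: "pair x y \<E> g" using psurj_onto[OF g] by blast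
    then have "x \<E> Z" using psurj_in[OF g] by blast
    then have "pair x z \<E> h" using hp z x y by blast
    then show "\<exists>x. pair x z \<E> h" ..
  next
    fix x y z assume "pair x y \<E> h" "pair x z \<E> h"
    then obtain u v where u: "pair x u \<E> g" "pair u y \<E> f" and v: "pair x v \<E> g" "pair v z \<E> f"
      using hp by blast
    then have "u = v" using psurj_unique[OF g] by blast
    then show "y = z" using psurj_unique[OF f] u v by blast
  qed
  then show False using no_psurj_lind by blast
qed

text \<open>Provides an element of the cardinals used below; it serves as the default value when
  partial surjections are made total.\<close>

lemma emp_in_lind: "emp \<E> lind Z"
proof -
  have "psurj emp Z emp" by (rule psurjI) auto
  then show ?thesis using in_lind Ord_nat[OF emp_omega] by blast
qed

text \<open>The identity on \<open>a\<close> is a partial surjection of \<open>Z\<close> onto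
  \<open>a\<close>. This places \<open>lind Z\<close> above any ordinal included in
  \<open>Z\<close>, such as the bound in Mekler's condition.\<close>

lemma sub_lind:
  assumes "Ord a" "sub a Z" shows "sub a (lind Z)"
proof -
  have dI: "dfn (\<lambda>e. e 0)" by (intro dfs)
  have "psurj (lam a (\<lambda>x. x)) Z a"
    by (rule psurjI) (use in_lam[OF dI] assms(2) in \<open>auto simp: sub_def\<close>)
  then have "a \<E> lind Z" using in_lind assms(1) by blast
  then show ?thesis using Ord_lind[unfolded Ord_def Trans_def] by blast
qed

subsection \<open>The sets \<open>H\<^sub>\<kappa>\<close>\<close>

definition inH :: "'a \<Rightarrow> 'a \<Rightarrow> bool" where
  "inH x k \<longleftrightarrow> \<not> (\<exists>f. issurj f (trcl x) k)"

lemma df_inH [dfs]: "dfn s \<Longrightarrow> dfn t \<Longrightarrow> df (\<lambda>e. inH (s e) (t e))"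
  by (rule df_comp2[where Q = inH], unfold inH_def) (intro dfs)

text \<open>A surjection of \<open>trcl x\<close> onto \<open>k\<close> would restrict to a partial
  surjection of the larger set \<open>Z\<close> onto the smaller set \<open>lind Z\<close>.\<close>

lemma inH_small:
  assumes "Trans Z" "sub x Z" "sub (lind Z) k" shows "inH x k"
proof -
  have "sub (trcl x) Z" using trcl_least assms by blast
  then show ?thesis unfolding inH_def
    using psurj_restrict[OF issurj_psurj assms(3)] no_psurj_lind by blast
qed

text \<open>A surjection from \<open>trcl y\<close> onto \<open>k\<close> extends to the larger set
  \<open>trcl x\<close> once \<open>k\<close> has an element \<open>c\<close> to serve as default
  value.\<close>

lemma inH_trans:
  assumes "inH x k" "y \<E> x" "c \<E> k" shows "inH y k"
proof -
  have "sub y (trcl x)" using subD[OF sub_trcl assms(2)] Trans_trcl[of x] by (simp add: Trans_def)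
  then have "sub (trcl y) (trcl x)" using trcl_least Trans_trcl by blast
  then show ?thesis using assms(1) unfolding inH_def
    using psurj_restrict[OF issurj_psurj sub_refl] psurj_total[OF _ assms(3)] by blast
qed

text \<open>If the levels \<open>V a\<close> with \<open>a \<in> \<kappa>\<close> do not cover the transitive closure of \<open>x\<close>, then each such \<open>a\<close> is
  the rank of one of its elements, so the rank maps it onto \<open>\<kappa>\<close>.\<close>

lemma ex_H:
  assumes k: "Ord k" "c \<E> k" shows "\<exists>h. \<forall>x. x \<E> h \<longleftrightarrow> inH x k"
proof -
  \<comment> \<open>The power set is taken of the union of the earlier levels, so
    \<open>app V a\<close> is the usual level with index \<open>a + 1\<close>, and the least
    \<open>a\<close> whose level contains \<open>y\<close> is the rank of \<open>y\<close>.\<close>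
  define F where "F a g = power (funion a g)" for a g
  have "dfn (\<lambda>e. F (e 0) (e (Suc 0)))" unfolding F_def by (intro dfs)
  from Trans_recursion[OF this Ord_Trans[OF k(1)]]
  obtain V where V: "\<forall>a. a \<E> k \<longrightarrow> app V a = F a (lam a (app V))" ..
  have Va: "z \<E> app V a \<longleftrightarrow> (\<forall>y. y \<E> z \<longrightarrow> (\<exists>b. b \<E> a \<and> y \<E> app V b))" if "a \<E> k" for z a
  proof -
    have "app V a = F a (lam a (app V))" using V that by blast
    then show ?thesis by (simp only: F_def in_power sub_def in_funion_lam)
  qed
  define W where "W = funion k V"
  have W: "z \<E> W \<longleftrightarrow> (\<exists>b. b \<E> k \<and> z \<E> app V b)" for z unfolding W_def by (rule in_funion)
  have "sub x W" if "inH x k" for x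
  proof (rule ccontr)
    assume nW: "\<not> sub x W"
    let ?t = "trcl x"
    have "df (\<lambda>e. e 0 \<E> app V (e (Suc 0)) \<and> (\<forall>b. b \<E> e (Suc 0) \<longrightarrow> \<not> e 0 \<E> app V b))" by (intro dfs)
    then obtain f where f: "\<And>p. p \<E> f \<Longrightarrow> \<exists>x y. x \<E> ?t \<and> y \<E> k \<and> p = pair x y"
      and fp: "\<And>y a. pair y a \<E> f \<longleftrightarrow>
        y \<E> ?t \<and> a \<E> k \<and> (y \<E> app V a \<and> (\<forall>b. b \<E> a \<longrightarrow> \<not> y \<E> app V b))"
      by (rule ex_relation[where A = "?t" and B = "k"]) (rule that)
    have "psurj f ?t k"
    proof (rule psurjI)
      fix p assume "p \<E> f"
      then show "\<exists>x y. x \<E> ?t \<and> y \<E> k \<and> p = pair x y" by (rule f)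
    next
      fix y a b assume "pair y a \<E> f" "pair y b \<E> f"
      then show "a = b" using fp Ord_linear[of a b] Ord_mem[OF k(1)] by blast
    next
      fix a assume a: "a \<E> k"
      \<comment> \<open>From a point outside all levels, minimality leads to a point outside the
        levels below \<open>a\<close> all of whose elements lie in them; its rank is
        \<open>a\<close>.\<close>
      obtain y where "y \<E> ?t" "\<not> y \<E> W" using nW sub_trcl[of x] unfolding sub_def by blast
      then have "y \<E> ?t" "\<not> (\<exists>b. b \<E> a \<and> y \<E> app V b)"
        using W TransD[OF Ord_Trans[OF k(1)] a] by blast+
      moreover have "df (\<lambda>e. \<not> (\<exists>b. b \<E> a \<and> e 0 \<E> app V b))" by (intro dfs)
      ultimately have "\<exists>y. y \<E> ?t \<and> \<not> (\<exists>b. b \<E> a \<and> y \<E> app V b) \<and>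
          (\<forall>z. z \<E> y \<longrightarrow> z \<E> ?t \<longrightarrow> \<not> \<not> (\<exists>b. b \<E> a \<and> z \<E> app V b))"
        by (intro set_min)
      then obtain y where y: "y \<E> ?t" "\<not> (\<exists>b. b \<E> a \<and> y \<E> app V b)"
        "\<forall>z. z \<E> y \<longrightarrow> z \<E> ?t \<longrightarrow> (\<exists>b. b \<E> a \<and> z \<E> app V b)" by blast
      then have "y \<E> app V a" using Va[OF a] TransD[OF Trans_trcl y(1)] by blast
      then have "pair y a \<E> f" using fp y a by blast
      then show "\<exists>x. pair x a \<E> f" ..
    qed
    then show False using that psurj_total[OF _ k(2)] unfolding inH_def by blast
  qed
  moreover have "\<exists>h. \<forall>x. x \<E> h \<longleftrightarrow> x \<E> power W \<and> inH x k" by (rule separation) (intro dfs)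
  ultimately show ?thesis by (elim exE) (rule exI, simp, blast)
qed

subsection \<open>Coded formulas and satisfaction\<close>

lemma nat_bound_mem: "m \<E> omega \<Longrightarrow> n \<E> omega \<Longrightarrow> \<exists>k. k \<E> omega \<and> m \<E> k \<and> n \<E> k"
proof -
  assume mn: "m \<E> omega" "n \<E> omega"
  then consider "m \<E> n" | "m = n" | "n \<E> m" using Ord_linear Ord_nat by blast
  then show ?thesis
  proof cases
    case 1
    then show ?thesis using mn by (intro exI[of _ "succ n"]) simp
  next
    case 2
    then show ?thesis using mn by (intro exI[of _ "succ n"]) simp
  next
    case 3
    then show ?thesis using mn by (intro exI[of _ "succ m"]) simp
  qed
qed

lemma ex_pair_closed: "\<exists>K. sub A K \<and> (\<forall>x y. x \<E> K \<and> y \<E> K \<longrightarrow> pair x y \<E> K)"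
proof -
  define F where "F n g = un A (prod (funion n g) (funion n g))" for n g
  have "dfn (\<lambda>e. F (e 0) (e (Suc 0)))" unfolding F_def by (intro dfs)
  from Trans_recursion[OF this Trans_omega]
  obtain g where g: "\<forall>n. n \<E> omega \<longrightarrow> app g n = F n (lam n (app g))" ..
  have gA: "z \<E> A \<Longrightarrow> z \<E> app g n" if "n \<E> omega" for n z
    using g that by (simp add: F_def)
  have gP: "pair x y \<E> app g n" if "n \<E> omega" "m \<E> n" "x \<E> app g m" "k \<E> n" "y \<E> app g k" for n m k x y
  proof -
    have "app g n = F n (lam n (app g))" using g that(1) by blast
    then show ?thesis using that by (simp add: F_def in_funion_lam) blast
  qed
  define K where "K = funion omega g"
  have K: "z \<E> K \<longleftrightarrow> (\<exists>n. n \<E> omega \<and> z \<E> app g n)" for z unfolding K_def by (rule in_funion)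
  show ?thesis
  proof (intro exI[of _ K] conjI allI impI)
    show "sub A K" unfolding sub_def using K gA emp_omega by blast
    fix x y assume "x \<E> K \<and> y \<E> K"
    then obtain m k where "m \<E> omega" "x \<E> app g m" "k \<E> omega" "y \<E> app g k" using K by blast
    moreover from this obtain n where "n \<E> omega" "m \<E> n" "k \<E> n" using nat_bound_mem by blast
    ultimately show "pair x y \<E> K" using K gP by blast
  qed
qed

text \<open>Interprets the numbers of HOL in the model; \<open>omega\<close> may have further,
  nonstandard elements.\<close>

primrec num :: "nat \<Rightarrow> 'a" where
  "num 0 = emp"
| "num (Suc n) = succ (num n)"

lemma num_omega [simp]: "num n \<E> omega"
  by (induction n) auto

lemma num_less: "m < n \<Longrightarrow> num m \<E> num n"
  by (induction n) (auto simp: less_Suc_eq)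

lemma num_eq [simp]: "num m = num n \<longleftrightarrow> m = n"
  using num_less mem_irrefl by (metis nat_neq_iff)

definition code :: "nat \<Rightarrow> 'a \<Rightarrow> 'a \<Rightarrow> 'a" where
  "code k a b = pair (num k) (pair a b)"

lemma code_eq [simp]: "code k a b = code l c d \<longleftrightarrow> k = l \<and> a = c \<and> b = d"
  by (simp add: code_def)

lemma dfn_code [dfs]: "dfn s \<Longrightarrow> dfn t \<Longrightarrow> dfn (\<lambda>e. code k (s e) (t e))"
  unfolding code_def by (intro dfs)

definition form_closed :: "'a \<Rightarrow> bool" where
  "form_closed F \<longleftrightarrow>
    (\<forall>i j. i \<E> omega \<and> j \<E> omega \<longrightarrow> code 0 i j \<E> F) \<and>
    (\<forall>i j. i \<E> omega \<and> j \<E> omega \<longrightarrow> code 1 i j \<E> F) \<and>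
    (\<forall>\<phi> \<psi>. \<phi> \<E> F \<and> \<psi> \<E> F \<longrightarrow> code 2 \<phi> \<psi> \<E> F) \<and>
    (\<forall>i \<phi>. i \<E> omega \<and> \<phi> \<E> F \<longrightarrow> code 3 i \<phi> \<E> F)"

lemma df_form_closed [dfs]: "dfn s \<Longrightarrow> df (\<lambda>e. form_closed (s e))"
  by (rule df_comp1[where Q = form_closed], unfold form_closed_def) (intro dfs)

definition Fm :: 'a where "Fm = coll (\<lambda>u. \<forall>F. form_closed F \<longrightarrow> u \<E> F)"

text \<open>Codes are nested pairs over \<open>omega\<close>, so a pair-closed set that includes
  \<open>omega\<close> contains them. It bounds the class of formulas and later also accommodates
  the intermediate pairs from which a code is assembled.\<close>

lemma ex_coded_formulas:
  "\<exists>K. sub omega K \<and> form_closed K \<and> (\<forall>x y. x \<E> K \<and> y \<E> K \<longrightarrow> pair x y \<E> K)"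
proof -
  obtain K where K: "sub omega K" "\<forall>x y. x \<E> K \<and> y \<E> K \<longrightarrow> pair x y \<E> K"
    using ex_pair_closed by blast
  have "code k x y \<E> K" if "x \<E> K" "y \<E> K" for k x y
    unfolding code_def using K that num_omega subD by blast
  then have "form_closed K" unfolding form_closed_def using subD[OF K(1)] by blast
  then show ?thesis using K by blast
qed

lemma in_Fm: "u \<E> Fm \<longleftrightarrow> (\<forall>F. form_closed F \<longrightarrow> u \<E> F)"
proof -
  obtain K where "form_closed K" using ex_coded_formulas by blast
  moreover have "\<exists>b. \<forall>u. u \<E> b \<longleftrightarrow> u \<E> K \<and> (\<forall>F. form_closed F \<longrightarrow> u \<E> F)"
    by (rule separation) (intro dfs)
  ultimately have "\<exists>b. \<forall>u. u \<E> b \<longleftrightarrow> (\<forall>F. form_closed F \<longrightarrow> u \<E> F)" by (elim exE) (rule exI, blast)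
  from in_coll[OF this] show ?thesis by (simp add: Fm_def)
qed

lemma form_closed_Fm: "form_closed Fm"
  unfolding form_closed_def
proof (intro conjI allI impI)
  show "code 2 a b \<E> Fm" if "a \<E> Fm \<and> b \<E> Fm" for a b
    using that unfolding in_Fm form_closed_def by blast
  show "code 3 a b \<E> Fm" if "a \<E> omega \<and> b \<E> Fm" for a b
    using that unfolding in_Fm form_closed_def by blast
qed (unfold in_Fm form_closed_def, blast+)

lemma Fm_intros [simp]:
  "i \<E> omega \<Longrightarrow> j \<E> omega \<Longrightarrow> code 0 i j \<E> Fm"
  "i \<E> omega \<Longrightarrow> j \<E> omega \<Longrightarrow> code (Suc 0) i j \<E> Fm"
  "a \<E> Fm \<Longrightarrow> b \<E> Fm \<Longrightarrow> code 2 a b \<E> Fm"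
  "i \<E> omega \<Longrightarrow> b \<E> Fm \<Longrightarrow> code 3 i b \<E> Fm"
  using form_closed_Fm by (simp_all add: form_closed_def)

text \<open>\<open>Fm\<close> may contain codes of nonstandard length. Statements about all formulas
  of the model therefore cannot be proved by induction on \<open>fm\<close> and go through this
  internal induction, at the price of definability.\<close>

lemma Fm_induct [consumes 2, case_names mem eq nand ex]:
  assumes "df (\<lambda>e. P (e 0))" "u \<E> Fm"
    and "\<And>i j. i \<E> omega \<Longrightarrow> j \<E> omega \<Longrightarrow> P (code 0 i j)"
    and "\<And>i j. i \<E> omega \<Longrightarrow> j \<E> omega \<Longrightarrow> P (code 1 i j)"
    and "\<And>a b. a \<E> Fm \<Longrightarrow> b \<E> Fm \<Longrightarrow> P a \<Longrightarrow> P b \<Longrightarrow> P (code 2 a b)"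
    and "\<And>i a. i \<E> omega \<Longrightarrow> a \<E> Fm \<Longrightarrow> P a \<Longrightarrow> P (code 3 i a)"
  shows "P u"
proof -
  obtain F where F: "u \<E> F \<longleftrightarrow> u \<E> Fm \<and> P u" for u
    by (rule ex_Sep[OF assms(1)]) (rule that)
  have "form_closed F" unfolding form_closed_def F using assms(3-6) by simp
  then show ?thesis using in_Fm assms(2) F by blast
qed

definition upd :: "'a \<Rightarrow> 'a \<Rightarrow> 'a \<Rightarrow> 'a" where
  "upd s i a = un (Sep s (\<lambda>p. \<not> (\<exists>y. p = pair i y))) (upair (pair i a) (pair i a))"

lemma in_upd: "p \<E> upd s i a \<longleftrightarrow> p = pair i a \<or> (p \<E> s \<and> \<not> (\<exists>y. p = pair i y))"
proof -
  have "p \<E> Sep s (\<lambda>p. \<not> (\<exists>y. p = pair i y)) \<longleftrightarrow> p \<E> s \<and> \<not> (\<exists>y. p = pair i y)"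
    by (rule in_Sep) (intro dfs)
  then show ?thesis unfolding upd_def by auto
qed

lemma dfn_upd [dfs]: "dfn s \<Longrightarrow> dfn t \<Longrightarrow> dfn u \<Longrightarrow> dfn (\<lambda>e. upd (s e) (t e) (u e))"
  by (rule dfn_comp3[where F = upd], unfold upd_def) (intro dfs)

lemma isfun_upd:
  assumes s: "isfun s W A" and "i \<E> W" "a \<E> A" shows "isfun (upd s i a) W A"
proof (rule isfunI)
  fix p assume "p \<E> upd s i a"
  then consider "p = pair i a" | "p \<E> s" unfolding in_upd by blast
  then show "\<exists>x y. x \<E> W \<and> y \<E> A \<and> p = pair x y"
    using assms unfolding isfun_def by cases blast+
next
  fix x assume "x \<E> W"
  then show "\<exists>y. pair x y \<E> upd s i a"
    using isfun_pair[OF s] unfolding in_upd pair_eq by blast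
next
  fix x y z assume "pair x y \<E> upd s i a" "pair x z \<E> upd s i a"
  then show "y = z" using isfun_unique[OF s] unfolding in_upd pair_eq by blast
qed

lemma app_upd:
  assumes s: "isfun s W A" and "i \<E> W" "a \<E> A"
  shows app_upd_same: "app (upd s i a) i = a"
    and app_upd_other: "j \<E> W \<Longrightarrow> j \<noteq> i \<Longrightarrow> app (upd s i a) j = app s j"
proof -
  show "app (upd s i a) i = a" by (rule app_eq) (auto simp: in_upd)
  show "app (upd s i a) j = app s j" if "j \<E> W" "j \<noteq> i"
  proof (rule app_eq)
    show "pair j (app s j) \<E> upd s i a" using that isfun_pair[OF s] by (simp add: in_upd)
    show "z = app s j" if "pair j z \<E> upd s i a" for z
      using that isfun_pair[OF s] \<open>j \<noteq> i\<close> by (simp add: in_upd)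
  qed
qed

definition satrel :: "'a \<Rightarrow> 'a \<Rightarrow> bool" where
  "satrel T A \<longleftrightarrow> (\<forall>s. isfun s omega A \<longrightarrow>
    (\<forall>i j. i \<E> omega \<and> j \<E> omega \<longrightarrow> (pair (code 0 i j) s \<E> T \<longleftrightarrow> app s i \<E> app s j)) \<and>
    (\<forall>i j. i \<E> omega \<and> j \<E> omega \<longrightarrow> (pair (code 1 i j) s \<E> T \<longleftrightarrow> app s i = app s j)) \<and>
    (\<forall>\<phi> \<psi>. \<phi> \<E> Fm \<and> \<psi> \<E> Fm \<longrightarrow>
      (pair (code 2 \<phi> \<psi>) s \<E> T \<longleftrightarrow> \<not> (pair \<phi> s \<E> T \<and> pair \<psi> s \<E> T))) \<and>
    (\<forall>i \<phi>. i \<E> omega \<and> \<phi> \<E> Fm \<longrightarrow>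
      (pair (code 3 i \<phi>) s \<E> T \<longleftrightarrow> (\<exists>a. a \<E> A \<and> pair \<phi> (upd s i a) \<E> T))))"

lemma df_satrel [dfs]: "dfn s \<Longrightarrow> dfn t \<Longrightarrow> df (\<lambda>e. satrel (s e) (t e))"
  by (rule df_comp2[where Q = satrel], unfold satrel_def) (intro dfs)

lemma pair_trcl: "x \<E> trcl (pair x y)" "y \<E> trcl (pair x y)"
proof -
  have "upair x y \<E> trcl (pair x y)" using subD[OF sub_trcl[of "pair x y"], of "upair x y"]
    by (simp add: pair_def)
  from TransD[OF Trans_trcl this] show "x \<E> trcl (pair x y)" "y \<E> trcl (pair x y)" by simp_all
qed

lemma code_trcl: "a \<E> trcl (code k a b)" "b \<E> trcl (code k a b)"
proof -
  let ?u = "code k a b"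
  have "pair a b \<E> trcl ?u" unfolding code_def by (rule pair_trcl)
  then have "sub (trcl (pair a b)) (trcl ?u)"
    using Trans_trcl[of ?u] by (intro trcl_least) (auto simp: Trans_def)
  then show "a \<E> trcl (code k a b)" "b \<E> trcl (code k a b)" using pair_trcl subD by blast+
qed

lemma ex_satrel: "\<exists>T. satrel T A"
proof -
  obtain S where S: "s \<E> S \<longleftrightarrow> s \<E> power (prod omega A) \<and> isfun s omega A" for s
    by (rule ex_Sep[of "\<lambda>s. isfun s omega A" "power (prod omega A)"]) (intro dfs, rule that)
  have "s \<E> power (prod omega A)" if "isfun s omega A" for s
    using that unfolding isfun_def in_power sub_def in_prod by blast
  then have S: "s \<E> S \<longleftrightarrow> isfun s omega A" for s using S by blast
  \<comment> \<open>Tarski's clauses with \<open>app g a\<close> standing for the set of assignments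
    that satisfy \<open>a\<close>. Assigning such sets to formulas turns satisfaction into a
    recursion on codes alone.\<close>
  define C where "C u g s \<longleftrightarrow> (\<exists>i j. u = code 0 i j \<and> app s i \<E> app s j) \<or>
    (\<exists>i j. u = code 1 i j \<and> app s i = app s j) \<or>
    (\<exists>a b. u = code 2 a b \<and> \<not> (s \<E> app g a \<and> s \<E> app g b)) \<or>
    (\<exists>i b. u = code 3 i b \<and> (\<exists>a. a \<E> A \<and> upd s i a \<E> app g b))" for u g s
  have df_C: "df (\<lambda>e. C (e 0) (e (Suc 0)) (e (Suc (Suc 0))))" unfolding C_def by (intro dfs)
  define F where "F u g = Sep S (C u g)" for u g
  have inF: "s \<E> F u g \<longleftrightarrow> s \<E> S \<and> C u g s" for s u g
    unfolding F_def by (rule in_Sep) (intro df_comp3[OF df_C] dfs)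
  have "dfn (\<lambda>e. F (e 0) (e (Suc 0)))" unfolding F_def by (intro dfs df_comp3[OF df_C])
  from trcl_recursion[OF this Trans_trcl[of Fm]]
  obtain g where "\<forall>u. u \<E> trcl Fm \<longrightarrow> app g u = F u (lam (trcl u) (app g))" ..
  then have g: "app g u = F u (lam (trcl u) (app g))" if "u \<E> Fm" for u
    using subD[OF sub_trcl that] by blast
  have gl: "app (lam (trcl u) (app g)) a = app g a" if "a \<E> trcl u" for u a
    using that by (intro app_lam dfs)
  have "df (\<lambda>e. e (Suc 0) \<E> app g (e 0))" by (intro dfs)
  then obtain T where T: "\<And>u s. pair u s \<E> T \<longleftrightarrow> u \<E> Fm \<and> s \<E> S \<and> s \<E> app g u"
    by (rule ex_relation[where A = Fm and B = S]) (rule that)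
  have Tu: "pair u s \<E> T \<longleftrightarrow> C u (lam (trcl u) (app g)) s" if "u \<E> Fm" "s \<E> S" for u s
    using T inF g that by simp
  have "satrel T A" unfolding satrel_def
  proof (intro allI impI conjI)
    fix s assume "isfun s omega A"
    then have s: "s \<E> S" using S by blast
    {
      fix i j assume "i \<E> omega \<and> j \<E> omega"
      then show "pair (code 0 i j) s \<E> T \<longleftrightarrow> app s i \<E> app s j"
        using s by (subst Tu) (auto simp: C_def)
    next
      fix i j assume "i \<E> omega \<and> j \<E> omega"
      then show "pair (code 1 i j) s \<E> T \<longleftrightarrow> app s i = app s j"
        using s by (subst Tu) (auto simp: C_def)
    next
      fix a b assume "a \<E> Fm \<and> b \<E> Fm"
      then show "pair (code 2 a b) s \<E> T \<longleftrightarrow> \<not> (pair a s \<E> T \<and> pair b s \<E> T)"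
        using s by (subst Tu) (auto simp: C_def gl code_trcl T)
    next
      fix i b assume "i \<E> omega \<and> b \<E> Fm"
      moreover from this have "upd s i a \<E> S" if "a \<E> A" for a
        using that s S isfun_upd by blast
      ultimately show "pair (code 3 i b) s \<E> T \<longleftrightarrow> (\<exists>a. a \<E> A \<and> pair b (upd s i a) \<E> T)"
        using s by (subst Tu) (auto simp: C_def gl code_trcl T)
    }
  qed
  then show ?thesis ..
qed

lemma satrel_unique:
  assumes T: "satrel T A" "satrel T' A" and "u \<E> Fm"
  shows "\<forall>s. isfun s omega A \<longrightarrow> (pair u s \<E> T \<longleftrightarrow> pair u s \<E> T')"
proof (rule Fm_induct[where P = "\<lambda>u. \<forall>s. isfun s omega A \<longrightarrow> (pair u s \<E> T \<longleftrightarrow> pair u s \<E> T')"])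
  show "df (\<lambda>e. \<forall>s. isfun s omega A \<longrightarrow> (pair (e 0) s \<E> T \<longleftrightarrow> pair (e 0) s \<E> T'))" by (intro dfs)
next
  fix i a assume ia: "i \<E> omega" "a \<E> Fm" and IH: "\<forall>s. isfun s omega A \<longrightarrow> (pair a s \<E> T \<longleftrightarrow> pair a s \<E> T')"
  show "\<forall>s. isfun s omega A \<longrightarrow> (pair (code 3 i a) s \<E> T \<longleftrightarrow> pair (code 3 i a) s \<E> T')"
  proof (intro allI impI)
    fix s assume s: "isfun s omega A"
    have "pair (code 3 i a) s \<E> T \<longleftrightarrow> (\<exists>x. x \<E> A \<and> pair a (upd s i x) \<E> T)"
      using T(1) s ia unfolding satrel_def by blast
    moreover have "pair (code 3 i a) s \<E> T' \<longleftrightarrow> (\<exists>x. x \<E> A \<and> pair a (upd s i x) \<E> T')"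
      using T(2) s ia unfolding satrel_def by blast
    ultimately show "pair (code 3 i a) s \<E> T \<longleftrightarrow> pair (code 3 i a) s \<E> T'"
      using IH isfun_upd[OF s ia(1)] by blast
  qed
qed (use assms in \<open>unfold satrel_def, simp_all\<close>)

definition Sat :: "'a \<Rightarrow> 'a \<Rightarrow> 'a \<Rightarrow> bool" where
  "Sat A u s \<longleftrightarrow> (\<exists>T. satrel T A \<and> pair u s \<E> T)"

lemma df_Sat [dfs]: "dfn s \<Longrightarrow> dfn t \<Longrightarrow> dfn u \<Longrightarrow> df (\<lambda>e. Sat (s e) (t e) (u e))"
  by (rule df_comp3[where Q = Sat], unfold Sat_def) (intro dfs)

lemma Sat_satrel: "satrel T A \<Longrightarrow> u \<E> Fm \<Longrightarrow> isfun s omega A \<Longrightarrow> Sat A u s \<longleftrightarrow> pair u s \<E> T"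
  using satrel_unique unfolding Sat_def by blast

lemma Sat_clauses:
  assumes s: "isfun s omega A"
  shows Sat_mem: "i \<E> omega \<Longrightarrow> j \<E> omega \<Longrightarrow> Sat A (code 0 i j) s \<longleftrightarrow> app s i \<E> app s j"
    and Sat_eq: "i \<E> omega \<Longrightarrow> j \<E> omega \<Longrightarrow> Sat A (code 1 i j) s \<longleftrightarrow> app s i = app s j"
    and Sat_nand: "a \<E> Fm \<Longrightarrow> b \<E> Fm \<Longrightarrow> Sat A (code 2 a b) s \<longleftrightarrow> \<not> (Sat A a s \<and> Sat A b s)"
    and Sat_ex: "i \<E> omega \<Longrightarrow> b \<E> Fm \<Longrightarrow> Sat A (code 3 i b) s \<longleftrightarrow> (\<exists>a. a \<E> A \<and> Sat A b (upd s i a))"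
proof -
  obtain T where T: "satrel T A" using ex_satrel by blast
  note eq = Sat_satrel[OF T]
  show "i \<E> omega \<Longrightarrow> j \<E> omega \<Longrightarrow> Sat A (code 0 i j) s \<longleftrightarrow> app s i \<E> app s j"
    using T s by (simp add: eq) (simp add: satrel_def)
  show "i \<E> omega \<Longrightarrow> j \<E> omega \<Longrightarrow> Sat A (code 1 i j) s \<longleftrightarrow> app s i = app s j"
    using T s by (simp add: eq) (simp add: satrel_def)
  show "a \<E> Fm \<Longrightarrow> b \<E> Fm \<Longrightarrow> Sat A (code 2 a b) s \<longleftrightarrow> \<not> (Sat A a s \<and> Sat A b s)"
    using T s by (simp add: eq) (simp add: satrel_def)
  assume ib: "i \<E> omega" "b \<E> Fm"
  have "Sat A (code 3 i b) s \<longleftrightarrow> (\<exists>a. a \<E> A \<and> pair b (upd s i a) \<E> T)"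
    using T s ib eq[OF Fm_intros(4)] unfolding satrel_def by blast
  then show "Sat A (code 3 i b) s \<longleftrightarrow> (\<exists>a. a \<E> A \<and> Sat A b (upd s i a))"
    using eq[OF ib(2) isfun_upd[OF s ib(1)]] by blast
qed

definition elem :: "'a \<Rightarrow> 'a \<Rightarrow> bool" where
  "elem M N \<longleftrightarrow> (\<exists>x. x \<E> M) \<and> sub M N \<and>
    (\<forall>u s. u \<E> Fm \<and> isfun s omega M \<longrightarrow> (Sat M u s \<longleftrightarrow> Sat N u s))"

text \<open>The code of a concrete formula at depth \<open>d\<close>. Index \<open>i\<close> becomes
  the object variable numbered by the level \<open>d - 1 - i\<close>, so a quantifier at depth
  \<open>d\<close> binds variable \<open>d\<close>; the connectives are reduced to nand and the
  existential quantifier.\<close>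

primrec fcode :: "fm \<Rightarrow> nat \<Rightarrow> 'a" where
  "fcode (FMem i j) = (\<lambda>d. code 0 (num (d - 1 - i)) (num (d - 1 - j)))"
| "fcode (FEq i j) = (\<lambda>d. code 1 (num (d - 1 - i)) (num (d - 1 - j)))"
| "fcode FFalse = (\<lambda>d. code 2 (code 1 emp emp) (code 1 emp emp))"
| "fcode (FImp \<phi> \<psi>) = (\<lambda>d. code 2 (fcode \<phi> d) (code 2 (fcode \<psi> d) (fcode \<psi> d)))"
| "fcode (FAll \<phi>) = (\<lambda>d. let n = code 2 (fcode \<phi> (Suc d)) (fcode \<phi> (Suc d)); x = code 3 (num d) n
     in code 2 x x)"

lemma fcode_Fm [simp]: "fcode \<phi> d \<E> Fm"
  by (induction \<phi> arbitrary: d) (auto simp: Let_def)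

text \<open>Indices beyond \<open>d\<close> are read as level 0, both in the code and in the environment.\<close>

lemma Sat_fcode:
  assumes "0 < d" "isfun s omega A" "\<And>k. k < d \<Longrightarrow> app s (num k) = v k"
  shows "Sat A (fcode \<phi> d) s \<longleftrightarrow> sat {x. x \<E> A} E (\<lambda>i. v (d - 1 - i)) \<phi>"
  using assms
proof (induction \<phi> arbitrary: d s v)
  case (FAll \<phi>)
  note s = FAll.prems(2)
  have step: "Sat A (fcode \<phi> (Suc d)) (upd s (num d) a) \<longleftrightarrow>
      sat {x. x \<E> A} E (case_nat a (\<lambda>i. v (d - 1 - i))) \<phi>" if a: "a \<E> A" for a
  proof -
    have "case_nat a (\<lambda>i. v (d - 1 - i)) = (\<lambda>i. (v(d := a)) (Suc d - 1 - i))"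
      using FAll.prems(1) by (auto simp: fun_eq_iff split: nat.split)
    moreover have "app (upd s (num d) a) (num k) = (v(d := a)) k" if "k < Suc d" for k
      using that FAll.prems app_upd[OF s _ a] by (simp add: less_Suc_eq) auto
    ultimately show ?thesis using FAll.IH[of "Suc d" "upd s (num d) a" "v(d := a)"] isfun_upd[OF s _ a]
      by simp
  qed
  let ?\<phi> = "fcode \<phi> (Suc d)"
  have "Sat A (code 3 (num d) (code 2 ?\<phi> ?\<phi>)) s \<longleftrightarrow> (\<exists>a. a \<E> A \<and> \<not> Sat A ?\<phi> (upd s (num d) a))"
    using Sat_ex[OF s] Sat_nand[OF isfun_upd[OF s num_omega]] by (simp cong: conj_cong)
  then show ?case using step by (simp add: Let_def Sat_nand[OF s] Bex_def)
qed (simp_all add: Sat_mem Sat_eq Sat_nand Sat_eq[unfolded One_nat_def])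

text \<open>The prescribed values are written one after another into the constant assignment with
  value \<open>v 0\<close>, for which \<open>0 < d\<close> is needed.\<close>

lemma ex_assignment:
  assumes "0 < d" "\<And>k. k < d \<Longrightarrow> v k \<E> M"
  shows "\<exists>s. isfun s omega M \<and> (\<forall>k<d. app s (num k) = v k)"
  using assms
proof (induction d)
  case (Suc d)
  have "\<exists>s. isfun s omega M \<and> (\<forall>k<d. app s (num k) = v k)"
  proof (cases "d = 0")
    case True
    have "isfun (lam omega (\<lambda>_. v 0)) omega M"
      by (rule isfun_lam) (use Suc.prems in \<open>auto intro: dfs\<close>)
    then show ?thesis using True by blast
  qed (use Suc in auto)
  then obtain s where s: "isfun s omega M" "\<forall>k<d. app s (num k) = v k" by blast
  have vd: "v d \<E> M" using Suc.prems by blast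
  have "\<forall>k<Suc d. app (upd s (num d) (v d)) (num k) = v k"
    using s(2) app_upd[OF s(1) num_omega vd] by (auto simp: less_Suc_eq)
  then show ?case using isfun_upd[OF s(1) num_omega vd] by blast
qed simp

text \<open>\<open>elem\<close> speaks about coded formulas inside the model. Through
  \<open>fcode\<close> it yields elementarity for every concrete formula evaluated from outside. The
  constant environment \<open>v 0\<close> matches the reading of indices beyond \<open>d\<close> as
  level 0.\<close>

lemma elementarity:
  assumes MN: "elem M N" and d: "0 < d" "\<And>k. k < d \<Longrightarrow> v k \<E> M"
  shows "ev {x. x \<E> M} E (\<lambda>_. v 0) d v \<Phi> \<longleftrightarrow> ev {x. x \<E> N} E (\<lambda>_. v 0) d v \<Phi>"
proof -
  obtain s where s: "isfun s omega M" "\<forall>k<d. app s (num k) = v k" using ex_assignment d by blast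
  have "sub M N" using MN by (simp add: elem_def)
  then have "isfun s omega N" using s(1) unfolding isfun_def sub_def by blast
  moreover have "lenv d v (\<lambda>_. v 0) = (\<lambda>i. v (d - 1 - i))" using d(1) by (auto simp: lenv_def fun_eq_iff)
  ultimately show ?thesis
    using MN s Sat_fcode[OF d(1)] unfolding elem_def ev_def by (metis fcode_Fm)
qed

end

section \<open>The formulas of the statement in a model\<close>

lemma upd_less: "(x :: nat) < d \<Longrightarrow> (v(d := a)) x = v x"
  by auto

context zf_dc
begin

text \<open>Most of the basic notions are absolute between a transitive domain and the whole model,
  since their quantifiers can be bounded. The following evaluations serve both domains: the whole
  model, and the elements of an \<open>h\<close> in which elementarity is exploited.\<close>

definition tdom :: "'a set \<Rightarrow> bool" where
  "tdom D \<longleftrightarrow> (\<forall>x\<in>D. \<forall>y. y \<E> x \<longrightarrow> y \<in> D)"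

definition vok :: "'a set \<Rightarrow> nat \<Rightarrow> (nat \<Rightarrow> 'a) \<Rightarrow> bool" where
  "vok D d v \<longleftrightarrow> (\<forall>k<d. v k \<in> D)"

lemma tdom_UNIV [simp]: "tdom UNIV" and vok_UNIV [simp]: "vok UNIV d v"
  by (simp_all add: tdom_def vok_def)

lemma vok_upd [simp]: "vok D d v \<Longrightarrow> a \<in> D \<Longrightarrow> vok D (Suc d) (v(d := a))"
  by (simp add: vok_def less_Suc_eq)

lemma vokD: "vok D d v \<Longrightarrow> x < d \<Longrightarrow> v x \<in> D"
  by (simp add: vok_def)

lemma tdomD: "tdom D \<Longrightarrow> vok D d v \<Longrightarrow> x < d \<Longrightarrow> a \<E> v x \<Longrightarrow> a \<in> D"
  unfolding tdom_def vok_def by blast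

lemma tdom_mem: "tdom D \<Longrightarrow> x \<in> D \<Longrightarrow> a \<E> x \<Longrightarrow> a \<in> D"
  unfolding tdom_def by blast

lemma ext_iff: "x = y \<longleftrightarrow> (\<forall>z. z \<E> x \<longleftrightarrow> z \<E> y)"
  by (metis extensionality)

lemmas [evs] = upd_less fun_upd_same

declare fun_upd_apply [simp del]

context
  fixes D :: "'a set" and e :: "nat \<Rightarrow> 'a" and d :: nat and v :: "nat \<Rightarrow> 'a"
  assumes D: "tdom D" and v: "vok D d v"
begin

lemma ev_subset: "x < d \<Longrightarrow> y < d \<Longrightarrow> ev D E e d v (x \<^bold>\<subseteq> y) \<longleftrightarrow> sub (v x) (v y)"
proof -
  assume "x < d" "y < d"
  moreover from this have "ev D E e d v (x \<^bold>\<subseteq> y) \<longleftrightarrow> (\<forall>a\<in>D. a \<E> v x \<longrightarrow> a \<E> v y)"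
    unfolding is_subset_def by (simp add: evs)
  ultimately show ?thesis unfolding sub_def using tdomD[OF D v] by blast
qed

lemma ev_empty: "x < d \<Longrightarrow> ev D E e d v (is_empty x) \<longleftrightarrow> v x = emp"
proof -
  assume "x < d"
  moreover from this have "ev D E e d v (is_empty x) \<longleftrightarrow> (\<forall>a\<in>D. \<not> a \<E> v x)"
    unfolding is_empty_def by (simp add: evs)
  moreover have "v x = emp" if "\<forall>a\<in>D. \<not> a \<E> v x"
    by (rule empI) (use that tdomD[OF D v \<open>x < d\<close>] in blast)
  ultimately show ?thesis by auto
qed

lemma ev_inter: "u < d \<Longrightarrow> x < d \<Longrightarrow> y < d \<Longrightarrow>
    ev D E e d v (is_inter u x y) \<longleftrightarrow> (\<forall>z. z \<E> v u \<longleftrightarrow> z \<E> v x \<and> z \<E> v y)"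
proof -
  assume "u < d" "x < d" "y < d"
  moreover from this have "ev D E e d v (is_inter u x y) \<longleftrightarrow> (\<forall>z\<in>D. z \<E> v u \<longleftrightarrow> z \<E> v x \<and> z \<E> v y)"
    unfolding is_inter_def by (simp add: evs)
  ultimately show ?thesis using tdomD[OF D v] by blast
qed

lemma ev_upair: "u < d \<Longrightarrow> x < d \<Longrightarrow> y < d \<Longrightarrow>
    ev D E e d v (is_upair u x y) \<longleftrightarrow> v u = upair (v x) (v y)"
proof -
  assume a: "u < d" "x < d" "y < d"
  then have "ev D E e d v (is_upair u x y) \<longleftrightarrow> (\<forall>z\<in>D. z \<E> v u \<longleftrightarrow> z = v x \<or> z = v y)"
    unfolding is_upair_def by (simp add: evs)
  also have "\<dots> \<longleftrightarrow> (\<forall>z. z \<E> v u \<longleftrightarrow> z \<E> upair (v x) (v y))"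
    using tdomD[OF D v] vokD[OF v] a unfolding in_upair by blast
  also have "\<dots> \<longleftrightarrow> v u = upair (v x) (v y)" by (rule ext_iff[symmetric])
  finally show ?thesis .
qed

lemma ev_succ: "x < d \<Longrightarrow> y < d \<Longrightarrow> ev D E e d v (is_succ y x) \<longleftrightarrow> v y = succ (v x)"
proof -
  assume a: "x < d" "y < d"
  then have "ev D E e d v (is_succ y x) \<longleftrightarrow> (\<forall>z\<in>D. z \<E> v y \<longleftrightarrow> z \<E> v x \<or> z = v x)"
    unfolding is_succ_def by (simp add: evs)
  also have "\<dots> \<longleftrightarrow> (\<forall>z. z \<E> v y \<longleftrightarrow> z \<E> succ (v x))"
    using tdomD[OF D v] vokD[OF v] a unfolding in_succ by blast
  also have "\<dots> \<longleftrightarrow> v y = succ (v x)" by (rule ext_iff[symmetric])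
  finally show ?thesis .
qed

end

lemmas [evs] = ev_subset ev_empty ev_inter ev_upair ev_succ

context
  fixes D :: "'a set" and e :: "nat \<Rightarrow> 'a" and d :: nat and v :: "nat \<Rightarrow> 'a"
  assumes D: "tdom D" and v: "vok D d v"
begin

text \<open>The two intermediate unordered pairs are elements of \<open>v p\<close>, so a transitive
  domain contains them and restricting the quantifiers loses nothing.\<close>

lemma ev_opair: "p < d \<Longrightarrow> x < d \<Longrightarrow> y < d \<Longrightarrow>
    ev D E e d v (is_opair p x y) \<longleftrightarrow> v p = pair (v x) (v y)"
proof -
  assume a: "p < d" "x < d" "y < d"
  then have "ev D E e d v (is_opair p x y) \<longleftrightarrow>
      (\<exists>a\<in>D. \<exists>b\<in>D. a = upair (v x) (v x) \<and> b = upair (v x) (v y) \<and> v p = upair a b)"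
    unfolding is_opair_def
    by (simp add: evs D v cong: bex_cong_simp)
  moreover have "upair (v x) (v x) \<in> D \<and> upair (v x) (v y) \<in> D" if "v p = pair (v x) (v y)"
    using tdomD[OF D v a(1)] that by (simp add: pair_def)
  ultimately show ?thesis unfolding pair_def by blast
qed

end

lemmas [evs] = ev_opair

context
  fixes D :: "'a set" and e :: "nat \<Rightarrow> 'a" and d :: nat and v :: "nat \<Rightarrow> 'a"
  assumes D: "tdom D" and v: "vok D d v"
begin

lemma ev_otriple: "t < d \<Longrightarrow> x < d \<Longrightarrow> y < d \<Longrightarrow> z < d \<Longrightarrow>
    ev D E e d v (is_otriple t x y z) \<longleftrightarrow> v t = pair (v x) (pair (v y) (v z))"
proof -
  assume a: "t < d" "x < d" "y < d" "z < d"
  then have "ev D E e d v (is_otriple t x y z) \<longleftrightarrow> (\<exists>p\<in>D. p = pair (v y) (v z) \<and> v t = pair (v x) p)"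
    unfolding is_otriple_def
    by (simp add: evs D v cong: bex_cong_simp)
  moreover have "pair (v y) (v z) \<in> D" if t: "v t = pair (v x) (pair (v y) (v z))"
  proof (rule tdom_mem[OF D])
    show "upair (v x) (pair (v y) (v z)) \<in> D"
      using tdomD[OF D v a(1)] t by (simp add: pair_def[of "v x"])
  qed simp
  ultimately show ?thesis by blast
qed

lemma ev_rel: "r < d \<Longrightarrow> x < d \<Longrightarrow> y < d \<Longrightarrow> ev D E e d v (rel r x y) \<longleftrightarrow> pair (v x) (v y) \<E> v r"
proof -
  assume a: "r < d" "x < d" "y < d"
  then have "ev D E e d v (rel r x y) \<longleftrightarrow> (\<exists>p\<in>D. p = pair (v x) (v y) \<and> p \<E> v r)"
    unfolding rel_def
    by (simp add: evs D v cong: bex_cong_simp)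
  then show ?thesis using tdomD[OF D v a(1)] by blast
qed

lemma ev_relation: "r < d \<Longrightarrow> x < d \<Longrightarrow> y < d \<Longrightarrow> ev D E e d v (is_relation r x y) \<longleftrightarrow>
    (\<forall>p. p \<E> v r \<longrightarrow> (\<exists>a b. a \<E> v x \<and> b \<E> v y \<and> p = pair a b))"
proof -
  assume a: "r < d" "x < d" "y < d"
  then have "ev D E e d v (is_relation r x y) \<longleftrightarrow>
      (\<forall>p\<in>D. p \<E> v r \<longrightarrow> (\<exists>a\<in>D. \<exists>b\<in>D. a \<E> v x \<and> b \<E> v y \<and> p = pair a b))"
    unfolding is_relation_def
    by (simp add: evs D v cong: bex_cong_simp ball_cong_simp)
  then show ?thesis using tdomD[OF D v] a by blast
qed

end

lemmas [evs] = ev_otriple ev_rel ev_relation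

subsection \<open>Forcing notions\<close>

definition cmp :: "'a \<Rightarrow> 'a \<Rightarrow> 'a \<Rightarrow> 'a \<Rightarrow> bool" where
  "cmp P R p q \<longleftrightarrow> (\<exists>r. r \<E> P \<and> pair r p \<E> R \<and> pair r q \<E> R)"

definition pdense :: "'a \<Rightarrow> 'a \<Rightarrow> 'a \<Rightarrow> bool" where
  "pdense P R D \<longleftrightarrow> sub D P \<and> (\<forall>p. p \<E> P \<longrightarrow> (\<exists>d. d \<E> D \<and> cmp P R p d))"

definition pdense_below :: "'a \<Rightarrow> 'a \<Rightarrow> 'a \<Rightarrow> 'a \<Rightarrow> bool" where
  "pdense_below P R D q \<longleftrightarrow> sub D P \<and>
    (\<forall>p. p \<E> P \<and> pair p q \<E> R \<longrightarrow> (\<exists>d. d \<E> D \<and> cmp P R p d))"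

definition forcing :: "'a \<Rightarrow> 'a \<Rightarrow> 'a \<Rightarrow> 'a \<Rightarrow> bool" where
  "forcing Q P R m \<longleftrightarrow> Q = pair P (pair R m) \<and>
    (\<forall>p. p \<E> R \<longrightarrow> (\<exists>a b. a \<E> P \<and> b \<E> P \<and> p = pair a b)) \<and>
    (\<forall>p. p \<E> P \<longrightarrow> pair p p \<E> R) \<and>
    (\<forall>p q r. pair p q \<E> R \<and> pair q r \<E> R \<longrightarrow> pair p r \<E> R) \<and>
    m \<E> P \<and> (\<forall>p. p \<E> P \<longrightarrow> pair p m \<E> R)"

definition countable :: "'a \<Rightarrow> bool" where
  "countable x \<longleftrightarrow> (\<exists>f. isinj f x omega)"

definition ccc3 :: "'a \<Rightarrow> 'a \<Rightarrow> bool" where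
  "ccc3 P R \<longleftrightarrow> (\<forall>D. pdense P R D \<longrightarrow> (\<exists>C. sub C D \<and> countable C \<and> pdense P R C))"

definition generic :: "'a \<Rightarrow> 'a \<Rightarrow> 'a \<Rightarrow> 'a \<Rightarrow> bool" where
  "generic P R M q \<longleftrightarrow> (\<forall>D. pdense P R D \<and> D \<E> M \<longrightarrow>
    (\<exists>C. (\<forall>z. z \<E> C \<longleftrightarrow> z \<E> D \<and> z \<E> M) \<and> pdense_below P R C q))"

definition suitable :: "'a \<Rightarrow> 'a \<Rightarrow> 'a \<Rightarrow> bool" where
  "suitable Q k M \<longleftrightarrow> countable M \<and> Q \<E> M \<and> (\<exists>h. (\<forall>x. x \<E> h \<longleftrightarrow> inH x k) \<and> elem M h)"

definition mekler :: "'a \<Rightarrow> 'a \<Rightarrow> 'a \<Rightarrow> bool" where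
  "mekler Q P R \<longleftrightarrow> (\<exists>k0. Card k0 \<and> (\<forall>k. Card k \<and> sub k0 k \<longrightarrow>
    (\<forall>M. suitable Q k M \<longrightarrow> (\<forall>q. q \<E> P \<longrightarrow> generic P R M q))))"

context
  fixes D :: "'a set" and e :: "nat \<Rightarrow> 'a" and d :: nat and v :: "nat \<Rightarrow> 'a"
  assumes D: "tdom D" and v: "vok D d v"
begin

lemma ev_map: "f < d \<Longrightarrow> x < d \<Longrightarrow> y < d \<Longrightarrow> ev D E e d v (is_map f x y) \<longleftrightarrow> isfun (v f) (v x) (v y)"
proof -
  assume a: "f < d" "x < d" "y < d"
  define r where "r \<longleftrightarrow> (\<forall>p. p \<E> v f \<longrightarrow> (\<exists>a b. a \<E> v x \<and> b \<E> v y \<and> p = pair a b))"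
  define t where "t \<longleftrightarrow> (\<forall>a\<in>D. a \<E> v x \<longrightarrow> (\<exists>b\<in>D. pair a b \<E> v f \<and> (\<forall>c\<in>D. pair a c \<E> v f \<longrightarrow> c = b)))"
  define t' where "t' \<longleftrightarrow> (\<forall>a. a \<E> v x \<longrightarrow> (\<exists>b. pair a b \<E> v f \<and> (\<forall>c. pair a c \<E> v f \<longrightarrow> c = b)))"
  have "ev D E e d v (is_map f x y) \<longleftrightarrow> r \<and> t"
    unfolding is_map_def r_def t_def using a
    by (simp add: evs D v cong: bex_cong_simp ball_cong_simp)
  moreover have "t \<longleftrightarrow> t'" if r
  proof -
    have "b \<E> v y" if "pair a b \<E> v f" for a b using \<open>r\<close> that unfolding r_def by auto
    then have bD: "b \<in> D" if "pair a b \<E> v f" for a b using tdomD[OF D v a(3)] that by blast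
    show ?thesis unfolding t_def t'_def
      using bD tdomD[OF D v a(2)] by (intro iffI allI ballI impI) (blast, blast)
  qed
  moreover have "isfun (v f) (v x) (v y) \<longleftrightarrow> r \<and> t'" unfolding isfun_def r_def t'_def ..
  ultimately show ?thesis by blast
qed

lemma ev_injection: "f < d \<Longrightarrow> x < d \<Longrightarrow> y < d \<Longrightarrow>
    ev D E e d v (is_injection f x y) \<longleftrightarrow> isinj (v f) (v x) (v y)"
proof -
  assume a: "f < d" "x < d" "y < d"
  then have "ev D E e d v (is_injection f x y) \<longleftrightarrow> isfun (v f) (v x) (v y) \<and>
      (\<forall>a\<in>D. \<forall>b\<in>D. \<forall>c\<in>D. pair a c \<E> v f \<and> pair b c \<E> v f \<longrightarrow> a = b)"
    unfolding is_injection_def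
    by (simp add: evs ev_map D v cong: bex_cong_simp ball_cong_simp)
  moreover have "p \<in> D \<and> q \<in> D" if "isfun (v f) (v x) (v y)" "pair p q \<E> v f" for p q
    using isfunD[OF that] tdomD[OF D v] a by blast
  ultimately show ?thesis unfolding isinj_def by blast
qed

lemma ev_compatible: "P < d \<Longrightarrow> R < d \<Longrightarrow> p < d \<Longrightarrow> q < d \<Longrightarrow>
    ev D E e d v (compatible P R p q) \<longleftrightarrow> cmp (v P) (v R) (v p) (v q)"
proof -
  assume a: "P < d" "R < d" "p < d" "q < d"
  then have "ev D E e d v (compatible P R p q) \<longleftrightarrow>
      (\<exists>r\<in>D. r \<E> v P \<and> pair r (v p) \<E> v R \<and> pair r (v q) \<E> v R)"
    unfolding compatible_def
    by (simp add: evs D v cong: bex_cong_simp)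
  then show ?thesis unfolding cmp_def using tdomD[OF D v a(1)] by blast
qed

end

lemmas [evs] = ev_map ev_injection ev_compatible

lemma ev_predense [evs]:
  assumes D: "tdom D" and v: "vok D d v" and a: "P < d" "R < d" "x < d"
  shows "ev D E e d v (predense P R x) \<longleftrightarrow> pdense (v P) (v R) (v x)"
proof -
  from a have "ev D E e d v (predense P R x) \<longleftrightarrow> sub (v x) (v P) \<and>
      (\<forall>p\<in>D. p \<E> v P \<longrightarrow> (\<exists>b\<in>D. b \<E> v x \<and> cmp (v P) (v R) p b))"
    unfolding predense_def
    by (simp add: evs D v cong: bex_cong_simp ball_cong_simp)
  then show ?thesis unfolding pdense_def using tdomD[OF D v] a by blast
qed

lemma ev_inductive [evs]:
  assumes D: "tdom D" and v: "vok D d v" and a: "x < d"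
  shows "ev D E e d v (is_inductive x) \<longleftrightarrow> indset (v x)"
proof -
  from a have "ev D E e d v (is_inductive x) \<longleftrightarrow> (\<exists>z\<in>D. z = emp \<and> z \<E> v x) \<and>
      (\<forall>b\<in>D. b \<E> v x \<longrightarrow> (\<exists>y\<in>D. y = succ b \<and> y \<E> v x))"
    unfolding is_inductive_def
    by (simp add: evs D v cong: bex_cong_simp ball_cong_simp)
  then show ?thesis unfolding indset_def using tdomD[OF D v a] by blast
qed

text \<open>Leastness is tested only against the inductive sets in \<open>D\<close>. With
  \<open>omega\<close> among them the test is strong enough to force
  \<open>v x = omega\<close>.\<close>

lemma ev_omega [evs]:
  assumes D: "tdom D" and v: "vok D d v" and "omega \<in> D" and a: "x < d"
  shows "ev D E e d v (is_omega x) \<longleftrightarrow> v x = omega"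
proof -
  from a have "ev D E e d v (is_omega x) \<longleftrightarrow> indset (v x) \<and> (\<forall>I\<in>D. indset I \<longrightarrow> sub (v x) I)"
    unfolding is_omega_def
    by (simp add: evs D v cong: bex_cong_simp ball_cong_simp)
  moreover have "sub omega I" if "indset I" for I using that in_omega unfolding sub_def by blast
  moreover have "v x = omega" if "indset (v x)" "sub (v x) omega"
    by (rule sub_antisym[OF that(2) calculation(2)[OF that(1)]])
  ultimately show ?thesis using assms(3) inductive_omega by auto
qed

section \<open>Notions evaluated only in the whole model\<close>

lemma ev_surjection [evs]: "f < d \<Longrightarrow> x < d \<Longrightarrow> y < d \<Longrightarrow>
    ev UNIV E e d v (is_surjection f x y) \<longleftrightarrow> issurj (v f) (v x) (v y)"
  by (simp add: is_surjection_def issurj_def evs)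

lemma ev_countable [evs]: "x < d \<Longrightarrow> ev UNIV E e d v (is_countable x) \<longleftrightarrow> countable (v x)"
  by (simp add: is_countable_def countable_def evs)

lemma ev_transitive [evs]: "x < d \<Longrightarrow> ev UNIV E e d v (is_transitive x) \<longleftrightarrow> Trans (v x)"
  by (simp add: is_transitive_def Trans_def evs)

lemma ev_ordinal [evs]: "x < d \<Longrightarrow> ev UNIV E e d v (is_ordinal x) \<longleftrightarrow> Ord (v x)"
  by (simp add: is_ordinal_def Ord_def evs)

lemma ev_cardinal [evs]: "x < d \<Longrightarrow> ev UNIV E e d v (is_cardinal x) \<longleftrightarrow> Card (v x)"
  by (simp add: is_cardinal_def Card_def evs)

lemma ev_trcl [evs]: "t < d \<Longrightarrow> x < d \<Longrightarrow> ev UNIV E e d v (is_trcl t x) \<longleftrightarrow> v t = trcl (v x)"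
  by (simp add: is_trcl_def istrcl_iff[symmetric] istrcl_def evs)

lemma ev_H [evs]: "h < d \<Longrightarrow> k < d \<Longrightarrow> ev UNIV E e d v (is_H h k) \<longleftrightarrow> (\<forall>x. x \<E> v h \<longleftrightarrow> inH x (v k))"
  by (simp add: is_H_def inH_def evs)

lemma ev_numeral [evs]: "x < d \<Longrightarrow> ev UNIV E e d v (is_numeral k x) \<longleftrightarrow> v x = num k"
  by (induction k arbitrary: d v x) (simp_all add: evs)

lemma ev_code [evs]: "u < d \<Longrightarrow> a < d \<Longrightarrow> b < d \<Longrightarrow>
    ev UNIV E e d v (is_code k u a b) \<longleftrightarrow> v u = code k (v a) (v b)"
  by (simp add: is_code_def code_def evs)

lemma ev_formula_closed [evs]: "F < d \<Longrightarrow> ev UNIV E e d v (formula_closed F) \<longleftrightarrow> form_closed (v F)"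
  by (simp add: formula_closed_def form_closed_def evs)

lemma ev_formula [evs]: "u < d \<Longrightarrow> ev UNIV E e d v (is_formula u) \<longleftrightarrow> v u \<E> Fm"
  by (simp add: is_formula_def in_Fm evs)

lemma ev_assignment [evs]: "s < d \<Longrightarrow> A < d \<Longrightarrow> ev UNIV E e d v (is_assignment s A) \<longleftrightarrow> isfun (v s) omega (v A)"
  by (simp add: is_assignment_def evs)

lemma ev_update [evs]: "t < d \<Longrightarrow> s < d \<Longrightarrow> i < d \<Longrightarrow> a < d \<Longrightarrow>
    ev UNIV E e d v (is_update t s i a) \<longleftrightarrow> v t = upd (v s) (v i) (v a)"
  by (simp add: is_update_def ext_iff[of _ "upd _ _ _"] in_upd evs)

lemma ev_satrel [evs]: 
  assumes "T < d" "A < d" shows "ev UNIV E e d v (is_satrel T A) \<longleftrightarrow> satrel (v T) (v A)"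
proof -
  have val: "(\<exists>x. pair i x \<E> s \<and> (\<exists>y. pair j y \<E> s \<and> x \<E> y)) \<longleftrightarrow> app s i \<E> app s j"
    if "isfun s omega (v A)" "i \<E> omega" "j \<E> omega" for s i j
    using isfun_pair[OF that(1)] that by simp
  have val2: "(\<exists>x. pair i x \<E> s \<and> pair j x \<E> s) \<longleftrightarrow> app s i = app s j"
    if "isfun s omega (v A)" "i \<E> omega" "j \<E> omega" for s i j
    using isfun_pair[OF that(1)] that by auto
  show ?thesis using assms
    unfolding is_satrel_def satrel_def
    by (simp add: val val2 evs cong: conj_cong imp_cong)
qed

lemma ev_satisfies [evs]: "A < d \<Longrightarrow> u < d \<Longrightarrow> s < d \<Longrightarrow>
    ev UNIV E e d v (satisfies A u s) \<longleftrightarrow> Sat (v A) (v u) (v s)"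
  by (simp add: satisfies_def Sat_def evs)

lemma ev_elementary [evs]: "M < d \<Longrightarrow> N < d \<Longrightarrow> ev UNIV E e d v (M \<^bold>\<prec> N) \<longleftrightarrow> elem (v M) (v N)"
  by (simp add: elementary_submodel_def elem_def evs)

lemma ev_forcing [evs]: "Q < d \<Longrightarrow> P < d \<Longrightarrow> R < d \<Longrightarrow> m < d \<Longrightarrow>
    ev UNIV E e d v (is_forcing Q P R m) \<longleftrightarrow> forcing (v Q) (v P) (v R) (v m)"
  by (simp add: is_forcing_def forcing_def evs)

lemma ev_predense_below [evs]: "P < d \<Longrightarrow> R < d \<Longrightarrow> C < d \<Longrightarrow> q < d \<Longrightarrow>
    ev UNIV E e d v (predense_below P R C q) \<longleftrightarrow> pdense_below (v P) (v R) (v C) (v q)"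
  by (simp add: predense_below_def pdense_below_def evs)

lemma ev_CCC3 [evs]: "P < d \<Longrightarrow> R < d \<Longrightarrow> ev UNIV E e d v (CCC3 P R) \<longleftrightarrow> ccc3 (v P) (v R)"
  by (simp add: CCC3_def ccc3_def evs)

lemma ev_generic [evs]: "P < d \<Longrightarrow> R < d \<Longrightarrow> M < d \<Longrightarrow> q < d \<Longrightarrow>
    ev UNIV E e d v (is_generic P R M q) \<longleftrightarrow> generic (v P) (v R) (v M) (v q)"
  by (simp add: is_generic_def generic_def evs)

lemma ev_suitable [evs]: "Q < d \<Longrightarrow> k < d \<Longrightarrow> M < d \<Longrightarrow>
    ev UNIV E e d v (suitable_model Q k M) \<longleftrightarrow> suitable (v Q) (v k) (v M)"
  by (simp add: suitable_model_def suitable_def evs)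

lemma ev_Mekler [evs]: "Q < d \<Longrightarrow> P < d \<Longrightarrow> R < d \<Longrightarrow>
    ev UNIV E e d v (Mekler_CCC Q P R) \<longleftrightarrow> mekler (v Q) (v P) (v R)"
  by (simp add: Mekler_CCC_def mekler_def evs)

lemma dependent_choice:
  assumes "a \<E> A" "\<And>x. x \<E> A \<Longrightarrow> \<exists>y. y \<E> A \<and> pair x y \<E> R"
  shows "\<exists>f. isfun f omega A \<and> (\<forall>n. n \<E> omega \<longrightarrow> pair (app f n) (app f (succ n)) \<E> R)"
proof -
  have "ev UNIV E e0 0 e0 Dependent_Choice" by (rule axiom) (simp add: ZF_DC_def)
  then have "(\<exists>x. x \<E> A) \<and> (\<forall>x. x \<E> A \<longrightarrow> (\<exists>y. y \<E> A \<and> pair x y \<E> R)) \<longrightarrow>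
      (\<exists>f. isfun f omega A \<and> (\<forall>n x y. n \<E> omega \<and> pair n x \<E> f \<and> pair (succ n) y \<E> f \<longrightarrow> pair x y \<E> R))"
    unfolding Dependent_Choice_def by (simp add: evs)
  then obtain f where f: "isfun f omega A"
    "\<forall>n x y. n \<E> omega \<and> pair n x \<E> f \<and> pair (succ n) y \<E> f \<longrightarrow> pair x y \<E> R"
    using assms by blast
  then have "\<forall>n. n \<E> omega \<longrightarrow> pair (app f n) (app f (succ n)) \<E> R"
    using isfun_pair[OF f(1)] by simp
  then show ?thesis using f by blast
qed

subsection \<open>From countable predense subsets to generic conditions\<close>

text \<open>All conditions lie below the maximum, so predense below the maximum is simply predense,
  which passes to every \<open>q\<close>.\<close>

lemma generic_max_iff:
  assumes "forcing Q P R m"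
  shows "(\<forall>q. q \<E> P \<longrightarrow> generic P R M q) \<longleftrightarrow> generic P R M m"
proof
  show "\<forall>q. q \<E> P \<longrightarrow> generic P R M q \<Longrightarrow> generic P R M m"
    using assms unfolding forcing_def by blast
  assume "generic P R M m"
  moreover have "pdense_below P R C q" if "pdense_below P R C m" for C q
    using that assms unfolding pdense_below_def forcing_def by blast
  ultimately show "\<forall>q. q \<E> P \<longrightarrow> generic P R M q" unfolding generic_def by blast
qed

lemma elem_witness:
  assumes "elem M h" "0 < d" "\<And>k. k < d \<Longrightarrow> v k \<E> M"
    and "ev {x. x \<E> h} E (\<lambda>_. v 0) d v (fEx \<Phi>)"
  obtains a where "a \<E> M" "ev {x. x \<E> h} E (\<lambda>_. v 0) (Suc d) (v(d := a)) (\<Phi> d)"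
proof -
  have "ev {x. x \<E> M} E (\<lambda>_. v 0) d v (fEx \<Phi>)" using elementarity[OF assms(1,2), of v "fEx \<Phi>"] assms(3,4) by blast
  then obtain a where a: "a \<E> M" "ev {x. x \<E> M} E (\<lambda>_. v 0) (Suc d) (v(d := a)) (\<Phi> d)"
    by (auto simp: ev_ex)
  have "(v(d := a)) k \<E> M" if "k < Suc d" for k using that a assms(3) by (auto simp: less_Suc_eq fun_upd_apply)
  from elementarity[of M h "Suc d" "v(d := a)", OF assms(1) zero_less_Suc this] a assms(2)
  have "ev {x. x \<E> h} E (\<lambda>_. v 0) (Suc d) (v(d := a)) (\<Phi> d)" by (simp add: upd_less)
  with a(1) show thesis by (rule that)
qed

lemma tdom_pair: "tdom D \<Longrightarrow> pair x y \<in> D \<Longrightarrow> x \<in> D \<and> y \<in> D"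
proof -
  assume D: "tdom D" and p: "pair x y \<in> D"
  have "upair x y \<in> D" by (rule tdom_mem[OF D p]) (simp add: pair_def)
  then show ?thesis using tdom_mem[OF D] by simp
qed

text \<open>Zero is definable in \<open>h\<close>, and a successor is definable from its
  predecessor. The induction is internal, so that nonstandard numbers are reached as well.\<close>

lemma omega_elem:
  assumes el: "elem M h" and h: "tdom {x. x \<E> h}" "omega \<E> h" and n: "n \<E> omega"
  shows "n \<E> M"
proof -
  let ?H = "{x. x \<E> h}"
  have sub: "sub M h" using el by (simp add: elem_def)
  have omh: "k \<E> h" if "k \<E> omega" for k using tdom_mem[OF h(1)] h(2) that by simp
  show ?thesis
  proof (rule omega_induct[where P = "\<lambda>n. n \<E> M", OF _ n])
    show "df (\<lambda>e. e 0 \<E> M)" by (intro dfs)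
    obtain c where c: "c \<E> M" using el by (auto simp: elem_def)
    define v where "v = (\<lambda>_ :: nat. c)"
    have v: "vok ?H 1 v" using c sub by (auto simp: vok_def v_def sub_def)
    have "ev ?H E (\<lambda>_. v 0) 1 v (\<^bold>\<exists>z. is_empty z)"
      using h(1) v omh by (auto simp: evs)
    then obtain a where "a \<E> M" "ev ?H E (\<lambda>_. v 0) (Suc 1) (v(1 := a)) (is_empty 1)"
      by (rule elem_witness[OF el zero_less_one, rotated]) (use c in \<open>auto simp: v_def\<close>)
    moreover from this have "vok ?H (Suc 1) (v(1 := a))" using v sub by (simp add: sub_def)
    ultimately show "emp \<E> M" using h(1) by (simp add: evs)
  next
    fix n assume n: "n \<E> omega" "n \<E> M"
    define v where "v = (\<lambda>_ :: nat. n)"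
    have v: "vok ?H 1 v" using n sub by (auto simp: vok_def v_def sub_def)
    have "ev ?H E (\<lambda>_. v 0) 1 v (\<^bold>\<exists>y. is_succ y 0)"
      using h(1) v omh n by (auto simp: evs v_def)
    then obtain a where "a \<E> M" "ev ?H E (\<lambda>_. v 0) (Suc 1) (v(1 := a)) (is_succ 1 0)"
      by (rule elem_witness[OF el zero_less_one, rotated]) (use n in \<open>auto simp: v_def\<close>)
    moreover from this have "vok ?H (Suc 1) (v(1 := a))" using v sub by (simp add: sub_def)
    ultimately show "succ n \<E> M" using h(1) by (simp add: evs v_def)
  qed
qed

text \<open>The value \<open>n\<close> of \<open>f\<close> at \<open>c\<close> is a natural number
  and hence in \<open>M\<close>, and \<open>c\<close> is definable from \<open>f\<close> and
  \<open>n\<close> as the only point with that value.\<close>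

lemma countable_elem:
  assumes el: "elem M h" and h: "tdom {x. x \<E> h}" "omega \<E> h"
    and f: "f \<E> M" "isinj f C omega" and c: "C \<E> M" "c \<E> C"
  shows "c \<E> M"
proof -
  let ?H = "{x. x \<E> h}"
  have sub: "sub M h" using el by (simp add: elem_def)
  have fn: "isfun f C omega" using f(2) by (simp add: isinj_def)
  define n where "n = app f c"
  have n: "pair c n \<E> f" "n \<E> omega" using isfun_pair[OF fn] isfun_app[OF fn] c(2) by (simp_all add: n_def)
  then have nM: "n \<E> M" using omega_elem[OF el h] by blast
  have ch: "c \<E> h" using tdom_mem[OF h(1)] c sub by (auto simp: sub_def)
  define v where "v = (\<lambda>k :: nat. if k = 0 then f else n)"
  have v: "vok ?H (Suc (Suc 0)) v" using f n nM sub by (auto simp: vok_def v_def sub_def)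
  have "ev ?H E (\<lambda>_. v 0) (Suc (Suc 0)) v (\<^bold>\<exists>c. rel 0 c (Suc 0))"
    using h(1) v n ch by (auto simp: evs) (auto simp: v_def)
  then obtain a where a: "a \<E> M" "ev ?H E (\<lambda>_. v 0) (Suc (Suc (Suc 0))) (v(Suc (Suc 0) := a)) (rel 0 (Suc (Suc 0)) (Suc 0))"
    by (rule elem_witness[OF el zero_less_Suc, rotated]) (use f nM in \<open>auto simp: v_def\<close>)
  moreover from this have "vok ?H (Suc (Suc (Suc 0))) (v(Suc (Suc 0) := a))" using v sub by (simp add: sub_def)
  ultimately have "pair a n \<E> f" using h(1) by (simp add: evs) (simp add: v_def)
  then have "a = c" using f(2) n unfolding isinj_def by blast
  then show ?thesis using a by simp
qed

text \<open>Elementarity finds in \<open>M\<close> some decomposition of \<open>Q\<close>; as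
  pairing is injective, it is the given one.\<close>

lemma forcing_parts_elem:
  assumes el: "elem M h" and h: "tdom {x. x \<E> h}" and Q: "Q \<E> M" "Q = pair P (pair R m)"
  shows "P \<E> M \<and> R \<E> M"
proof -
  let ?H = "{x. x \<E> h}"
  have sub: "sub M h" using el by (simp add: elem_def)
  have Qh: "Q \<in> ?H" using Q sub by (simp add: sub_def)
  then have PRm: "P \<E> h" "R \<E> h" "m \<E> h" using tdom_pair[OF h] Q(2) by blast+
  define v where "v = (\<lambda>_ :: nat. Q)"
  have v: "vok ?H 1 v" using Qh by (simp add: vok_def v_def)
  have "ev ?H E (\<lambda>_. v 0) 1 v (\<^bold>\<exists>P. \<^bold>\<exists>R. \<^bold>\<exists>e. is_otriple 0 P R e)"
    using h v PRm Q(2)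
    by (simp add: evs v_def cong: bex_cong_simp)
  then obtain P' where P': "P' \<E> M" "ev ?H E (\<lambda>_. v 0) (Suc 1) (v(1 := P')) (\<^bold>\<exists>R. \<^bold>\<exists>e. is_otriple 0 1 R e)"
    by (rule elem_witness[OF el zero_less_one, rotated]) (use Q in \<open>auto simp: v_def\<close>)
  have mem1: "(v(1 := P')) k \<E> M" for k using P'(1) Q(1) by (simp add: v_def fun_upd_apply)
  from P' have "ev ?H E (\<lambda>_. (v(1 := P')) 0) (Suc 1) (v(1 := P')) (\<^bold>\<exists>R. \<^bold>\<exists>e. is_otriple 0 1 R e)" by (simp add: upd_less)
  then obtain R' where R': "R' \<E> M"
      "ev ?H E (\<lambda>_. (v(1 := P')) 0) (Suc (Suc 1)) (v(1 := P', Suc 1 := R')) (\<^bold>\<exists>e. is_otriple 0 1 (Suc 1) e)"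
    by (rule elem_witness[where v = "v(1 := P')", OF el zero_less_Suc mem1]) (rule that)
  have v2: "vok ?H (Suc (Suc 1)) (v(1 := P', Suc 1 := R'))"
    using v P' R' sub by (simp add: sub_def)
  have "\<exists>e\<in>?H. Q = pair P' (pair R' e)"
    using R'(2) h v2 by (simp add: evs v_def cong: bex_cong_simp conj_cong)
  then have "P' = P" "R' = R" using Q(2) by auto
  then show ?thesis using P' R' by blast
qed

lemma countable_predense_elem:
  assumes el: "elem M h" and h: "tdom {x. x \<E> h}" "omega \<E> h" and PRD: "P \<E> M" "R \<E> M" "D \<E> M"
    and C: "sub C D" "isinj f C omega" "pdense P R C" "C \<E> h" "f \<E> h"
  obtains C' f' where "C' \<E> M" "f' \<E> M" "sub C' D" "isinj f' C' omega" "pdense P R C'"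
proof -
  let ?H = "{x. x \<E> h}"
  have sub: "sub M h" using el by (simp add: elem_def)
  define v where "v = (\<lambda>k :: nat. if k = 0 then P else if k = Suc 0 then R else D)"
  have v: "vok ?H (Suc (Suc (Suc 0))) v" using PRD sub by (auto simp: vok_def v_def sub_def)
  \<comment> \<open>Levels 0, 1 and 2 hold \<open>P\<close>, \<open>R\<close> and \<open>D\<close>.
    The set \<open>omega\<close> is described within the formula, so it need not be a parameter from
    \<open>M\<close>.\<close>
  define B where "B C f = (\<^bold>\<exists>w. C \<^bold>\<subseteq> Suc (Suc 0) \<^bold>\<and> is_omega w \<^bold>\<and> is_injection f C w \<^bold>\<and> predense 0 (Suc 0) C)" for C f
  have B: "ev ?H E e (Suc (Suc (Suc (Suc (Suc 0))))) (v(Suc (Suc (Suc 0)) := C, Suc (Suc (Suc (Suc 0))) := f)) (B (Suc (Suc (Suc 0))) (Suc (Suc (Suc (Suc 0))))) \<longleftrightarrow>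
      sub C D \<and> isinj f C omega \<and> pdense P R C" if "C \<E> h" "f \<E> h" for e C f
  proof -
    have v2: "vok ?H (Suc (Suc (Suc (Suc (Suc 0))))) (v(Suc (Suc (Suc 0)) := C, Suc (Suc (Suc (Suc 0))) := f))"
      using v that by simp
    then show ?thesis unfolding B_def using h
      by (simp add: evs cong: bex_cong_simp conj_cong) (simp add: v_def)
  qed
  have "ev ?H E (\<lambda>_. v 0) (Suc (Suc (Suc 0))) v (\<^bold>\<exists>C. \<^bold>\<exists>f. B C f)"
    unfolding ev_ex using B[OF C(4,5)] C by blast
  then obtain C' where C': "C' \<E> M" "ev ?H E (\<lambda>_. v 0) (Suc (Suc (Suc (Suc 0)))) (v(Suc (Suc (Suc 0)) := C')) (\<^bold>\<exists>f. B (Suc (Suc (Suc 0))) f)"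
    by (rule elem_witness[OF el zero_less_Suc, rotated]) (use PRD in \<open>auto simp: v_def\<close>)
  have mem1: "(v(Suc (Suc (Suc 0)) := C')) k \<E> M" for k using C'(1) PRD by (simp add: v_def fun_upd_apply)
  from C' have "ev ?H E (\<lambda>_. (v(Suc (Suc (Suc 0)) := C')) 0) (Suc (Suc (Suc (Suc 0)))) (v(Suc (Suc (Suc 0)) := C')) (\<^bold>\<exists>f. B (Suc (Suc (Suc 0))) f)" by (simp add: upd_less)
  then obtain f' where f': "f' \<E> M"
      "ev ?H E (\<lambda>_. (v(Suc (Suc (Suc 0)) := C')) 0) (Suc (Suc (Suc (Suc (Suc 0))))) (v(Suc (Suc (Suc 0)) := C', Suc (Suc (Suc (Suc 0))) := f')) (B (Suc (Suc (Suc 0))) (Suc (Suc (Suc (Suc 0)))))"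
    by (rule elem_witness[where v = "v(Suc (Suc (Suc 0)) := C')", OF el zero_less_Suc mem1]) (rule that)
  have "sub C' D \<and> isinj f' C' omega \<and> pdense P R C'"
    using B f'(2) C'(1) f'(1) subD[OF sub] by blast
  then show thesis using that C'(1) f'(1) by blast
qed

theorem ccc3_imp_mekler:
  assumes F: "forcing Q P R m" and ccc: "ccc3 P R"
  shows "mekler Q P R"
proof -
  \<comment> \<open>All subsets of \<open>Z\<close> belong to \<open>H\<close> of any
    \<open>k\<close> above \<open>lind Z\<close>. Among them are \<open>omega\<close>, every subset
    \<open>C\<close> of \<open>P\<close>, and every map from \<open>C\<close> to
    \<open>omega\<close>, being a subset of \<open>prod P omega\<close>.\<close>
  define Z where "Z = trcl (un (un P omega) (prod P omega))"
  have Z: "Trans Z" "sub (un (un P omega) (prod P omega)) Z"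
    unfolding Z_def by (rule Trans_trcl, rule sub_trcl)
  have gen: "generic P R M q" if k: "sub (lind Z) k" and M: "suitable Q k M" for k M q
    unfolding generic_def
  proof (intro allI impI)
    obtain h where hk: "\<forall>x. x \<E> h \<longleftrightarrow> inH x k" and el: "elem M h" and QM: "Q \<E> M"
      using M unfolding suitable_def by blast
    have h: "tdom {x. x \<E> h}"
      unfolding tdom_def using hk inH_trans subD[OF k emp_in_lind] by blast
    have small: "x \<E> h" if "sub x (un (un P omega) (prod P omega))" for x
      using hk inH_small[OF Z(1) sub_trans[OF that Z(2)] k] by blast
    have om: "omega \<E> h" by (rule small) (simp add: sub_def)
    have PR: "P \<E> M \<and> R \<E> M"
      by (rule forcing_parts_elem[OF el h QM]) (use F in \<open>simp add: forcing_def\<close>)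
    fix D assume D: "pdense P R D \<and> D \<E> M"
    then obtain C f where C: "sub C D" "isinj f C omega" "pdense P R C"
      using ccc unfolding ccc3_def countable_def by blast
    have CP: "sub C P" using C(3) by (simp add: pdense_def)
    have "C \<E> h" by (rule small) (use CP in \<open>simp add: sub_def\<close>)
    moreover have "f \<E> h"
    proof (rule small)
      have "isfun f C omega" using C(2) by (simp add: isinj_def)
      then show "sub f (un (un P omega) (prod P omega))"
        using CP unfolding sub_def in_un isfun_def in_prod by blast
    qed
    ultimately obtain C' f' where C': "C' \<E> M" "f' \<E> M" "sub C' D" "isinj f' C' omega" "pdense P R C'"
      using countable_predense_elem[OF el h om _ _ _ C] PR D by blast
    have C'M: "c \<E> M" if "c \<E> C'" for c
      using countable_elem[OF el h om C'(2,4,1) that] .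
    obtain K where K: "z \<E> K \<longleftrightarrow> z \<E> D \<and> z \<E> M" for z
      by (rule ex_Sep[of "\<lambda>z. z \<E> M" D]) (intro dfs, rule that)
    have "sub K P" using K D by (simp add: pdense_def sub_def)
    moreover have "\<exists>d. d \<E> K \<and> cmp P R p d" if "p \<E> P" for p
      using that C'(5) K C'M subD[OF C'(3)] unfolding pdense_def by blast
    ultimately have "pdense_below P R K q" unfolding pdense_below_def by blast
    then show "\<exists>C. (\<forall>z. z \<E> C \<longleftrightarrow> z \<E> D \<and> z \<E> M) \<and> pdense_below P R C q" using K by blast
  qed
  show ?thesis unfolding mekler_def
    by (rule exI[of _ "lind Z"]) (use gen Card_lind in blast)
qed

subsection \<open>Countable closures from Dependent Choice\<close>

text \<open>The chain that DC produces consists of finite sequences and not of finite sets, so that its union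
  is an enumeration and no further choice is needed.\<close>

definition inran :: "'a \<Rightarrow> 'a \<Rightarrow> bool" where
  "inran g x \<longleftrightarrow> (\<exists>i. pair i x \<E> g)"

definition fseq :: "'a \<Rightarrow> 'a \<Rightarrow> bool" where
  "fseq U g \<longleftrightarrow> (\<exists>n. n \<E> omega \<and> isfun g n U)"

lemma df_inran [dfs]: "dfn s \<Longrightarrow> dfn t \<Longrightarrow> df (\<lambda>e. inran (s e) (t e))"
  by (rule df_comp2[where Q = inran], unfold inran_def) (intro dfs)

lemma df_fseq [dfs]: "dfn s \<Longrightarrow> dfn t \<Longrightarrow> df (\<lambda>e. fseq (s e) (t e))"
  by (rule df_comp2[where Q = fseq], unfold fseq_def) (intro dfs)

lemma inran_mono: "sub g g' \<Longrightarrow> inran g x \<Longrightarrow> inran g' x"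
  unfolding inran_def sub_def by blast

lemma fseq_append:
  assumes "fseq U g" "z \<E> U"
  shows "\<exists>g'. fseq U g' \<and> sub g g' \<and> inran g' z"
proof -
  obtain n where n: "n \<E> omega" "isfun g n U" using assms(1) unfolding fseq_def by blast
  define g' where "g' = un g (upair (pair n z) (pair n z))"
  have g': "p \<E> g' \<longleftrightarrow> p \<E> g \<or> p = pair n z" for p by (simp add: g'_def)
  have nn: "\<not> pair n y \<E> g" for y using isfunD[OF n(2)] mem_irrefl by blast
  have "isfun g' (succ n) U"
  proof (rule isfunI)
    fix p assume "p \<E> g'"
    then consider "p \<E> g" | "p = pair n z" using g' by blast
    then show "\<exists>x y. x \<E> succ n \<and> y \<E> U \<and> p = pair x y"
    proof cases
      case 1
      then show ?thesis using n(2) unfolding isfun_def in_succ by blast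
    next
      case 2
      then show ?thesis using assms(2) by auto
    qed
  next
    fix x assume "x \<E> succ n"
    then show "\<exists>y. pair x y \<E> g'" using isfun_pair[OF n(2)] unfolding g' in_succ by blast
  next
    fix x y y' assume "pair x y \<E> g'" "pair x y' \<E> g'"
    then show "y = y'" using isfun_unique[OF n(2)] nn unfolding g' pair_eq by blast
  qed
  then have "fseq U g'" unfolding fseq_def using succ_omega[OF n(1)] by blast
  moreover have "sub g g'" "inran g' z" using g' unfolding sub_def inran_def by blast+
  ultimately show ?thesis by blast
qed

text \<open>Requirements indexed by the elements of a natural number are met one after another, and
  monotonicity keeps those already met. The choices are hidden in the existential quantifier of an
  internal induction, so no choice principle is invoked.\<close>

lemma extend_all:
  assumes df: "df (\<lambda>e. \<Phi> (e 0) (e (Suc 0)))"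
    and mono: "\<And>i g g'. sub g g' \<Longrightarrow> \<Phi> i g \<Longrightarrow> \<Phi> i g'"
    and step: "\<And>i g. fseq U g \<Longrightarrow> \<exists>g'. fseq U g' \<and> sub g g' \<and> \<Phi> i g'"
    and "n \<E> omega" "fseq U g"
  shows "\<exists>g'. fseq U g' \<and> sub g g' \<and> (\<forall>i. i \<E> n \<longrightarrow> \<Phi> i g')"
proof (rule omega_induct[where P = "\<lambda>n. \<exists>g'. fseq U g' \<and> sub g g' \<and> (\<forall>i. i \<E> n \<longrightarrow> \<Phi> i g')", OF _ assms(4)])
  show "df (\<lambda>e. \<exists>g'. fseq U g' \<and> sub g g' \<and> (\<forall>i. i \<E> e 0 \<longrightarrow> \<Phi> i g'))"
    by (intro dfs df_comp2[OF df])
  show "\<exists>g'. fseq U g' \<and> sub g g' \<and> (\<forall>i. i \<E> emp \<longrightarrow> \<Phi> i g')"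
    using assms(5) in_emp sub_refl by blast
  fix n assume "\<exists>g'. fseq U g' \<and> sub g g' \<and> (\<forall>i. i \<E> n \<longrightarrow> \<Phi> i g')"
  then obtain g1 where g1: "fseq U g1" "sub g g1" "\<forall>i. i \<E> n \<longrightarrow> \<Phi> i g1" by blast
  from step[OF g1(1), of n] obtain g2 where g2: "fseq U g2" "sub g1 g2" "\<Phi> n g2" by blast
  have "\<Phi> i g2" if "i \<E> succ n" for i
    using that g1(3) mono[OF g2(2)] g2(3) unfolding in_succ by blast
  then show "\<exists>g'. fseq U g' \<and> sub g g' \<and> (\<forall>i. i \<E> succ n \<longrightarrow> \<Phi> i g')"
    using g2(1) sub_trans[OF g1(2) g2(2)] by blast
qed

definition handled :: "('a \<Rightarrow> 'a \<Rightarrow> 'a \<Rightarrow> bool) \<Rightarrow> 'a \<Rightarrow> 'a \<Rightarrow> 'a \<Rightarrow> 'a \<Rightarrow> bool" where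
  "handled S U x y g \<longleftrightarrow> (\<exists>z. z \<E> U \<and> S x y z) \<longrightarrow> (\<exists>z. inran g z \<and> S x y z)"

lemma df_handled:
  assumes "df (\<lambda>e. S (e 0) (e (Suc 0)) (e (Suc (Suc 0))))" "dfn s" "dfn t" "dfn u"
  shows "df (\<lambda>e. handled S U (s e) (t e) (u e))"
  by (rule df_comp3[where Q = "handled S U", OF _ assms(2-4)], unfold handled_def)
    (intro dfs df_comp3[OF assms(1)])

lemma handled_mono: "sub g g' \<Longrightarrow> handled S U x y g \<Longrightarrow> handled S U x y g'"
  unfolding handled_def using inran_mono by blast

text \<open>The pairs of elements in the range of \<open>g\<close> are run through by their
  positions \<open>i\<close> and \<open>j\<close>, in two nested uses of \<open>extend_all\<close>.
  That \<open>g\<close> is a sequence is what makes these positions natural numbers.\<close>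

lemma extend_handled:
  assumes df: "df (\<lambda>e. S (e 0) (e (Suc 0)) (e (Suc (Suc 0))))" and g: "fseq U g"
  shows "\<exists>g'. fseq U g' \<and> sub g g' \<and> (\<forall>x y. inran g x \<and> inran g y \<longrightarrow> handled S U x y g')"
proof -
  obtain n where n: "n \<E> omega" "isfun g n U" using g unfolding fseq_def by blast
  have one: "\<exists>g'. fseq U g' \<and> sub g1 g' \<and> (\<forall>y. pair j y \<E> g \<longrightarrow> handled S U x y g')"
    if g1: "fseq U g1" for j x g1
  proof (cases "\<exists>y z. pair j y \<E> g \<and> z \<E> U \<and> S x y z")
    case True
    then obtain y z where yz: "pair j y \<E> g" "z \<E> U" "S x y z" by blast
    from fseq_append[OF g1 yz(2)] obtain g' where g': "fseq U g'" "sub g1 g'" "inran g' z" by blast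
    have "handled S U x y' g'" if "pair j y' \<E> g" for y'
      using isfun_unique[OF n(2) that yz(1)] yz g' unfolding handled_def by blast
    then show ?thesis using g' by blast
  next
    case False
    then show ?thesis using g1 sub_refl unfolding handled_def by blast
  qed
  have inner: "\<exists>g'. fseq U g' \<and> sub g1 g' \<and> (\<forall>j. j \<E> n \<longrightarrow> (\<forall>y. pair j y \<E> g \<longrightarrow> handled S U x y g'))"
    if g1: "fseq U g1" for x g1
  proof (rule extend_all[where \<Phi> = "\<lambda>j g'. \<forall>y. pair j y \<E> g \<longrightarrow> handled S U x y g'", OF _ _ one n(1) g1])
    show "df (\<lambda>e. \<forall>y. pair (e 0) y \<E> g \<longrightarrow> handled S U x y (e (Suc 0)))"
      by (intro dfs df_handled[OF df])
  qed (use handled_mono in blast)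
  let ?\<Phi> = "\<lambda>i g'. \<forall>x. pair i x \<E> g \<longrightarrow> (\<forall>j. j \<E> n \<longrightarrow> (\<forall>y. pair j y \<E> g \<longrightarrow> handled S U x y g'))"
  have "\<exists>g'. fseq U g' \<and> sub g g' \<and> (\<forall>i. i \<E> n \<longrightarrow> ?\<Phi> i g')"
  proof (rule extend_all[where \<Phi> = ?\<Phi>, OF _ _ _ n(1) g])
    show "df (\<lambda>e. ?\<Phi> (e 0) (e (Suc 0)))" by (intro dfs df_handled[OF df])
    show "?\<Phi> i g''" if "sub g' g''" "?\<Phi> i g'" for i g' g''
      using that handled_mono by blast
    show "\<exists>g'. fseq U g' \<and> sub g1 g' \<and> ?\<Phi> i g'" if g1: "fseq U g1" for i g1
    proof (cases "\<exists>x. pair i x \<E> g")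
      case True
      then obtain x where x: "pair i x \<E> g" by blast
      from inner[OF g1, of x] obtain g' where "fseq U g'" "sub g1 g'"
        "\<forall>j. j \<E> n \<longrightarrow> (\<forall>y. pair j y \<E> g \<longrightarrow> handled S U x y g')" by blast
      then show ?thesis using isfun_unique[OF n(2) x] by blast
    next
      case False
      then show ?thesis using g1 sub_refl by blast
    qed
  qed
  then obtain g' where "fseq U g'" "sub g g'" "\<forall>i. i \<E> n \<longrightarrow> ?\<Phi> i g'" by blast
  then show ?thesis using isfunD[OF n(2)] unfolding inran_def by blast
qed

text \<open>\<open>K\<close> is a number of HOL, so the bounded quantifier is a finite conjunction
  of formulas.\<close>

lemma df_all_less:
  fixes K :: nat
  assumes "\<And>k. df (P k)" shows "df (\<lambda>e. \<forall>k<K. P k e)"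
proof (induction K)
  case 0
  show ?case by (simp add: df_bool)
next
  case (Suc K)
  have "(\<lambda>e. \<forall>k<Suc K. P k e) = (\<lambda>e. P K e \<and> (\<forall>k<K. P k e))" by (auto simp: less_Suc_eq)
  then show ?case using df_and[OF assms Suc] by simp
qed

lemma extend_handled_less:
  fixes S :: "nat \<Rightarrow> 'a \<Rightarrow> 'a \<Rightarrow> 'a \<Rightarrow> bool"
  assumes df: "\<And>k. df (\<lambda>e. S k (e 0) (e (Suc 0)) (e (Suc (Suc 0))))" and g: "fseq U g"
  shows "\<exists>g'. fseq U g' \<and> sub g g' \<and> (\<forall>k<K. \<forall>x y. inran g x \<and> inran g y \<longrightarrow> handled (S k) U x y g')"
proof (induction K)
  case 0
  show ?case using g sub_refl by blast
next
  case (Suc K)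
  then obtain g1 where g1: "fseq U g1" "sub g g1"
    "\<forall>k<K. \<forall>x y. inran g x \<and> inran g y \<longrightarrow> handled (S k) U x y g1" by blast
  from extend_handled[OF df[of K] g1(1)] obtain g2 where g2: "fseq U g2" "sub g1 g2"
    "\<forall>x y. inran g1 x \<and> inran g1 y \<longrightarrow> handled (S K) U x y g2" by blast
  have "handled (S k) U x y g2" if "k < Suc K" "inran g x" "inran g y" for k x y
  proof (cases "k = K")
    case True
    then show ?thesis using that g2(3) inran_mono[OF g1(2)] by blast
  next
    case False
    then have "k < K" using that by simp
    then show ?thesis using that g1(3) handled_mono[OF g2(2)] by blast
  qed
  then show ?case using g2(1) sub_trans[OF g1(2) g2(2)] by blast
qed

text \<open>Any two elements of the union occur together at some stage, and the next stage contains
  a solution for them if \<open>U\<close> has one. Because the stages are sequences extending one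
  another, the union is itself an enumeration.\<close>

theorem countable_closure:
  fixes S :: "nat \<Rightarrow> 'a \<Rightarrow> 'a \<Rightarrow> 'a \<Rightarrow> bool"
  assumes df: "\<And>k. df (\<lambda>e. S k (e 0) (e (Suc 0)) (e (Suc (Suc 0))))" and g0: "fseq U g0"
  obtains c where "\<And>n x. pair n x \<E> c \<Longrightarrow> n \<E> omega" "\<And>n x y. pair n x \<E> c \<Longrightarrow> pair n y \<E> c \<Longrightarrow> x = y"
    "sub g0 c" "\<And>k x y z. k < K \<Longrightarrow> inran c x \<Longrightarrow> inran c y \<Longrightarrow> z \<E> U \<Longrightarrow> S k x y z \<Longrightarrow>
      \<exists>z. inran c z \<and> S k x y z"
proof -
  \<comment> \<open>One step deals with all requirements on the current range at once; those on
    elements added by the step wait for the next one.\<close>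
  define next_seq where "next_seq g g' \<longleftrightarrow> sub g g' \<and>
    (\<forall>k<K. \<forall>x y. inran g x \<and> inran g y \<longrightarrow> handled (S k) U x y g')" for g g'
  have df_next: "df (\<lambda>e. next_seq (e 0) (e (Suc 0)))"
    unfolding next_seq_def by (intro dfs df_all_less df_handled[OF df])
  obtain A where A': "g \<E> A \<longleftrightarrow> g \<E> power (prod omega U) \<and> fseq U g \<and> sub g0 g" for g
    by (rule ex_Sep[of "\<lambda>g. fseq U g \<and> sub g0 g" "power (prod omega U)"]) (intro dfs, rule that)
  have "g \<E> power (prod omega U)" if "fseq U g" for g
    using that TransD[OF Trans_omega] unfolding fseq_def isfun_def in_power sub_def in_prod by blast
  then have A: "g \<E> A \<longleftrightarrow> fseq U g \<and> sub g0 g" for g using A' by blast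
  obtain R where R: "\<And>g g'. pair g g' \<E> R \<longleftrightarrow> g \<E> A \<and> g' \<E> A \<and> next_seq g g'"
    by (rule ex_relation[where A = A and B = A, OF df_next]) (rule that)
  have "\<exists>g'. g' \<E> A \<and> pair g g' \<E> R" if "g \<E> A" for g
  proof -
    have "fseq U g" using that A by blast
    from extend_handled_less[where S = S and K = K, OF df this]
    obtain g' where "fseq U g'" "next_seq g g'" unfolding next_seq_def by blast
    moreover from this have "g' \<E> A" using A that sub_trans unfolding next_seq_def by blast
    ultimately show ?thesis using R that by blast
  qed
  moreover have g0A: "g0 \<E> A" using A g0 sub_refl by blast
  ultimately obtain f where f: "isfun f omega A"
    and fR: "\<forall>n. n \<E> omega \<longrightarrow> pair (app f n) (app f (succ n)) \<E> R"
    using dependent_choice by blast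
  have fA: "app f n \<E> A" if "n \<E> omega" for n using isfun_app[OF f that] .
  have fnext: "next_seq (app f n) (app f (succ n))" if "n \<E> omega" for n using fR R that by blast
  have mono: "\<forall>m. m \<E> n \<longrightarrow> sub (app f m) (app f n)" if "n \<E> omega" for n
  proof (rule omega_induct[where P = "\<lambda>n. \<forall>m. m \<E> n \<longrightarrow> sub (app f m) (app f n)", OF _ that])
    show "df (\<lambda>e. \<forall>m. m \<E> e 0 \<longrightarrow> sub (app f m) (app f (e 0)))" by (intro dfs)
    show "\<forall>m. m \<E> emp \<longrightarrow> sub (app f m) (app f emp)" by simp
    fix n assume n: "n \<E> omega" "\<forall>m. m \<E> n \<longrightarrow> sub (app f m) (app f n)"
    have "sub (app f n) (app f (succ n))" using fnext[OF n(1)] by (simp add: next_seq_def)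
    then show "\<forall>m. m \<E> succ n \<longrightarrow> sub (app f m) (app f (succ n))"
      using n(2) sub_trans unfolding in_succ by blast
  qed
  define c where "c = funion omega f"
  have c: "p \<E> c \<longleftrightarrow> (\<exists>n. n \<E> omega \<and> p \<E> app f n)" for p unfolding c_def by (rule in_funion)
  have both: "\<exists>k. k \<E> omega \<and> p \<E> app f k \<and> q \<E> app f k" if pq: "p \<E> c" "q \<E> c" for p q
  proof -
    obtain m n where mn: "m \<E> omega" "p \<E> app f m" "n \<E> omega" "q \<E> app f n" using pq c by blast
    then obtain k where k: "k \<E> omega" "m \<E> k" "n \<E> k" using nat_bound_mem by blast
    then show ?thesis using mono[OF k(1)] mn subD by blast
  qed
  show thesis
  proof (rule that[of c])
    show "n \<E> omega" if p: "pair n x \<E> c" for n x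
    proof -
      obtain k where "k \<E> omega" "pair n x \<E> app f k" using p c by blast
      then obtain l where "l \<E> omega" "isfun (app f k) l U" "pair n x \<E> app f k"
        using fA A unfolding fseq_def by blast
      then show ?thesis using isfunD TransD[OF Trans_omega] by blast
    qed
    show "x = y" if p: "pair n x \<E> c" "pair n y \<E> c" for n x y
    proof -
      obtain k where k: "k \<E> omega" "pair n x \<E> app f k" "pair n y \<E> app f k" using both[OF p] by blast
      then obtain l where "isfun (app f k) l U" using fA A unfolding fseq_def by blast
      then show ?thesis using isfun_unique k by blast
    qed
    show "sub g0 c" unfolding sub_def
      using fA[OF emp_omega] A c emp_omega subD by blast
    fix k x y z assume kxy: "k < K" "inran c x" "inran c y" and z: "z \<E> U" "S k x y z"
    then obtain i j where "pair i x \<E> c" "pair j y \<E> c" unfolding inran_def by blast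
    from both[OF this] obtain n where n: "n \<E> omega" "inran (app f n) x" "inran (app f n) y"
      unfolding inran_def by blast
    then have "handled (S k) U x y (app f (succ n))"
      using fnext[OF n(1)] kxy(1) unfolding next_seq_def by blast
    then obtain z' where "inran (app f (succ n)) z'" "S k x y z'" using z unfolding handled_def by blast
    moreover have "sub (app f (succ n)) c" unfolding sub_def using c succ_omega[OF n(1)] by blast
    ultimately show "\<exists>z. inran c z \<and> S k x y z" using inran_mono by blast
  qed
qed

text \<open>An element goes to its least index in the enumeration, which needs no choice.\<close>

lemma countableI:
  assumes c: "\<And>n x. pair n x \<E> c \<Longrightarrow> n \<E> omega" "\<And>n x y. pair n x \<E> c \<Longrightarrow> pair n y \<E> c \<Longrightarrow> x = y"
    and M: "\<And>x. x \<E> M \<Longrightarrow> inran c x"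
  shows "countable M"
proof -
  have "df (\<lambda>e. pair (e (Suc 0)) (e 0) \<E> c \<and> (\<forall>m. m \<E> e (Suc 0) \<longrightarrow> \<not> pair m (e 0) \<E> c))" by (intro dfs)
  then obtain f where f: "\<And>p. p \<E> f \<Longrightarrow> \<exists>x y. x \<E> M \<and> y \<E> omega \<and> p = pair x y"
    and fp: "\<And>x n. pair x n \<E> f \<longleftrightarrow> x \<E> M \<and> n \<E> omega \<and> (pair n x \<E> c \<and> (\<forall>m. m \<E> n \<longrightarrow> \<not> pair m x \<E> c))"
    by (rule ex_relation[where A = M and B = omega]) (rule that)
  have "isfun f M omega"
  proof (rule isfunI)
    fix x assume x: "x \<E> M"
    then obtain n where n: "pair n x \<E> c" "n \<E> omega" using M c(1) unfolding inran_def by blast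
    have "df (\<lambda>e. pair (e 0) x \<E> c)" by (intro dfs)
    from set_min[OF this n(2,1)] obtain m where "m \<E> omega" "pair m x \<E> c"
      "\<forall>k. k \<E> m \<longrightarrow> k \<E> omega \<longrightarrow> \<not> pair k x \<E> c" by blast
    then have "pair x m \<E> f" using fp x c(1) by blast
    then show "\<exists>n. pair x n \<E> f" ..
  next
    fix x m n assume "pair x m \<E> f" "pair x n \<E> f"
    then show "m = n" using fp Ord_linear[OF Ord_nat Ord_nat, of m n] by blast
  qed (rule f)
  moreover have "x = y" if "pair x n \<E> f" "pair y n \<E> f" for x y n using that fp c(2) by blast
  ultimately show ?thesis unfolding countable_def isinj_def by blast
qed

lemma countable_subset:
  assumes "countable M" "sub C M" shows "countable C"
proof -
  obtain f where f: "isinj f M omega" using assms(1) unfolding countable_def by blast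
  then have fn: "isfun f M omega" and inj: "\<And>x y z. pair x z \<E> f \<Longrightarrow> pair y z \<E> f \<Longrightarrow> x = y"
    unfolding isinj_def by blast+
  have "df (\<lambda>e. pair (e (Suc 0)) (e 0) \<E> f)" by (intro dfs)
  then obtain c where cp: "\<And>n x. pair n x \<E> c \<longleftrightarrow> n \<E> omega \<and> x \<E> M \<and> pair x n \<E> f"
    by (rule ex_relation[where A = omega and B = M]) (rule that)
  show ?thesis
  proof (rule countableI[of c])
    show "inran c x" if "x \<E> C" for x
      using cp isfun_pair[OF fn] isfun_app[OF fn] subD[OF assms(2) that] unfolding inran_def by blast
  qed (use cp inj in blast)+
qed

subsection \<open>The Loewenheim--Skolem theorem\<close>

lemma upd_agree:
  assumes "isfun s omega A" "isfun t omega A" "i \<E> omega" "x \<E> A" "n \<E> omega"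
    and "j \<E> n \<Longrightarrow> app s j = app t j" "j \<E> n"
  shows "app (upd s i x) j = app (upd t i x) j"
proof -
  have "j \<E> omega" using TransD[OF Trans_omega assms(5,7)] .
  then show ?thesis
    using app_upd[OF assms(1,3,4)] app_upd[OF assms(2-4)] assms(6,7) by (cases "j = i") simp_all
qed

text \<open>Satisfaction of \<open>u\<close> depends only on the values below \<open>n\<close>. This
  is needed because a countable enumeration cannot be expected to list all infinite assignments into
  a countable set, but it can list enough of them to match any assignment below
  \<open>n\<close>.\<close>

definition supports :: "'a \<Rightarrow> 'a \<Rightarrow> 'a \<Rightarrow> bool" where
  "supports n A u \<longleftrightarrow> (\<forall>s t. isfun s omega A \<and> isfun t omega A \<and>
    (\<forall>i. i \<E> n \<longrightarrow> app s i = app t i) \<longrightarrow> (Sat A u s \<longleftrightarrow> Sat A u t))"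

lemma df_supports [dfs]: "dfn s \<Longrightarrow> dfn t \<Longrightarrow> dfn u \<Longrightarrow> df (\<lambda>e. supports (s e) (t e) (u e))"
  by (rule df_comp3[where Q = supports], unfold supports_def) (intro dfs)

lemma supportsI:
  assumes "\<And>s t. isfun s omega A \<Longrightarrow> isfun t omega A \<Longrightarrow> (\<And>i. i \<E> n \<Longrightarrow> app s i = app t i) \<Longrightarrow>
    Sat A u s \<longleftrightarrow> Sat A u t"
  shows "supports n A u"
  unfolding supports_def by (intro allI impI, rule assms) blast+

lemma supportsD:
  assumes "supports n A u" "isfun s omega A" "isfun t omega A" "\<And>i. i \<E> n \<Longrightarrow> app s i = app t i"
  shows "Sat A u s \<longleftrightarrow> Sat A u t"
  using assms unfolding supports_def by blast

text \<open>In the quantifier case the bound for the body still works: assignments that agree below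
  \<open>n\<close> do so after the same update.\<close>

lemma Sat_support:
  assumes "u \<E> Fm" shows "\<exists>n. n \<E> omega \<and> supports n A u"
proof (rule Fm_induct[where P = "\<lambda>u. \<exists>n. n \<E> omega \<and> supports n A u", OF _ assms])
  show "df (\<lambda>e. \<exists>n. n \<E> omega \<and> supports n A (e 0))" by (intro dfs)
next
  fix i j assume ij: "i \<E> omega" "j \<E> omega"
  then obtain n where n: "n \<E> omega" "i \<E> n" "j \<E> n" using nat_bound_mem by blast
  have "supports n A (code 0 i j)" by (rule supportsI) (simp add: n Sat_mem[OF _ ij])
  then show "\<exists>n. n \<E> omega \<and> supports n A (code 0 i j)" using n(1) by blast
  have "supports n A (code 1 i j)" by (rule supportsI) (simp add: n Sat_eq[OF _ ij, unfolded One_nat_def])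
  then show "\<exists>n. n \<E> omega \<and> supports n A (code 1 i j)" using n(1) by blast
next
  fix a b assume ab: "a \<E> Fm" "b \<E> Fm"
  assume "\<exists>n. n \<E> omega \<and> supports n A a" "\<exists>n. n \<E> omega \<and> supports n A b"
  then obtain m n where mn: "m \<E> omega" "supports m A a" "n \<E> omega" "supports n A b" by blast
  obtain k where k: "k \<E> omega" "sub m k" "sub n k" using nat_bound[OF mn(1,3)] by blast
  have "supports k A (code 2 a b)"
  proof (rule supportsI)
    fix s t assume st: "isfun s omega A" "isfun t omega A" and eq: "\<And>i. i \<E> k \<Longrightarrow> app s i = app t i"
    have "Sat A a s \<longleftrightarrow> Sat A a t" by (rule supportsD[OF mn(2) st]) (rule eq[OF subD[OF k(2)]])
    moreover have "Sat A b s \<longleftrightarrow> Sat A b t" by (rule supportsD[OF mn(4) st]) (rule eq[OF subD[OF k(3)]])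
    ultimately show "Sat A (code 2 a b) s \<longleftrightarrow> Sat A (code 2 a b) t" using st ab by (simp add: Sat_nand)
  qed
  then show "\<exists>n. n \<E> omega \<and> supports n A (code 2 a b)" using k(1) by blast
next
  fix i a assume ia: "i \<E> omega" "a \<E> Fm" and "\<exists>n. n \<E> omega \<and> supports n A a"
  then obtain n where n: "n \<E> omega" "supports n A a" by blast
  have "supports n A (code 3 i a)"
  proof (rule supportsI)
    fix s t assume s: "isfun s omega A" and t: "isfun t omega A" and eq: "\<And>i. i \<E> n \<Longrightarrow> app s i = app t i"
    have "Sat A a (upd s i x) \<longleftrightarrow> Sat A a (upd t i x)" if x: "x \<E> A" for x
      by (rule supportsD[OF n(2) isfun_upd[OF s ia(1) x] isfun_upd[OF t ia(1) x]])
        (rule upd_agree[OF s t ia(1) x n(1)], rule eq)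
    then show "Sat A (code 3 i a) s \<longleftrightarrow> Sat A (code 3 i a) t"
      unfolding Sat_ex[OF s ia] Sat_ex[OF t ia] by blast
  qed
  then show "\<exists>n. n \<E> omega \<and> supports n A (code 3 i a)" using n(1) by blast
qed

text \<open>The formulas of the model cannot be run through from outside. A single two-place
  requirement, on the code of an existential formula and an assignment, takes care of all of them;
  this is why codes and assignments are enumerated along with the elements of
  \<open>H\<close>.\<close>

theorem loewenheim_skolem:
  assumes "p \<E> H" "q \<E> H"
  shows "\<exists>M. countable M \<and> p \<E> M \<and> q \<E> M \<and> elem M H"
proof -
  obtain K where K: "sub omega K" "form_closed K" "\<And>x y. x \<E> K \<Longrightarrow> y \<E> K \<Longrightarrow> pair x y \<E> K"
    using ex_coded_formulas by blast
  have FmK: "u \<E> K" if "u \<E> Fm" for u using that K(2) in_Fm by blast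
  \<comment> \<open>The four parts hold the elements of \<open>H\<close>, the assignments, the
    numbers and codes, and the pairs of an index and a value that describe an update.\<close>
  define U where "U = un (un H (power (prod omega H))) (un K (prod omega H))"
  have U: "x \<E> U \<longleftrightarrow> x \<E> H \<or> x \<E> power (prod omega H) \<or> x \<E> K \<or> x \<E> prod omega H" for x
    unfolding U_def in_un by blast
  have assignU: "s \<E> U" if "isfun s omega H" for s
    using that unfolding U isfun_def in_power sub_def in_prod by blast
  \<comment> \<open>The requirements are successor, pairing, update and witness. An update has three
    arguments, so the index and the value are packed into one pair. For \<open>k\<close> below 3 the
    solution is unique, so closure yields exactly the intended set.\<close>
  define S where "S k x y z \<longleftrightarrow> (k = (0::nat) \<and> z = succ x) \<or> (k = 1 \<and> z = pair x y) \<or>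
    (k = 2 \<and> (\<exists>i a. y = pair i a \<and> z = upd x i a)) \<or>
    (k = 3 \<and> (\<exists>i u. x = code 3 i u \<and> z \<E> H \<and> Sat H u (upd y i z)))" for k x y z
  have df_S: "df (\<lambda>e. S k (e 0) (e (Suc 0)) (e (Suc (Suc 0))))" for k
    unfolding S_def by (intro dfs)
  \<comment> \<open>The constant assignment is the one from which all other enumerated assignments
    are obtained by updates.\<close>
  define s0 where "s0 = lam omega (\<lambda>_. p)"
  have s0: "isfun s0 omega B" if "p \<E> B" for B
    unfolding s0_def by (rule isfun_lam) (intro dfs, rule that)
  have "isfun emp emp U" by (rule isfunI) simp_all
  then have "fseq U emp" unfolding fseq_def using emp_omega by blast
  from fseq_append[OF this] assms(1) U obtain g1 where g1: "fseq U g1" "inran g1 p" by blast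
  from fseq_append[OF g1(1)] assms(2) U obtain g2 where g2: "fseq U g2" "sub g1 g2" "inran g2 q" by blast
  from fseq_append[OF g2(1) assignU[OF s0[OF assms(1)]]]
  obtain g3 where g3: "fseq U g3" "sub g2 g3" "inran g3 s0" by blast
  have "emp \<E> U" using U subD[OF K(1) emp_omega] by blast
  from fseq_append[OF g3(1) this]
  obtain g4 where g4: "fseq U g4" "sub g3 g4" "inran g4 emp" by blast
  obtain c where c: "\<And>n x. pair n x \<E> c \<Longrightarrow> n \<E> omega" "\<And>n x y. pair n x \<E> c \<Longrightarrow> pair n y \<E> c \<Longrightarrow> x = y"
    "sub g4 c" and closure: "\<And>k x y z. k < 4 \<Longrightarrow> inran c x \<Longrightarrow> inran c y \<Longrightarrow> z \<E> U \<Longrightarrow> S k x y z \<Longrightarrow>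
      \<exists>z. inran c z \<and> S k x y z"
    by (rule countable_closure[where S = S and K = 4, OF df_S g4(1)]) (rule that)
  have init: "inran c p" "inran c q" "inran c s0" "inran c emp"
    using inran_mono g1 g2 g3 g4 c(3) by blast+
  have nat_X: "inran c n" if "n \<E> omega" for n
  proof (rule omega_induct[where P = "inran c", OF _ that])
    show "df (\<lambda>e. inran c (e 0))" by (intro dfs)
    fix n assume n: "n \<E> omega" "inran c n"
    have "succ n \<E> U" using U subD[OF K(1) succ_omega[OF n(1)]] by blast
    from closure[of 0, OF _ n(2) n(2) this] show "inran c (succ n)" by (auto simp: S_def)
  qed (rule init)
  have pair_X: "inran c (pair x y)" if "inran c x" "inran c y" "pair x y \<E> U" for x y
    using closure[of 1, OF _ that] by (auto simp: S_def)
  have code_X: "inran c (code k a b)" if ab: "inran c a" "inran c b" "a \<E> K" "b \<E> K" for k a b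
  proof -
    have abK: "pair a b \<E> K" using K(3)[OF ab(3,4)] .
    then have "inran c (pair a b)" using pair_X[OF ab(1,2)] U by blast
    moreover have "pair (num k) (pair a b) \<E> U" using U K(3)[OF subD[OF K(1) num_omega] abK] by blast
    ultimately show ?thesis unfolding code_def using pair_X[OF nat_X[OF num_omega]] by blast
  qed
  have Fm_X: "inran c u" if "u \<E> Fm" for u
  proof (rule Fm_induct[where P = "inran c", OF _ that])
    show "df (\<lambda>e. inran c (e 0))" by (intro dfs)
  qed (use code_X nat_X FmK subD[OF K(1)] in blast)+
  obtain M where M: "x \<E> M \<longleftrightarrow> x \<E> H \<and> inran c x" for x
    by (rule ex_Sep[of "inran c" H]) (intro dfs, rule that)
  have MH: "sub M H" using M by (simp add: sub_def)
  have asg: "isfun s omega H" if "isfun s omega M" for s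
    using that MH unfolding isfun_def sub_def by blast
  have pM: "p \<E> M" using M assms init by blast
  have upd_X: "inran c (upd s i a)" if "inran c s" "isfun s omega M" "i \<E> omega" "a \<E> M" for s i a
  proof -
    have "pair i a \<E> U" using U that M by simp
    then have "inran c (pair i a)" using pair_X nat_X that M by blast
    moreover have "upd s i a \<E> U" using assignU asg isfun_upd that by blast
    moreover have "S 2 s (pair i a) (upd s i a)" by (simp add: S_def)
    ultimately have "\<exists>z. inran c z \<and> S 2 s (pair i a) z" using closure[of 2] that by simp
    then show ?thesis by (auto simp: S_def)
  qed
  \<comment> \<open>An arbitrary assignment \<open>s\<close> into \<open>M\<close> need not be
    enumerated. Below a given \<open>n\<close> it is copied into the constant assignment by
    successive updates, and the result is enumerated.\<close>
  have approx: "\<exists>s'. inran c s' \<and> isfun s' omega M \<and> (\<forall>i. i \<E> n \<longrightarrow> app s' i = app s i)"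
    if n: "n \<E> omega" and s: "isfun s omega M" for n s
  proof (rule omega_induct[where P = "\<lambda>n. \<exists>s'. inran c s' \<and> isfun s' omega M \<and> (\<forall>i. i \<E> n \<longrightarrow> app s' i = app s i)", OF _ n])
    show "df (\<lambda>e. \<exists>s'. inran c s' \<and> isfun s' omega M \<and> (\<forall>i. i \<E> e 0 \<longrightarrow> app s' i = app s i))" by (intro dfs)
    show "\<exists>s'. inran c s' \<and> isfun s' omega M \<and> (\<forall>i. i \<E> emp \<longrightarrow> app s' i = app s i)"
      using init(3) s0[OF pM] by auto
    fix n assume n: "n \<E> omega" and "\<exists>s'. inran c s' \<and> isfun s' omega M \<and> (\<forall>i. i \<E> n \<longrightarrow> app s' i = app s i)"
    then obtain t where t: "inran c t" "isfun t omega M" "\<forall>i. i \<E> n \<longrightarrow> app t i = app s i" by blast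
    have sn: "app s n \<E> M" using isfun_app[OF s n] .
    let ?t = "upd t n (app s n)"
    have "app ?t i = app s i" if "i \<E> succ n" for i
    proof (cases "i = n")
      case True
      then show ?thesis using app_upd_same[OF t(2) n sn] by simp
    next
      case False
      then have "i \<E> n" using that by simp
      then have "i \<E> omega" using TransD[OF Trans_omega n] by blast
      then show ?thesis using app_upd_other[OF t(2) n sn _ False] t(3) \<open>i \<E> n\<close> by simp
    qed
    then show "\<exists>s'. inran c s' \<and> isfun s' omega M \<and> (\<forall>i. i \<E> succ n \<longrightarrow> app s' i = app s i)"
      using upd_X[OF t(1,2) n sn] isfun_upd[OF t(2) n sn] by blast
  qed
  \<comment> \<open>The assignment is replaced by an enumerated one that agrees with it on a support
    of \<open>u\<close>; closure gives a witness for the replacement, and the support carries it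
    back.\<close>
  have tarski_vaught: "\<exists>z. z \<E> M \<and> Sat H u (upd s i z)"
    if s: "isfun s omega M" and iu: "i \<E> omega" "u \<E> Fm" and a: "a \<E> H" "Sat H u (upd s i a)" for s i u a
  proof -
    obtain n where n: "n \<E> omega" "supports n H u" using Sat_support[OF iu(2)] by blast
    obtain t where t: "inran c t" "isfun t omega M" "\<forall>i. i \<E> n \<longrightarrow> app t i = app s i"
      using approx[OF n(1) s] by blast
    note sH = asg[OF s] and tH = asg[OF t(2)]
    have eq: "Sat H u (upd t i z) \<longleftrightarrow> Sat H u (upd s i z)" if z: "z \<E> H" for z
      by (rule supportsD[OF n(2) isfun_upd[OF tH iu(1) z] isfun_upd[OF sH iu(1) z]])
        (rule upd_agree[OF tH sH iu(1) z n(1)], use t(3) in blast)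
    have "inran c (code 3 i u)" using Fm_X Fm_intros(4)[OF iu] by blast
    moreover have "S 3 (code 3 i u) t a" using a eq by (simp add: S_def)
    moreover have "a \<E> U" using a U by blast
    ultimately have "\<exists>z. inran c z \<and> S 3 (code 3 i u) t z" using closure[of 3] t(1) by simp
    then obtain z where "inran c z" "z \<E> H" "Sat H u (upd t i z)" by (auto simp: S_def)
    then show ?thesis using eq M by blast
  qed
  have sat_eq: "\<forall>s. isfun s omega M \<longrightarrow> (Sat M u s \<longleftrightarrow> Sat H u s)" if "u \<E> Fm" for u
  proof (rule Fm_induct[where P = "\<lambda>u. \<forall>s. isfun s omega M \<longrightarrow> (Sat M u s \<longleftrightarrow> Sat H u s)", OF _ that])
    show "df (\<lambda>e. \<forall>s. isfun s omega M \<longrightarrow> (Sat M (e 0) s \<longleftrightarrow> Sat H (e 0) s))" by (intro dfs)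
  next
    fix i u assume iu: "i \<E> omega" "u \<E> Fm"
      and IH: "\<forall>s. isfun s omega M \<longrightarrow> (Sat M u s \<longleftrightarrow> Sat H u s)"
    show "\<forall>s. isfun s omega M \<longrightarrow> (Sat M (code 3 i u) s \<longleftrightarrow> Sat H (code 3 i u) s)"
    proof (intro allI impI)
      fix s assume s: "isfun s omega M"
      show "Sat M (code 3 i u) s \<longleftrightarrow> Sat H (code 3 i u) s"
        unfolding Sat_ex[OF s iu] Sat_ex[OF asg[OF s] iu]
        using IH isfun_upd[OF s iu(1)] tarski_vaught[OF s iu] subD[OF MH] by blast
    qed
  next
    fix a b assume ab: "a \<E> Fm" "b \<E> Fm"
      and IH: "\<forall>s. isfun s omega M \<longrightarrow> (Sat M a s \<longleftrightarrow> Sat H a s)"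
        "\<forall>s. isfun s omega M \<longrightarrow> (Sat M b s \<longleftrightarrow> Sat H b s)"
    then show "\<forall>s. isfun s omega M \<longrightarrow> (Sat M (code 2 a b) s \<longleftrightarrow> Sat H (code 2 a b) s)"
      using Sat_nand[OF _ ab] asg by blast
  next
    fix i j assume ij: "i \<E> omega" "j \<E> omega"
    show "\<forall>s. isfun s omega M \<longrightarrow> (Sat M (code 0 i j) s \<longleftrightarrow> Sat H (code 0 i j) s)"
      using Sat_mem[OF _ ij] asg by blast
    show "\<forall>s. isfun s omega M \<longrightarrow> (Sat M (code 1 i j) s \<longleftrightarrow> Sat H (code 1 i j) s)"
      using Sat_eq[OF _ ij] asg by blast
  qed
  have "elem M H" unfolding elem_def using pM MH sat_eq by blast
  moreover have "countable M" by (rule countableI[OF c(1,2)]) (use M in blast)+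
  moreover have "q \<E> M" using M assms init by blast
  ultimately show ?thesis using pM by blast
qed

theorem mekler_imp_ccc3:
  assumes F: "forcing Q P R m" and mek: "mekler Q P R"
  shows "ccc3 P R"
  unfolding ccc3_def
proof (intro allI impI)
  fix D assume D: "pdense P R D"
  obtain k0 where k0: "Card k0" "\<And>k M q. Card k \<Longrightarrow> sub k0 k \<Longrightarrow> suitable Q k M \<Longrightarrow> q \<E> P \<Longrightarrow> generic P R M q"
    using mek unfolding mekler_def by blast
  \<comment> \<open>\<open>k0\<close> enters as a subset, so that \<open>lind Z\<close> lies above
    it; \<open>Q\<close> and \<open>D\<close> enter as elements of the transitive set
    \<open>Z\<close>, which puts them into \<open>H\<close> of \<open>lind Z\<close>.\<close>
  define Z where "Z = trcl (un k0 (upair Q D))"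
  have Z: "Trans Z" unfolding Z_def by (rule Trans_trcl)
  have inZ: "x \<E> Z" if "x \<E> un k0 (upair Q D)" for x
    unfolding Z_def using subD[OF sub_trcl that] .
  let ?k = "lind Z"
  have "sub k0 ?k"
    by (rule sub_lind) (use k0(1) inZ in \<open>simp_all add: Card_def sub_def\<close>)
  obtain h where h: "\<forall>x. x \<E> h \<longleftrightarrow> inH x ?k" using ex_H[OF Ord_lind emp_in_lind] by blast
  have inh: "x \<E> h" if "x \<E> Z" for x
    using h inH_small[OF Z _ sub_refl] Z that unfolding Trans_def by blast
  have "Q \<E> h" "D \<E> h" by (intro inh inZ; simp)+
  then obtain M where M: "countable M" "Q \<E> M" "D \<E> M" "elem M h"
    using loewenheim_skolem by blast
  then have "suitable Q ?k M" unfolding suitable_def using h by blast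
  moreover have "m \<E> P" using F by (simp add: forcing_def)
  ultimately have "generic P R M m" using k0(2) Card_lind \<open>sub k0 ?k\<close> by blast
  then obtain C where C: "\<forall>z. z \<E> C \<longleftrightarrow> z \<E> D \<and> z \<E> M" "pdense_below P R C m"
    using D M(3) unfolding generic_def by blast
  have "pdense P R C" using C(2) F unfolding pdense_def pdense_below_def forcing_def by blast
  moreover have "countable C" by (rule countable_subset[OF M(1)]) (use C(1) in \<open>simp add: sub_def\<close>)
  moreover have "sub C D" using C(1) by (simp add: sub_def)
  ultimately show "\<exists>C. sub C D \<and> countable C \<and> pdense P R C" by blast
qed

lemma statement_true:
  "sat UNIV E e0 (sentence (\<^bold>\<forall>\<P> P R e. is_forcing \<P> P R e \<^bold>\<rightarrow>
     (CCC3 P R \<^bold>\<leftrightarrow> Mekler_CCC \<P> P R) \<^bold>\<and>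
     (\<^bold>\<forall>\<kappa> M. is_cardinal \<kappa> \<^bold>\<and> suitable_model \<P> \<kappa> M \<^bold>\<rightarrow>
        ((\<^bold>\<forall>q. q \<^bold>\<in> P \<^bold>\<rightarrow> is_generic P R M q) \<^bold>\<leftrightarrow> is_generic P R M e))))"
proof -
  have "\<forall>Q P R m. forcing Q P R m \<longrightarrow> (ccc3 P R \<longleftrightarrow> mekler Q P R) \<and>
      (\<forall>k M. Card k \<and> suitable Q k M \<longrightarrow>
        ((\<forall>q. q \<E> P \<longrightarrow> generic P R M q) \<longleftrightarrow> generic P R M m))"
    using ccc3_imp_mekler mekler_imp_ccc3 generic_max_iff by blast
  then show ?thesis
    unfolding sat_sentence[of _ _ _ _ e0] by (simp add: evs)
qed

end

section \<open>From models to provability\<close>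

text \<open>Adjoining elements one at a time by Pairing and Union makes every finite subset of the
  domain the extension of a set. For a finite domain this gives a set that contains itself, against
  Foundation.\<close>

lemma no_finite_model:
  assumes ax: "\<And>\<psi>. \<psi> \<in> ZF_DC \<Longrightarrow> sat D E e \<psi>"
  shows "infinite D"
proof
  assume "finite D"
  have ev: "ev D E e 0 e \<Phi>" if "sentence \<Phi> \<in> ZF_DC" for \<Phi>
    using ax[OF that] sat_sentence by blast
  have pairing: "\<exists>u\<in>D. \<forall>z\<in>D. E z u \<longleftrightarrow> z = x \<or> z = y" if "x \<in> D" "y \<in> D" for x y
    using ev[of Pairing] that by (simp add: ZF_DC_def ZF_def Pairing_def is_upair_def evs)
  have union: "\<exists>u\<in>D. \<forall>z\<in>D. E z u \<longleftrightarrow> (\<exists>y\<in>D. E y x \<and> E z y)" if "x \<in> D" for x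
    using ev[of Union_ax] that by (simp add: ZF_DC_def ZF_def Union_ax_def evs)
  have foundation: "\<exists>y\<in>D. E y x \<and> \<not> (\<exists>z\<in>D. E z x \<and> E z y)" if "x \<in> D" "y \<in> D" "E y x" for x y
    using ev[of Foundation] that by (simp add: ZF_DC_def ZF_def Foundation_def evs) blast
  have empty: "\<exists>z\<in>D. \<forall>y\<in>D. \<not> E y z"
    using ev[of Infinity]
    by (simp add: ZF_DC_def ZF_def Infinity_def is_inductive_def is_empty_def evs) blast
  have "\<exists>u\<in>D. \<forall>z\<in>D. E z u \<longleftrightarrow> z \<in> F" if "finite F" "F \<subseteq> D" for F
    using that
  proof (induction F)
    case empty
    then show ?case using \<open>\<exists>z\<in>D. \<forall>y\<in>D. \<not> E y z\<close> by simp
  next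
    case (insert a F)
    then obtain u where u: "u \<in> D" "\<forall>z\<in>D. E z u \<longleftrightarrow> z \<in> F" by auto
    obtain s where s: "s \<in> D" "\<forall>z\<in>D. E z s \<longleftrightarrow> z = a" using pairing[of a a] insert.prems by auto
    obtain p where p: "p \<in> D" "\<forall>z\<in>D. E z p \<longleftrightarrow> z = u \<or> z = s" using pairing[OF u(1) s(1)] by auto
    obtain w where w: "w \<in> D" "\<forall>z\<in>D. E z w \<longleftrightarrow> (\<exists>y\<in>D. E y p \<and> E z y)" using union[OF p(1)] by auto
    have "\<forall>z\<in>D. E z w \<longleftrightarrow> z \<in> insert a F" using w u s p by auto
    then show ?case using w(1) by blast
  qed
  from this[OF \<open>finite D\<close>] obtain u where u: "u \<in> D" "E u u" by blast
  obtain s where s: "s \<in> D" "\<forall>z\<in>D. E z s \<longleftrightarrow> z = u" using pairing[OF u(1) u(1)] by auto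
  then show False using foundation[of s u] u by auto
qed

text \<open>The domain supplied by \<open>completeness\<close> is an infinite set of naturals; its
  increasing enumeration is a bijection with \<open>nat\<close>, along which the model is
  transferred to the whole type.\<close>

lemma zf_dc_completeness:
  assumes "\<And>(E :: nat \<Rightarrow> nat \<Rightarrow> bool) e. zf_dc E e \<Longrightarrow> sat UNIV E e \<phi>"
  shows "ZF_DC \<turnstile> \<phi>"
proof (rule completeness)
  fix D :: "nat set" and E and e :: "nat \<Rightarrow> nat"
  assume e: "range e \<subseteq> D" and ax: "\<And>\<psi>. \<psi> \<in> ZF_DC \<Longrightarrow> sat D E e \<psi>"
  define f where "f = enumerate D"
  have "bij_betw f UNIV D" unfolding f_def by (rule bij_enumerate[OF no_finite_model[OF ax]])
  then have f: "inj f" "range f = D" by (auto simp: bij_betw_def)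
  then have "\<forall>i. \<exists>j. e i = f j" using e by blast
  then obtain e' where "\<forall>i. e i = f (e' i)" by metis
  then have e': "e = (\<lambda>i. f (e' i))" by auto
  have tr: "sat D E e \<psi> \<longleftrightarrow> sat UNIV (\<lambda>x y. E (f x) (f y)) e' \<psi>" for \<psi>
    unfolding e' by (rule sat_transfer[OF f])
  have "zf_dc (\<lambda>x y. E (f x) (f y)) e'"
    by unfold_locales (use ax tr in blast)
  then show "sat D E e \<phi>" unfolding tr by (rule assms)
qed

theorem proposition5p1:
  "ZF_DC \<turnstile> sentence (\<^bold>\<forall>\<P> P R e. is_forcing \<P> P R e \<^bold>\<rightarrow>
     (CCC3 P R \<^bold>\<leftrightarrow> Mekler_CCC \<P> P R) \<^bold>\<and>
     (\<^bold>\<forall>\<kappa> M. is_cardinal \<kappa> \<^bold>\<and> suitable_model \<P> \<kappa> M \<^bold>\<rightarrow>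
        ((\<^bold>\<forall>q. q \<^bold>\<in> P \<^bold>\<rightarrow> is_generic P R M q) \<^bold>\<leftrightarrow> is_generic P R M e)))"
  by (rule zf_dc_completeness[OF zf_dc.statement_true])

end
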